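(* Let $q$ be a prime power and let $d>1$ be an odd divisor of $q+1$. Let $u$ be a proper divisor of $d$ (that is, a positive divisor $u$ of $d$ with $u<d$; $u=1$ is allowed), let $t$ be a positive integer, and set $n=d^{t}u$. Then there exists a flag-transitive non-Desarguesian linear space with $q^{2n}$ points and with $q^{2}$ points on each line that admits a flag-transitive one-dimensional affine automorphism group.
   Context: A finite linear space $\mathcal{L}$ is a point-line incidence structure with finitely many points such that any two distinct points lie on exactly one common line, any point lies on at least two lines, and any line is incident with at least two points. It is non-trivial if some line has more than two points, and nondegenerate if it has four points no three of which are collinear. All linear spaces are assumed finite, non-trivial and nondegenerate. An automorphism of $\mathcal{L}$ consists of a permutation of the points and a permutation of the lines that preserve incidence; an automorphism group of $\mathcal{L}$ is any subgroup of the full automorphism group $\mathrm{Aut}(\mathcal{L})$. A flag is an incident point-line pair. An automorphism group is flag-transitive if it acts transitively on the flags of $\mathcal{L}$, and $\mathcal{L}$ is flag-transitive if it has a flag-transitive automorphism group. Let $p$ be the prime dividing $q$. An automorphism group $G$ of a linear space whose number of points is a power $p^{f}$ is called one-dimensional affine if the point set can be identified with the field $\mathbb{F}_{p^{f}}$ in such a way that $G$ contains all translations $x\mapsto x+v$ ($v\in\mathbb{F}_{p^f}$) and $G\le \mathrm{A\Gamma L}_{1}(p^{f})=\{x\mapsto a x^{\sigma}+v : a\in\mathbb{F}_{p^f}^{*},\ v\in\mathbb{F}_{p^f},\ \sigma\in\mathrm{Aut}(\mathbb{F}_{p^f})\}$. A linear space with $q^{2n}$ points and $q^2$ points on each line is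 Desarguesian if it is isomorphic to the Desarguesian affine space whose points are the vectors of $\mathbb{F}_{q^{2}}^{n}$ and whose lines are the cosets of the one-dimensional $\mathbb{F}_{q^2}$-subspaces; otherwise it is non-Desarguesian. *)

theory Defs
  imports
    "HOL-Algebra.Bij"
    "HOL-Algebra.QuotRing"
    "HOL-Number_Theory.Prime_Powers"
begin

section \<open>Linear spaces\<close>

text \<open>The values of \<open>inc\<close> outside \<open>points \<times> lines\<close> carry no meaning; every definition below
  relativises to \<open>points\<close> and \<open>lines\<close>.\<close>

record ('p, 'l) incidence_structure =
  points :: "'p set"
  lines :: "'l set"
  inc :: "'p \<Rightarrow> 'l \<Rightarrow> bool"

definition points_on :: "('p, 'l) incidence_structure \<Rightarrow> 'l \<Rightarrow> 'p set" where
  "points_on S l = {x \<in> points S. inc S x l}"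

definition lines_through :: "('p, 'l) incidence_structure \<Rightarrow> 'p \<Rightarrow> 'l set" where
  "lines_through S x = {l \<in> lines S. inc S x l}"

definition collinear_points :: "('p, 'l) incidence_structure \<Rightarrow> 'p set \<Rightarrow> bool" where
  "collinear_points S A \<longleftrightarrow> (\<exists>l\<in>lines S. A \<subseteq> points_on S l)"

text \<open>The first three conditions force the set of lines to be finite, so the
  use of \<open>card\<close> in the last one is safe.\<close>

locale finite_linear_space =
  fixes S :: "('p, 'l) incidence_structure"
  assumes finite_points: "finite (points S)"
    and two_points_one_line:
      "\<lbrakk>x \<in> points S; y \<in> points S; x \<noteq> y\<rbrakk> \<Longrightarrow> \<exists>!l. l \<in> lines S \<and> inc S x l \<and> inc S y l"
    and two_points_on_line: "l \<in> lines S \<Longrightarrow> 2 \<le> card (points_on S l)"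
    and two_lines_through_point: "x \<in> points S \<Longrightarrow> 2 \<le> card (lines_through S x)"

definition nontrivial_space :: "('p, 'l) incidence_structure \<Rightarrow> bool" where
  "nontrivial_space S \<longleftrightarrow> (\<exists>l\<in>lines S. 2 < card (points_on S l))"

definition nondegenerate_space :: "('p, 'l) incidence_structure \<Rightarrow> bool" where
  "nondegenerate_space S \<longleftrightarrow>
     (\<exists>A \<subseteq> points S. card A = 4 \<and> (\<forall>B \<subseteq> A. card B = 3 \<longrightarrow> \<not> collinear_points S B))"

definition isomorphic_spaces ::
    "('p, 'l) incidence_structure \<Rightarrow> ('p2, 'l2) incidence_structure \<Rightarrow> bool" where
  "isomorphic_spaces S T \<longleftrightarrow>
     (\<exists>f g. bij_betw f (points S) (points T) \<and> bij_betw g (lines S) (lines T) \<and>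
        (\<forall>x\<in>points S. \<forall>l\<in>lines S. inc T (f x) (g l) \<longleftrightarrow> inc S x l))"


section \<open>Automorphism groups and flag-transitivity\<close>

definition Aut_space :: "('p, 'l) incidence_structure \<Rightarrow> (('p \<Rightarrow> 'p) \<times> ('l \<Rightarrow> 'l)) monoid" where
  "Aut_space S = (BijGroup (points S) \<times>\<times> BijGroup (lines S))
     \<lparr>carrier := {(f, g). f \<in> Bij (points S) \<and> g \<in> Bij (lines S) \<and>
        (\<forall>x\<in>points S. \<forall>l\<in>lines S. inc S (f x) (g l) \<longleftrightarrow> inc S x l)}\<rparr>"

lemma group_Aut_space: "group (Aut_space S)"
proof -
  let ?B = "BijGroup (points S) \<times>\<times> BijGroup (lines S)"
  let ?C = "{(f, g). f \<in> Bij (points S) \<and> g \<in> Bij (lines S) \<and>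
        (\<forall>x\<in>points S. \<forall>l\<in>lines S. inc S (f x) (g l) \<longleftrightarrow> inc S x l)}"
  have B: "group ?B"
    by (intro DirProd_group group_BijGroup)
  have "subgroup ?C ?B"
  proof (rule group.subgroupI[OF B])
    show "?C \<subseteq> carrier ?B"
      by (auto simp: DirProd_def BijGroup_def)
    show "?C \<noteq> {}"
      using id_Bij[of "points S"] id_Bij[of "lines S"] by fastforce
  next
    fix a assume "a \<in> ?C"
    then obtain f g where a: "a = (f, g)" and f: "f \<in> Bij (points S)" and g: "g \<in> Bij (lines S)"
      and fg: "\<And>x l. x \<in> points S \<Longrightarrow> l \<in> lines S \<Longrightarrow> inc S (f x) (g l) \<longleftrightarrow> inc S x l"
      by auto
    let ?f = "\<lambda>x\<in>points S. inv_into (points S) f x"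
    let ?g = "\<lambda>x\<in>lines S. inv_into (lines S) g x"
    have fc: "f \<in> carrier (BijGroup (points S))" and gc: "g \<in> carrier (BijGroup (lines S))"
      using f g by (auto simp: BijGroup_def)
    have "inv\<^bsub>?B\<^esub> a = (?f, ?g)"
      using inv_DirProd[OF group_BijGroup group_BijGroup fc gc] f g a by (simp add: inv_BijGroup)
    moreover have "inc S (?f x) (?g l) \<longleftrightarrow> inc S x l" if "x \<in> points S" "l \<in> lines S" for x l
    proof -
      have "f (inv_into (points S) f x) = x" "g (inv_into (lines S) g l) = l"
        using f g that by (auto simp: Bij_def intro: bij_betw_inv_into_right)
      then show ?thesis
        using fg[OF Bij_inv_into_mem[OF f that(1)] Bij_inv_into_mem[OF g that(2)]] that by simp
    qed
    ultimately show "inv\<^bsub>?B\<^esub> a \<in> ?C"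
      using restrict_inv_into_Bij[OF f] restrict_inv_into_Bij[OF g] by simp
  next
    fix a b assume "a \<in> ?C" "b \<in> ?C"
    then show "a \<otimes>\<^bsub>?B\<^esub> b \<in> ?C"
      by (auto simp: DirProd_def BijGroup_def compose_Bij compose_eq
          Bij_imp_funcset[THEN funcset_mem])
  qed
  then show ?thesis
    unfolding Aut_space_def by (rule group.subgroup_imp_group[OF B])
qed

abbreviation automorphism_group ::
    "('p, 'l) incidence_structure \<Rightarrow> (('p \<Rightarrow> 'p) \<times> ('l \<Rightarrow> 'l)) set \<Rightarrow> bool" where
  "automorphism_group S G \<equiv> subgroup G (Aut_space S)"

definition flags :: "('p, 'l) incidence_structure \<Rightarrow> ('p \<times> 'l) set" where
  "flags S = {(x, l). x \<in> points S \<and> l \<in> lines S \<and> inc S x l}"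

definition flag_transitive_group ::
    "('p, 'l) incidence_structure \<Rightarrow> (('p \<Rightarrow> 'p) \<times> ('l \<Rightarrow> 'l)) set \<Rightarrow> bool" where
  "flag_transitive_group S G \<longleftrightarrow> automorphism_group S G \<and>
     (\<forall>(x, l)\<in>flags S. \<forall>(y, m)\<in>flags S. \<exists>(f, g)\<in>G. f x = y \<and> g l = m)"

definition flag_transitive_space :: "('p, 'l) incidence_structure \<Rightarrow> bool" where
  "flag_transitive_space S \<longleftrightarrow> (\<exists>G. flag_transitive_group S G)"


section \<open>One-dimensional affine groups\<close>

text \<open>Finite fields are represented with a carrier in \<open>nat\<close>. This is no restriction: any finite
  field can be transported to such a carrier, and finite fields of equal order are isomorphic.\<close>

definition finite_field_of_order :: "nat ring \<Rightarrow> nat \<Rightarrow> bool" where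
  "finite_field_of_order K m \<longleftrightarrow> field K \<and> finite (carrier K) \<and> card (carrier K) = m"

definition translation_perms :: "('a, 'b) ring_scheme \<Rightarrow> ('a \<Rightarrow> 'a) set" where
  "translation_perms K = {(\<lambda>x\<in>carrier K. x \<oplus>\<^bsub>K\<^esub> v) |v. v \<in> carrier K}"

definition AGammaL1 :: "('a, 'b) ring_scheme \<Rightarrow> ('a \<Rightarrow> 'a) set" where
  "AGammaL1 K = {(\<lambda>x\<in>carrier K. a \<otimes>\<^bsub>K\<^esub> \<sigma> x \<oplus>\<^bsub>K\<^esub> v) |a v \<sigma>.
     a \<in> carrier K - {\<zero>\<^bsub>K\<^esub>} \<and> v \<in> carrier K \<and> \<sigma> \<in> ring_iso K K}"

text \<open>The permutations of the field \<open>K\<close> induced by a group \<open>G\<close> of automorphisms of \<open>S\<close>, after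
  identifying the points of \<open>S\<close> with the elements of \<open>K\<close> through the bijection \<open>\<phi>\<close>.\<close>

definition induced_perms ::
    "('p, 'l) incidence_structure \<Rightarrow> ('a, 'b) ring_scheme \<Rightarrow> ('p \<Rightarrow> 'a)
      \<Rightarrow> (('p \<Rightarrow> 'p) \<times> ('l \<Rightarrow> 'l)) set \<Rightarrow> ('a \<Rightarrow> 'a) set" where
  "induced_perms S K \<phi> G =
     (\<lambda>(f, g). \<lambda>x\<in>carrier K. \<phi> (f (inv_into (points S) \<phi> x))) ` G"

definition one_dimensional_affine ::
    "('p, 'l) incidence_structure \<Rightarrow> (('p \<Rightarrow> 'p) \<times> ('l \<Rightarrow> 'l)) set \<Rightarrow> bool" where
  "one_dimensional_affine S G \<longleftrightarrow> automorphism_group S G \<and>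
     (\<exists>(p::nat) f K \<phi>. Factorial_Ring.prime p \<and> card (points S) = p ^ f \<and>
        finite_field_of_order K (p ^ f) \<and> bij_betw \<phi> (points S) (carrier K) \<and>
        translation_perms K \<subseteq> induced_perms S K \<phi> G \<and> induced_perms S K \<phi> G \<subseteq> AGammaL1 K)"


section \<open>Desarguesian affine spaces\<close>

text \<open>Vectors of the \<open>n\<close>-dimensional coordinate space over \<open>K\<close> are extensional functions
  on \<open>{..<n}\<close>.\<close>

definition vectors :: "('a, 'b) ring_scheme \<Rightarrow> nat \<Rightarrow> (nat \<Rightarrow> 'a) set" where
  "vectors K n = {..<n} \<rightarrow>\<^sub>E carrier K"

definition vec_span1 :: "('a, 'b) ring_scheme \<Rightarrow> nat \<Rightarrow> (nat \<Rightarrow> 'a) \<Rightarrow> (nat \<Rightarrow> 'a) set" where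
  "vec_span1 K n w = {(\<lambda>i\<in>{..<n}. c \<otimes>\<^bsub>K\<^esub> w i) |c. c \<in> carrier K}"

definition one_dim_subspaces :: "('a, 'b) ring_scheme \<Rightarrow> nat \<Rightarrow> (nat \<Rightarrow> 'a) set set" where
  "one_dim_subspaces K n =
     {vec_span1 K n w |w. w \<in> vectors K n \<and> w \<noteq> (\<lambda>i\<in>{..<n}. \<zero>\<^bsub>K\<^esub>)}"

definition vec_coset ::
    "('a, 'b) ring_scheme \<Rightarrow> nat \<Rightarrow> (nat \<Rightarrow> 'a) \<Rightarrow> (nat \<Rightarrow> 'a) set \<Rightarrow> (nat \<Rightarrow> 'a) set" where
  "vec_coset K n v U = {(\<lambda>i\<in>{..<n}. v i \<oplus>\<^bsub>K\<^esub> u i) |u. u \<in> U}"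

definition desarguesian_affine_space ::
    "('a, 'b) ring_scheme \<Rightarrow> nat \<Rightarrow> (nat \<Rightarrow> 'a, (nat \<Rightarrow> 'a) set) incidence_structure" where
  "desarguesian_affine_space K n =
     \<lparr>points = vectors K n,
      lines = {vec_coset K n v U |v U. v \<in> vectors K n \<and> U \<in> one_dim_subspaces K n},
      inc = (\<in>)\<rparr>"

text \<open>For a linear space with \<open>q ^ (2 * n)\<close> points and \<open>q ^ 2\<close> points on each line.\<close>

definition desarguesian :: "nat \<Rightarrow> nat \<Rightarrow> ('p, 'l) incidence_structure \<Rightarrow> bool" where
  "desarguesian q n S \<longleftrightarrow>
     (\<exists>K. finite_field_of_order K (q ^ 2) \<and>
          isomorphic_spaces S (desarguesian_affine_space K n))"

end

theory Submission
  imports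
    Defs
    "HOL-Number_Theory.Residues"
    "HOL-Algebra.Algebraic_Closure"
    "HOL-Algebra.Multiplicative_Group"
    "HOL-Algebra.Group_Action"
begin

text \<open>Write \<open>Q = q^2\<close>, let \<open>K\<close> be the field of order \<open>Q^n\<close> and \<open>F\<close> its subfield of order \<open>q\<close>. The number
\<open>n > 1\<close> is odd, and every prime dividing \<open>n = d^t u\<close> divides \<open>d\<close> and therefore \<open>q + 1\<close>; these are the
facts that drive the construction.

\<^bold>\<open>The spaces.\<close> Choose \<open>b\<close> in \<open>K\<close> of multiplicative order \<open>n (Q - 1)\<close>. Then \<open>c = b^n\<close> generates the
multiplicative group of the subfield of order \<open>Q\<close>, and the conjugates \<open>b^(Q^i)\<close>, \<open>i < n\<close>, are
the \<open>n\<close> distinct roots of \<open>X^n - c\<close> (\<open>conj_inj\<close>, by lifting the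
exponent, \<open>dvd_repunit_iff\<close>). Hence the norm \<open>N\<close> from \<open>K\<close> to the subfield of order \<open>Q\<close>
satisfies \<open>N(x + y b) = x^n + y^n c\<close> for \<open>x, y\<close> in \<open>F\<close> (\<open>norm_formula\<close>). Let \<open>L\<close> be the \<open>F\<close>-span of
\<open>1\<close> and \<open>b\<close>, and let \<open>C\<close> consist of the nonzero \<open>a\<close> with \<open>N(a)\<close> in \<open>F\<close>, a group of index \<open>q + 1\<close>. Since \<open>c\<close> is not
in \<open>F\<close> and \<open>x \<mapsto> x^n\<close> permutes \<open>F\<close>, two elements of \<open>L\<close> whose norms differ by a factor from \<open>F\<close>
differ themselves by a factor from \<open>F\<close> (\<open>pow_M_inj\<close>). So the \<open>q + 1\<close> one-dimensional subspaces of
\<open>L\<close> represent the \<open>q + 1\<close> cosets of \<open>C\<close>, and the sets \<open>k L\<close> with \<open>k \<in> C\<close> form a spread of \<open>K\<close>: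
they cover \<open>K\<close> and meet pairwise in \<open>0\<close>. The lines of the space are the translates \<open>v + k L\<close>. The maps
\<open>x \<mapsto> a x + v\<close> with \<open>a \<in> C\<close> act transitively on points, and those fixing \<open>0\<close> act transitively on
the spread, so they are transitive on flags.

\<^bold>\<open>They are not Desarguesian.\<close> In the affine space of dimension \<open>n\<close> over the field of order \<open>Q\<close>, a
line and a point off it generate a plane with \<open>Q^2\<close> points. Suppose that the same holds in the new
space. Then the number of planes on the line \<open>L\<close> is \<open>(Q^(n-1) - 1) / (Q - 1)\<close>, which is
prime to the characteristic \<open>p\<close>, so the \<open>p\<close>-group of translations by elements of \<open>L\<close> fixes one of them, say \<open>W\<close> (\<open>not_planes_have_card\<close>). This
\<open>W\<close> is the sum of \<open>L\<close> and another spread element, hence an additive group that is a union of spread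
elements. Such a \<open>W\<close> does not exist (\<open>no_spread_closed_plane\<close>). Indeed, for \<open>k \<in> C \<inter> W\<close> also
\<open>b k \<in> k L \<subseteq> W\<close>, so all \<open>q^2 + 1\<close> projective points of \<open>W\<close> that lie in \<open>C\<close> lie in
\<open>U = W \<inter> b^(-1) W\<close>. Multiplication by \<open>b\<close> has orbits of length \<open>n (Q - 1)\<close>, which does not divide
\<open>q^4 - 1\<close>, so \<open>U \<noteq> W\<close> and \<open>U\<close> has at most \<open>q\<close> points outside \<open>C\<close>. The subspace
\<open>V = U \<inter> b^(-1) U\<close> has dimension at least two, and for each nonzero \<open>g \<in> V\<close> the set \<open>g L\<close> lies in \<open>U\<close> and
has exactly \<open>q \<ge> 2\<close> points outside \<open>C\<close>. So these sets \<open>g L\<close> share two points, are all equal, and equal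
\<open>V\<close>; then \<open>b V = V\<close>, which the orbit length excludes again.\<close>

section \<open>Divisibility of repunits\<close>

lemma repunit_geometric:
  fixes x m :: nat
  shows "(x - 1) * (\<Sum>i<m. x ^ i) = x ^ m - 1"
proof (cases "x = 0")
  case True
  then show ?thesis by (cases m) auto
next
  case False
  have "int ((x - 1) * (\<Sum>i<m. x ^ i)) = int (x ^ m - 1)"
    using False power_diff_1_eq[of "int x" m] by (simp add: of_nat_diff)
  then show ?thesis by linarith
qed

lemma dvd_repunit_iff_of_cong:
  fixes r x k :: nat
  assumes "[x = 1] (mod r)"
  shows "r dvd (\<Sum>i<k. x ^ i) \<longleftrightarrow> r dvd k"
proof -
  have "[(\<Sum>i<k. x ^ i) = (\<Sum>i<k. 1)] (mod r)"
    by (intro cong_sum) (use cong_pow[OF assms] in simp)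
  then show ?thesis by (simp add: cong_dvd_iff)
qed

text \<open>Writing \<open>x = 1 + r y\<close>, the sum is \<open>r + r y (0 + 1 + \<dots> + (r - 1))\<close> modulo \<open>r^2\<close>, and for odd \<open>r\<close>
the inner sum is itself divisible by \<open>r\<close>.\<close>

lemma repunit_prime_exact:
  fixes r x :: nat
  assumes r: "Factorial_Ring.prime r" "odd r" and x: "[x = 1] (mod r)"
  shows "\<exists>w. (\<Sum>i<r. x ^ i) = r * w \<and> \<not> r dvd w"
proof -
  have "\<exists>y::int. int x = 1 + int r * y"
  proof -
    have "int r dvd int x - 1" using x by (simp add: cong_iff_dvd_diff flip: cong_int_iff)
    then obtain y where "int x - 1 = int r * y" by auto
    then show ?thesis by (intro exI[of _ y]) simp
  qed
  then obtain y where y: "int x = 1 + int r * y" by blast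
  let ?R = "int r"
  have pow: "[int x ^ i = 1 + int i * (?R * y)] (mod (?R ^ 2))" for i
  proof (induction i)
    case (Suc i)
    have "[int x * int x ^ i = (1 + ?R * y) * (1 + int i * (?R * y))] (mod (?R ^ 2))"
      using Suc y by (intro cong_mult) auto
    also have "(1 + ?R * y) * (1 + int i * (?R * y)) = (1 + int (Suc i) * (?R * y)) + ?R^2 * (int i * y^2)"
      by (simp add: algebra_simps power2_eq_square)
    also have "[\<dots> = 1 + int (Suc i) * (?R * y)] (mod (?R ^ 2))"
      by (simp add: cong_iff_dvd_diff)
    finally show ?case by simp
  qed simp
  have "[(\<Sum>i<r. int x ^ i) = (\<Sum>i<r. 1 + int i * (?R * y))] (mod (?R^2))"
    by (intro cong_sum pow)
  also have "(\<Sum>i<r. 1 + int i * (?R * y)) = ?R + ?R * y * (\<Sum>i<r. int i)"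
    by (simp add: sum.distrib sum_distrib_left sum_distrib_right mult.commute)
  also have "(\<Sum>i<r. int i) = ?R * ((?R - 1) div 2)"
  proof -
    have "2 * (\<Sum>i<m. int i) = int m * (int m - 1)" for m
      by (induction m) (auto simp: algebra_simps)
    from this[of r] have "2 * (\<Sum>i<r. int i) = ?R * (?R - 1)" .
    moreover have "even (?R - 1)" using r(2) by simp
    ultimately have "2 * (\<Sum>i<r. int i) = 2 * (?R * ((?R - 1) div 2))" by auto
    then show ?thesis by linarith
  qed
  also have "?R + ?R * y * (?R * ((?R - 1) div 2)) = ?R + ?R^2 * (y * ((?R - 1) div 2))"
    by (simp add: power2_eq_square)
  also have "[\<dots> = ?R] (mod ?R^2)" by (simp add: cong_iff_dvd_diff)
  finally have c: "[(\<Sum>i<r. int x ^ i) = ?R] (mod ?R^2)" .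
  have "r dvd (\<Sum>i<r. x ^ i)" using dvd_repunit_iff_of_cong[OF x] by simp
  then obtain w where w: "(\<Sum>i<r. x ^ i) = r * w" by auto
  have "\<not> r dvd w"
  proof
    assume "r dvd w"
    then have "r^2 dvd (\<Sum>i<r. x ^ i)" using w by (auto simp: power2_eq_square)
    then have "?R^2 dvd (\<Sum>i<r. int x ^ i)"
      by (metis (mono_tags, lifting) int_dvd_int_iff of_nat_power of_nat_sum sum.cong)
    then have "?R^2 dvd ?R" using c by (simp add: cong_dvd_iff)
    then have "r^2 dvd r" by (metis int_dvd_int_iff of_nat_power)
    then show False using r(1) by (metis dvd_refl not_prime_unit power2_eq_square dvd_mult_cancel2 mult.commute prime_gt_0_nat)
  qed
  then show ?thesis using w by blast
qed

text \<open>Lifting the exponent. If \<open>k = r j\<close>, the repunit of length \<open>k\<close> in \<open>x\<close> is the product of the repunit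
of length \<open>r\<close> in \<open>x\<close>, which contributes exactly one factor \<open>r\<close>, and the repunit of length \<open>j\<close> in
\<open>x^r\<close>, to which induction applies.\<close>

lemma multiplicity_repunit:
  fixes r x k :: nat
  assumes r: "Factorial_Ring.prime r" "odd r" and x: "[x = 1] (mod r)" and "0 < k" and "0 < x"
  shows "multiplicity r (\<Sum>i<k. x ^ i) = multiplicity r k"
  using assms(3-)
proof (induction k arbitrary: x rule: less_induct)
  case (less k)
  show ?case
  proof (cases "r dvd k")
    case False
    then show ?thesis using dvd_repunit_iff_of_cong[OF less.prems(1), of k]
      by (simp add: not_dvd_imp_multiplicity_0)
  next
    case True
    then obtain j where j: "k = r * j" by auto
    have j0: "0 < j" "j < k" using j less.prems(2) prime_gt_1_nat[OF r(1)] by auto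
    have xr: "[x ^ r = 1] (mod r)" using cong_pow[OF less.prems(1), of r] by simp
    have split: "(\<Sum>i<k. x ^ i) = (\<Sum>i<r. x ^ i) * (\<Sum>i<j. (x ^ r) ^ i)"
    proof -
      have "(\<Sum>i<r * m. x ^ i) = (\<Sum>i<r. x ^ i) * (\<Sum>i<m. (x ^ r) ^ i)" for m
      proof (induction m)
        case (Suc m)
        have "(\<Sum>i<r * Suc m. x ^ i) = (\<Sum>i<r*m. x ^ i) + (\<Sum>i<r. x ^ (r * m + i))"
        proof -
          have "(\<Sum>i<a + b. x ^ i) = (\<Sum>i<a. x ^ i) + (\<Sum>i<b. x ^ (a + i))" for a b
            by (induction b) auto
          from this[of "r * m" r] show ?thesis by (simp add: add.commute)
        qed
        moreover have "(\<Sum>i<r. x ^ (r * m + i)) = (\<Sum>i<r. x ^ i) * (x ^ r) ^ m"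
          unfolding sum_distrib_right by (intro sum.cong refl) (metis power_add power_mult mult.commute)
        ultimately show ?case
          using Suc by (simp add: distrib_left)
      qed simp
      then show ?thesis using j by simp
    qed
    obtain w where w: "(\<Sum>i<r. x ^ i) = r * w" "\<not> r dvd w"
      using repunit_prime_exact[OF r less.prems(1)] by blast
    have w0: "w \<noteq> 0" using w(2) by (metis dvd_0_right)
    have nz: "(\<Sum>i<j. (x ^ r) ^ i) \<noteq> 0"
      using j0(1) less.prems(3) by (auto simp: sum_eq_0_iff)
    have r0: "r \<noteq> 0" "prime_elem r" using r(1) by auto
    have "multiplicity r (\<Sum>i<k. x ^ i)
        = multiplicity r r + multiplicity r w + multiplicity r (\<Sum>i<j. (x ^ r) ^ i)"
      using w0 nz r0 unfolding split w(1) by (simp add: prime_elem_multiplicity_mult_distrib)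
    also have "multiplicity r w = 0" using w(2) by (rule not_dvd_imp_multiplicity_0)
    also have "multiplicity r (\<Sum>i<j. (x ^ r) ^ i) = multiplicity r j"
      using less.IH[OF j0(2) xr j0(1)] less.prems(3) by simp
    also have "multiplicity r r + 0 + multiplicity r j = multiplicity r k"
      using r0 j0 unfolding j by (simp add: prime_elem_multiplicity_mult_distrib)
    finally show ?thesis .
  qed
qed

text \<open>For \<open>x = q^2\<close> this decides when the conjugates \<open>b^(x^i)\<close> of an element \<open>b\<close> of order
\<open>n (x - 1)\<close> coincide, because the repunit of length \<open>k\<close> is \<open>(x^k - 1) / (x - 1)\<close>.\<close>

lemma dvd_repunit_iff:
  fixes n x k :: nat
  assumes n: "odd n" and x: "0 < x" "\<And>r. Factorial_Ring.prime r \<Longrightarrow> r dvd n \<Longrightarrow> [x = 1] (mod r)"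
  shows "n dvd (\<Sum>i<k. x ^ i) \<longleftrightarrow> n dvd k"
proof (cases "k = 0")
  case False
  have nz: "(\<Sum>i<k. x ^ i) \<noteq> 0" "n \<noteq> 0"
    using False x(1) n by (auto intro!: Nat.gr0I)
  have eq: "multiplicity r (\<Sum>i<k. x ^ i) = multiplicity r k" if "Factorial_Ring.prime r" "r dvd n" for r
    using multiplicity_repunit[OF that(1) _ x(2)[OF that]] False x(1) n that(2) by auto
  have *: "n dvd m \<longleftrightarrow> (\<forall>r. Factorial_Ring.prime r \<longrightarrow> r dvd n \<longrightarrow> multiplicity r n \<le> multiplicity r m)"
    if "m \<noteq> 0" for m
  proof
    assume "n dvd m"
    then show "\<forall>r. Factorial_Ring.prime r \<longrightarrow> r dvd n \<longrightarrow> multiplicity r n \<le> multiplicity r m"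
      using that by (auto intro: dvd_imp_multiplicity_le)
  next
    assume a: "\<forall>r. Factorial_Ring.prime r \<longrightarrow> r dvd n \<longrightarrow> multiplicity r n \<le> multiplicity r m"
    show "n dvd m"
      by (rule multiplicity_le_imp_dvd[OF nz(2)]) (metis a le0 not_dvd_imp_multiplicity_0)
  qed
  show ?thesis using *[OF nz(1)] *[of k] eq False by simp
qed simp

section \<open>Frobenius maps and the existence of finite fields\<close>

lemma (in cring) binomial_theorem:
  assumes x: "x \<in> carrier R" and y: "y \<in> carrier R"
  shows "(x \<oplus> y) [^] (n::nat) = (\<Oplus>k\<in>{..n}. [(n choose k)] \<cdot> (x [^] k \<otimes> y [^] (n - k)))"
proof (induction n)
  case 0
  then show ?case by (simp add: add_pow_def)
next
  case (Suc n)
  note [simp] = x y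
  let ?u = "\<lambda>k. [(n choose k)] \<cdot> (x [^] Suc k \<otimes> y [^] (n - k))"
  let ?v = "\<lambda>k. [(n choose k)] \<cdot> (x [^] k \<otimes> y [^] (Suc n - k))"
  have "(x \<oplus> y) [^] Suc n = (\<Oplus>k\<in>{..n}. [(n choose k)] \<cdot> (x [^] k \<otimes> y [^] (n - k))) \<otimes> (x \<oplus> y)"
    using Suc by simp
  also have "\<dots> = (\<Oplus>k\<in>{..n}. [(n choose k)] \<cdot> (x [^] k \<otimes> y [^] (n - k)) \<otimes> (x \<oplus> y))"
    by (intro finsum_ldistr) auto
  also have "\<dots> = (\<Oplus>k\<in>{..n}. ?u k \<oplus> ?v k)"
  proof (intro finsum_cong' refl)
    fix k assume k: "k \<in> {..n}"
    have s: "Suc n - k = Suc (n - k)" using k by (simp add: Suc_diff_le)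
    have "x [^] k \<otimes> y [^] (n - k) \<otimes> (x \<oplus> y) = x [^] Suc k \<otimes> y [^] (n - k) \<oplus> x [^] k \<otimes> y [^] (Suc n - k)"
      unfolding s by (subst r_distr) (auto simp: m_ac)
    then show "[(n choose k)] \<cdot> (x [^] k \<otimes> y [^] (n - k)) \<otimes> (x \<oplus> y) = ?u k \<oplus> ?v k"
      by (simp add: add_pow_ldistr add.nat_pow_distrib)
  qed auto
  also have "\<dots> = (\<Oplus>k\<in>{..n}. ?u k) \<oplus> (\<Oplus>k\<in>{..n}. ?v k)"
    by (intro finsum_addf) auto
  also have "(\<Oplus>k\<in>{..n}. ?v k) = (\<Oplus>k\<in>{..Suc n}. ?v k)"
    using finsum_Suc[of ?v n] by (auto simp: binomial_eq_0)
  also have "\<dots> = (\<Oplus>k\<in>{..n}. ?v (Suc k)) \<oplus> ?v 0"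
    by (rule finsum_Suc2) auto
  also have "(\<Oplus>k\<in>{..n}. ?u k) \<oplus> ((\<Oplus>k\<in>{..n}. ?v (Suc k)) \<oplus> ?v 0)
           = (\<Oplus>k\<in>{..n}. ?u k \<oplus> ?v (Suc k)) \<oplus> ?v 0"
    by (subst finsum_addf) (auto simp: a_assoc)
  also have "(\<Oplus>k\<in>{..n}. ?u k \<oplus> ?v (Suc k))
      = (\<Oplus>k\<in>{..n}. [(Suc n choose Suc k)] \<cdot> (x [^] Suc k \<otimes> y [^] (Suc n - Suc k)))"
    by (intro finsum_cong' refl) (auto simp: add.nat_pow_mult)
  also have "\<dots> \<oplus> ?v 0 = (\<Oplus>k\<in>{..Suc n}. [(Suc n choose k)] \<cdot> (x [^] k \<otimes> y [^] (Suc n - k)))"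
    by (subst finsum_Suc2) auto
  finally show ?case .
qed

lemma (in ring) add_pow_dvd_zero:
  assumes x: "x \<in> carrier R" and z: "[p] \<cdot> \<one> = \<zero>" and d: "(p::nat) dvd m"
  shows "[m] \<cdot> x = \<zero>"
proof -
  obtain j where j: "m = p * j" using d by auto
  have "[p] \<cdot> x = ([p] \<cdot> \<one>) \<otimes> x" using x by (simp add: add_pow_ldistr)
  then have "[p] \<cdot> x = \<zero>" using z x by simp
  then show ?thesis
    using x unfolding j by (metis add.nat_pow_one add.nat_pow_pow)
qed

text \<open>All inner binomial coefficients are divisible by \<open>p\<close>.\<close>

lemma (in cring) frobenius_add:
  assumes p: "Factorial_Ring.prime (p::nat)" "[p] \<cdot> \<one> = \<zero>" and x: "x \<in> carrier R" and y: "y \<in> carrier R"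
  shows "(x \<oplus> y) [^] p = x [^] p \<oplus> y [^] p"
proof -
  note [simp] = x y
  let ?f = "\<lambda>k. [(p choose k)] \<cdot> (x [^] k \<otimes> y [^] (p - k))"
  obtain n where n: "p = Suc (Suc n)"
    using prime_ge_2_nat[OF p(1)] by (metis add_2_eq_Suc le_Suc_ex)
  have "(x \<oplus> y) [^] p = (\<Oplus>k\<in>{..p}. ?f k)" by (rule binomial_theorem) auto
  also have "\<dots> = ?f p \<oplus> (\<Oplus>k\<in>{..Suc n}. ?f k)"
    using finsum_Suc[of ?f "Suc n"] n by auto
  also have "(\<Oplus>k\<in>{..Suc n}. ?f k) = (\<Oplus>k\<in>{..n}. ?f (Suc k)) \<oplus> ?f 0"
    by (rule finsum_Suc2) auto
  also have "(\<Oplus>k\<in>{..n}. ?f (Suc k)) = (\<Oplus>k\<in>{..n}. \<zero>)"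
  proof (intro finsum_cong' refl)
    fix k assume "k \<in> {..n}"
    then have "p dvd p choose Suc k"
      using n by (intro dvd_choose_prime p(1)) auto
    then show "?f (Suc k) = \<zero>" by (intro add_pow_dvd_zero[OF _ p(2)]) auto
  qed auto
  finally show ?thesis by simp
qed

lemma (in cring) frobenius_pow_add:
  assumes p: "Factorial_Ring.prime (p::nat)" "[p] \<cdot> \<one> = \<zero>" and x: "x \<in> carrier R" and y: "y \<in> carrier R"
  shows "(x \<oplus> y) [^] (p ^ k) = x [^] (p ^ k) \<oplus> y [^] (p ^ k)"
proof (induction k)
  case (Suc k)
  have "(x \<oplus> y) [^] (p ^ Suc k) = ((x \<oplus> y) [^] (p ^ k)) [^] p"
    using x y by (simp add: nat_pow_pow mult.commute)
  also have "\<dots> = x [^] (p ^ Suc k) \<oplus> y [^] (p ^ Suc k)"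
    using x y by (simp add: Suc frobenius_add[OF p] nat_pow_pow mult.commute)
  finally show ?case .
qed (use x y in simp)

lemma (in cring) frobenius_pow_minus:
  assumes p: "Factorial_Ring.prime (p::nat)" "[p] \<cdot> \<one> = \<zero>" and x: "x \<in> carrier R"
  shows "(\<ominus> x) [^] (p ^ k) = \<ominus> (x [^] (p ^ k))"
proof -
  have "p ^ k \<noteq> 0" using p(1) by auto
  then have "(\<ominus> x) [^] (p ^ k) \<oplus> x [^] (p ^ k) = \<zero>"
    using frobenius_pow_add[OF p, of "\<ominus> x" x k] x by (simp add: l_neg nat_pow_zero)
  then show ?thesis using x by (intro minus_equality[symmetric]) auto
qed

lemma (in field) frobenius_fixed_subfield:
  assumes p: "Factorial_Ring.prime (p::nat)" "[p] \<cdot> \<one> = \<zero>"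
  shows "subfield {x \<in> carrier R. x [^] (p ^ k) = x} R"
proof (rule subfieldI')
  have nz: "p ^ k \<noteq> 0" using p(1) by auto
  show "subring {x \<in> carrier R. x [^] (p ^ k) = x} R"
    by (rule subringI)
       (use frobenius_pow_add[OF p] frobenius_pow_minus[OF p] in \<open>auto simp: nat_pow_distrib\<close>)
  fix x assume "x \<in> {x \<in> carrier R. x [^] (p ^ k) = x} - {\<zero>}"
  then have x: "x \<in> carrier R" "x \<noteq> \<zero>" "x [^] (p ^ k) = x" by auto
  then have u: "x \<in> Units R" by (simp add: field_Units)
  have "(x \<otimes> inv x) [^] (p ^ k) = x [^] (p ^ k) \<otimes> inv x [^] (p ^ k)"
    by (intro nat_pow_distrib Units_inv_closed x(1) u)
  then have "x \<otimes> inv x [^] (p ^ k) = \<one>" using x(3) u by simp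
  then have "inv x = inv x [^] (p ^ k)"
    by (intro comm_inv_char nat_pow_closed Units_inv_closed x(1) u)
  then show "inv x \<in> {x \<in> carrier R. x [^] (p ^ k) = x}" using u by auto
qed

lemma (in domain) nat_pow_eq_zeroD:
  assumes "x \<in> carrier R" "x [^] (n::nat) = \<zero>"
  shows "x = \<zero>"
  using assms(2)
proof (induction n)
  case (Suc n)
  then show ?case using integral[of "x [^] n" x] assms(1) by auto
qed simp

text \<open>The additive group gives \<open>p^f \<cdot> 1 = 0\<close>, and \<open>p^f \<cdot> 1\<close> is the \<open>f\<close>-th power of \<open>p \<cdot> 1\<close>.\<close>

lemma (in field) finite_field_characteristic:
  assumes "Factorial_Ring.prime p" and fin: "finite (carrier R)" and c: "card (carrier R) = p ^ f"
  shows "[(p::nat)] \<cdot> \<one> = \<zero>"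
proof -
  have "[(p ^ f)] \<cdot> \<one> = \<zero>"
    using add.pow_order_eq_1[of \<one>] c fin by (simp add: order_def add_pow_def)
  moreover have "[(p ^ f)] \<cdot> \<one> = ([p] \<cdot> \<one>) [^] f"
  proof (induction f)
    case (Suc f)
    have "([p] \<cdot> \<one>) [^] Suc f = ([(p ^ f)] \<cdot> \<one>) \<otimes> ([p] \<cdot> \<one>)" using Suc by simp
    also have "\<dots> = [(p ^ f)] \<cdot> ([p] \<cdot> \<one>)" by (simp add: add_pow_ldistr)
    also have "\<dots> = [(p ^ Suc f)] \<cdot> \<one>" by (simp add: add.nat_pow_pow)
    finally show ?case by simp
  qed simp
  ultimately have "([p] \<cdot> \<one>) [^] f = \<zero>" by metis
  then show ?thesis by (rule nat_pow_eq_zeroD[rotated]) simp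
qed


lemma (in field) finite_field_transport_nat:
  assumes "finite (carrier R)"
  shows "\<exists>K::nat ring. finite_field_of_order K (card (carrier R))"
proof -
  obtain h :: "'a \<Rightarrow> nat" where h: "inj_on h (carrier R)"
    using finite_imp_inj_to_nat_seg[OF assms] by blast
  show ?thesis
    using inj_imp_image_ring_is_field[OF h] assms h
    unfolding finite_field_of_order_def
    by (intro exI[of _ "image_ring h R"]) (simp add: image_ring_carrier card_image)
qed

lemma (in ring_hom_ring) hom_add_pow:
  assumes "x \<in> carrier R"
  shows "h ([(n::nat)] \<cdot>\<^bsub>R\<^esub> x) = [n] \<cdot>\<^bsub>S\<^esub> h x"
  using assms by (induction n) auto

text \<open>Cancelling \<open>Y\<close> from \<open>Y^m - Y = Y^2 r\<close> leaves \<open>1 = Y (Y^(m-2) - r)\<close>.\<close>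

lemma (in domain) dvd_one_of_square_dvd:
  assumes Y: "Y \<in> carrier R" "Y \<noteq> \<zero>" and r: "r \<in> carrier R" and m: "2 \<le> m"
    and eq: "Y [^] (m::nat) \<ominus> Y = Y [^] (2::nat) \<otimes> r"
  shows "Y divides \<one>"
proof -
  obtain j where j: "m = Suc (Suc j)" using m by (metis add_2_eq_Suc le_Suc_ex)
  define Z where "Z = Y [^] j"
  have Z: "Z \<in> carrier R" unfolding Z_def using Y by auto
  have "Y \<otimes> (Y \<otimes> Z \<ominus> \<one>) = Y [^] m \<ominus> Y"
    unfolding j nat_pow_Suc Z_def[symmetric] using Y Z by algebra
  also have "\<dots> = Y \<otimes> (Y \<otimes> r)" unfolding eq using Y r by (simp add: numeral_2_eq_2 m_assoc)
  finally have c: "Y \<otimes> Z \<ominus> \<one> = Y \<otimes> r" using m_lcancel[OF Y(2,1)] Y Z r by simp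
  have "Y \<otimes> (Z \<ominus> r) = (Y \<otimes> Z \<ominus> \<one>) \<ominus> Y \<otimes> r \<oplus> \<one>" using Y Z r by algebra
  also have "\<dots> = \<one>" unfolding c using Y r by algebra
  finally have "\<one> = Y \<otimes> (Z \<ominus> r)" by simp
  then show ?thesis using Z r unfolding factor_def by blast
qed

text \<open>The polynomial \<open>P = X^m - X\<close> with \<open>m = p^k\<close> splits, so only multiple roots have to be
excluded. If \<open>a\<close> is a root, then \<open>a^m = a\<close>, and the Frobenius identity in the polynomial ring turns \<open>P\<close>
into \<open>Y^m - Y\<close> with \<open>Y = X - a\<close>; if \<open>Y^2\<close> divided it, then \<open>Y\<close> would divide \<open>1\<close>.\<close>

lemma (in algebraically_closed) card_frobenius_fixed:
  assumes p: "Factorial_Ring.prime (p::nat)" "[p] \<cdot> \<one> = \<zero>" and k: "0 < k"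
  shows "card {x \<in> carrier L. x [^] (p ^ k) = x} = p ^ k"
proof -
  define m where "m = p ^ k"
  let ?P = "poly_ring L"
  have "p dvd m" using k by (simp add: m_def)
  then have m: "2 \<le> m"
    using prime_ge_2_nat[OF p(1)] p(1) by (metis dvd_imp_le le_trans m_def not_prime_0 power_eq_0_iff zero_less_iff_neq_zero)
  interpret UP: domain ?P using univ_poly_is_domain[OF carrier_is_subring] .
  have X: "X \<in> carrier ?P" using var_closed(1)[OF carrier_is_subring] .
  define Xm where "Xm = X [^]\<^bsub>?P\<^esub> m"
  define Xn where "Xn = \<ominus>\<^bsub>?P\<^esub> X"
  have Xmn: "Xm \<in> carrier ?P" "Xn \<in> carrier ?P" unfolding Xm_def Xn_def using X by auto
  define P where "P = Xm \<oplus>\<^bsub>?P\<^esub> Xn"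
  have P: "P \<in> carrier ?P" unfolding P_def using Xmn by auto
  have deg: "degree P = m"
  proof -
    have 1: "degree Xm = m"
      unfolding Xm_def unitary_monom_eq_var_pow[OF carrier_is_subring, symmetric] by (simp add: monom_def)
    have 2: "degree Xn = 1"
      unfolding Xn_def univ_poly_a_inv_degree[OF carrier_is_subring X] by (simp add: var_def)
    have "degree (poly_add Xm Xn) = max (degree Xm) (degree Xn)"
      using Xmn m 1 2 by (intro poly_add_degree_eq[OF carrier_is_subring]) (simp_all only: univ_poly_carrier)
    then show ?thesis
      unfolding P_def univ_poly_add 1 2 using m by linarith
  qed
  have P0: "P \<noteq> []"
  proof
    assume "P = []"
    then have "degree P = 0" by simp
    then show False using deg m by linarith
  qed
  have ev: "eval P x = x [^] m \<ominus> x" if x: "x \<in> carrier L" for x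
  proof -
    interpret ev: ring_hom_ring ?P L "\<lambda>p. eval p x"
      using eval_ring_hom[OF carrier_is_subring x] .
    have "eval P x = eval Xm x \<oplus> eval Xn x" unfolding P_def by (rule ev.hom_add[OF Xmn])
    also have "eval Xn x = \<ominus> (eval X x)" unfolding Xn_def by (rule ev.hom_a_inv[OF X])
    also have "eval Xm x = eval X x [^] m" unfolding Xm_def by (rule ev.hom_nat_pow[OF X])
    finally show ?thesis unfolding eval_var[OF x] a_minus_def .
  qed
  interpret c: ring_hom_ring L ?P poly_of_const
    using canonical_embedding_ring_hom[OF carrier_is_subring] by simp
  have pP: "[p] \<cdot>\<^bsub>?P\<^esub> \<one>\<^bsub>?P\<^esub> = \<zero>\<^bsub>?P\<^esub>"
    using c.hom_add_pow[OF one_closed, of p] p(2) c.hom_one c.hom_zero by argo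
  have mult: "alg_mult P a \<le> 1" if a: "a \<in> carrier L" for a
  proof (rule ccontr)
    assume "\<not> alg_mult P a \<le> 1"
    then have le: "2 \<le> alg_mult P a" by simp
    define Y where "Y = [\<one>, \<ominus> a]"
    have Y: "Y \<in> carrier ?P" unfolding Y_def using a by (auto simp: univ_poly_def polynomial_def)
    have Ya: "eval Y a = \<zero>" unfolding Y_def using a by (simp add: r_neg)
    have Y0: "Y \<noteq> \<zero>\<^bsub>?P\<^esub>" by (simp add: univ_poly_zero Y_def)
    have d2: "(Y [^]\<^bsub>?P\<^esub> (2::nat)) pdivides P"
      unfolding Y_def by (rule le_alg_mult_imp_pdivides[OF a P le])
    have "(Y [^]\<^bsub>?P\<^esub> (1::nat)) pdivides P"
      unfolding Y_def by (rule le_alg_mult_imp_pdivides[OF a P]) (use le in simp)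
    then have "eval P a = \<zero>"
      using pdivides_imp_root_sharing[OF Y _ a Ya] Y by simp
    then have "a [^] m \<ominus> a = \<zero>" using ev[OF a] by simp
    then have am: "a [^] m = a" using a by simp
    define A where "A = poly_of_const a"
    have A: "A \<in> carrier ?P" "A [^]\<^bsub>?P\<^esub> m = A"
      unfolding A_def using c.hom_closed[OF a] c.hom_nat_pow[OF a, of m] am by auto
    \<comment> \<open>Frobenius is applied to the sum of the linear factor \<open>Y\<close> and the constant \<open>a\<close>.\<close>
    have XY: "X = Y \<oplus>\<^bsub>?P\<^esub> A"
      unfolding Y_def A_def var_def univ_poly_add poly_of_const_def
      using a by (auto simp: l_neg)
    have "Xm = Y [^]\<^bsub>?P\<^esub> m \<oplus>\<^bsub>?P\<^esub> A"
      unfolding Xm_def XY m_def using UP.frobenius_pow_add[OF p(1) pP Y A(1)] A(2) unfolding m_def by simp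
    moreover have "Xn = \<ominus>\<^bsub>?P\<^esub> Y \<oplus>\<^bsub>?P\<^esub> \<ominus>\<^bsub>?P\<^esub> A"
      unfolding Xn_def XY using UP.minus_add[OF Y A(1)] .
    ultimately have P1: "P = Y [^]\<^bsub>?P\<^esub> m \<oplus>\<^bsub>?P\<^esub> \<ominus>\<^bsub>?P\<^esub> Y"
      unfolding P_def using UP.nat_pow_closed[OF Y, of m] Y A(1)
      by (simp add: UP.a_ac UP.r_neg1 UP.r_neg2 UP.r_neg)
    obtain r where r: "r \<in> carrier ?P" "P = Y [^]\<^bsub>?P\<^esub> (2::nat) \<otimes>\<^bsub>?P\<^esub> r"
      using d2 unfolding pdivides_def by blast
    have "Y pdivides \<one>\<^bsub>?P\<^esub>"
      unfolding pdivides_def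
    proof (rule UP.dvd_one_of_square_dvd[OF Y Y0 r(1) m])
      show "Y [^]\<^bsub>?P\<^esub> m \<ominus>\<^bsub>?P\<^esub> Y = Y [^]\<^bsub>?P\<^esub> (2::nat) \<otimes>\<^bsub>?P\<^esub> r"
        unfolding a_minus_def P1[symmetric] by (rule r(2))
    qed
    then have "eval \<one>\<^bsub>?P\<^esub> a = \<zero>"
      using pdivides_imp_root_sharing[OF Y _ a Ya] by blast
    then show False using a by (simp add: univ_poly_one)
  qed
  have rt: "a \<in># roots P \<longleftrightarrow> a \<in> carrier L \<and> a [^] m = a" for a
  proof -
    have "a \<in># roots P \<longleftrightarrow> a \<in> carrier L \<and> eval P a = \<zero>"
      using roots_mem_iff_is_root[OF P, of a] P0 by (simp add: is_root_def)
    also have "\<dots> \<longleftrightarrow> a \<in> carrier L \<and> a [^] m = a"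
      by (cases "a \<in> carrier L") (simp_all add: ev)
    finally show ?thesis .
  qed
  have "roots P = mset_set (set_mset (roots P))"
  proof (rule multiset_eqI)
    fix a
    show "count (roots P) a = count (mset_set (set_mset (roots P))) a"
    proof (cases "a \<in># roots P")
      case True
      then have "count (roots P) a \<le> 1"
        using mult[of a] rt[of a] unfolding alg_mult_eq_count_roots[OF P] by simp
      moreover have "0 < count (roots P) a" using True by simp
      ultimately have "count (roots P) a = 1" by linarith
      then show ?thesis using True by simp
    qed (simp add: not_in_iff)
  qed
  then have "size (roots P) = card (set_mset (roots P))"
    using size_mset_set[of "set_mset (roots P)"] by simp
  moreover have "size (roots P) = m"
    using roots_over_carrier[OF P] deg by (simp add: splitted_def)
  moreover have "set_mset (roots P) = {x \<in> carrier L. x [^] m = x}"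
    using rt by auto
  ultimately show ?thesis unfolding m_def by simp
qed

text \<open>The roots of \<open>X^(p^k) - X\<close> in an algebraic closure of the prime field.\<close>

lemma exists_finite_field_nat:
  assumes p: "Factorial_Ring.prime (p::nat)" and k: "0 < k"
  shows "\<exists>K::nat ring. finite_field_of_order K (p ^ k)"
proof -
  interpret R: residues_prime p "residue_ring (int p)"
    by (unfold_locales) (use p in auto)
  interpret R: field "residue_ring (int p)" using R.is_field .
  let ?L = "R.alg_closure"
  interpret algebraic_closure ?L "R.indexed_const ` carrier (residue_ring (int p))"
    using R.alg_closureE(1) .
  interpret h: ring_hom_ring "residue_ring (int p)" ?L R.indexed_const
    using R.alg_closureE(2) by (intro ring_hom_ringI2 R.ring_axioms ring_axioms)
  have "[p] \<cdot>\<^bsub>residue_ring (int p)\<^esub> \<one>\<^bsub>residue_ring (int p)\<^esub> = \<zero>\<^bsub>residue_ring (int p)\<^esub>"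
    using R.finite_field_characteristic[OF p R.finite, of 1] R.res_carrier_eq by simp
  then have c: "[p] \<cdot>\<^bsub>?L\<^esub> \<one>\<^bsub>?L\<^esub> = \<zero>\<^bsub>?L\<^esub>"
    by (metis h.hom_add_pow h.hom_one h.hom_zero R.one_closed)
  let ?F = "{x \<in> carrier ?L. x [^]\<^bsub>?L\<^esub> (p ^ k) = x}"
  have F: "field (?L\<lparr>carrier := ?F\<rparr>)"
    using subfield_iff(2)[OF frobenius_fixed_subfield[OF p c]] .
  have card: "card ?F = p ^ k" by (rule card_frobenius_fixed[OF p c k])
  moreover have "finite ?F"
  proof (rule ccontr)
    assume "infinite ?F"
    then have "p ^ k = 0" using card by simp
    then show False using p by simp
  qed
  ultimately show ?thesis using field.finite_field_transport_nat[OF F] by simp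
qed

section \<open>Products over the roots of a binomial\<close>

text \<open>Functions given on the carrier by a polynomial of degree less than \<open>n\<close>, in Horner form. The
recursion makes division by \<open>x - r\<close> a one-step induction.\<close>

fun polynomial_function :: "('a, 'm) ring_scheme \<Rightarrow> nat \<Rightarrow> ('a \<Rightarrow> 'a) \<Rightarrow> bool" where
  "polynomial_function R 0 f \<longleftrightarrow> (\<forall>x\<in>carrier R. f x = \<zero>\<^bsub>R\<^esub>)"
| "polynomial_function R (Suc n) f \<longleftrightarrow> (\<exists>c\<in>carrier R. \<exists>g. polynomial_function R n g \<and>
     (\<forall>x\<in>carrier R. f x = c \<oplus>\<^bsub>R\<^esub> x \<otimes>\<^bsub>R\<^esub> g x))"

context cring
begin

lemma polynomial_function_closed:
  "polynomial_function R n f \<Longrightarrow> x \<in> carrier R \<Longrightarrow> f x \<in> carrier R"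
  by (induction n arbitrary: f) auto

lemma polynomial_function_add:
  "polynomial_function R n f \<Longrightarrow> polynomial_function R n g \<Longrightarrow>
     polynomial_function R n (\<lambda>x. f x \<oplus> g x)"
proof (induction n arbitrary: f g)
  case (Suc n)
  obtain c f' where f: "c \<in> carrier R" "polynomial_function R n f'"
    "\<And>x. x \<in> carrier R \<Longrightarrow> f x = c \<oplus> x \<otimes> f' x" using Suc.prems(1) by auto
  obtain d g' where g: "d \<in> carrier R" "polynomial_function R n g'"
    "\<And>x. x \<in> carrier R \<Longrightarrow> g x = d \<oplus> x \<otimes> g' x" using Suc.prems(2) by auto
  have "f x \<oplus> g x = (c \<oplus> d) \<oplus> x \<otimes> (f' x \<oplus> g' x)" if "x \<in> carrier R" for x
    using that f g polynomial_function_closed[OF f(2) that] polynomial_function_closed[OF g(2) that]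
    by (simp add: r_distr a_ac)
  then show ?case using f g Suc.IH[OF f(2) g(2)] by (auto intro!: bexI[of _ "c \<oplus> d"])
qed auto

lemma polynomial_function_smult:
  "polynomial_function R n f \<Longrightarrow> a \<in> carrier R \<Longrightarrow> polynomial_function R n (\<lambda>x. a \<otimes> f x)"
proof (induction n arbitrary: f)
  case (Suc n)
  obtain c f' where f: "c \<in> carrier R" "polynomial_function R n f'"
    "\<And>x. x \<in> carrier R \<Longrightarrow> f x = c \<oplus> x \<otimes> f' x" using Suc.prems(1) by auto
  have "a \<otimes> f x = a \<otimes> c \<oplus> x \<otimes> (a \<otimes> f' x)" if "x \<in> carrier R" for x
    using that f Suc.prems(2) polynomial_function_closed[OF f(2) that]
    by (simp add: r_distr m_ac)
  then show ?case using f Suc.prems(2) Suc.IH[OF f(2) Suc.prems(2)] by (auto intro!: bexI[of _ "a \<otimes> c"])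
qed auto

lemma polynomial_function_Suc:
  "polynomial_function R n f \<Longrightarrow> polynomial_function R (Suc n) f"
proof (induction n arbitrary: f)
  case 0
  then show ?case
    by (auto intro!: bexI[of _ \<zero>] exI[of _ "\<lambda>_. \<zero>"])
next
  case (Suc n)
  obtain c f' where f: "c \<in> carrier R" "polynomial_function R n f'"
    "\<And>x. x \<in> carrier R \<Longrightarrow> f x = c \<oplus> x \<otimes> f' x" using Suc.prems(1) by auto
  show ?case
    unfolding polynomial_function.simps(2)[of R "Suc n"] using f Suc.IH[OF f(2)] by blast
qed

lemma polynomial_function_mult_var:
  assumes "polynomial_function R n f"
  shows "polynomial_function R (Suc n) (\<lambda>x. x \<otimes> f x)"
  unfolding polynomial_function.simps(2)
  using polynomial_function_closed[OF assms]
  by (intro bexI[of _ \<zero>] exI[of _ f] conjI assms) auto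

lemma polynomial_function_power: "polynomial_function R (Suc n) (\<lambda>x. x [^] n)"
proof (induction n)
  case 0
  then show ?case by (auto intro!: bexI[of _ \<one>] exI[of _ "\<lambda>_. \<zero>"])
next
  case (Suc n)
  show ?case
    unfolding polynomial_function.simps(2)[of R "Suc n"]
    by (intro bexI[of _ \<zero>] exI[of _ "\<lambda>x. x [^] n"] conjI Suc) (auto simp: m_comm)
qed

lemma polynomial_function_division:
  assumes "polynomial_function R (Suc n) f" and r: "r \<in> carrier R"
  shows "\<exists>g. polynomial_function R n g \<and> (\<forall>x\<in>carrier R. f x = f r \<oplus> (x \<ominus> r) \<otimes> g x)"
  using assms(1)
proof (induction n arbitrary: f)
  case 0
  then show ?case using r by (auto intro!: exI[of _ "\<lambda>_. \<zero>"])
next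
  case (Suc n)
  obtain c h where f: "c \<in> carrier R" "polynomial_function R (Suc n) h"
    "\<And>x. x \<in> carrier R \<Longrightarrow> f x = c \<oplus> x \<otimes> h x"
    using Suc.prems unfolding polynomial_function.simps(2)[of R "Suc n"] by auto
  obtain g where g: "polynomial_function R n g"
    "\<And>x. x \<in> carrier R \<Longrightarrow> h x = h r \<oplus> (x \<ominus> r) \<otimes> g x"
    using Suc.IH[OF f(2)] by blast
  have hr: "h r \<in> carrier R" by (rule polynomial_function_closed[OF f(2) r])
  have "f x = f r \<oplus> (x \<ominus> r) \<otimes> (h r \<oplus> x \<otimes> g x)" if x: "x \<in> carrier R" for x
  proof -
    have gx: "g x \<in> carrier R" by (rule polynomial_function_closed[OF g(1) x])
    have "f x = c \<oplus> x \<otimes> (h r \<oplus> (x \<ominus> r) \<otimes> g x)" using f(3)[OF x] g(2)[OF x] by simp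
    also have "\<dots> = (c \<oplus> r \<otimes> h r) \<oplus> (x \<ominus> r) \<otimes> (h r \<oplus> x \<otimes> g x)"
      using f(1) r x hr gx by algebra
    finally show ?thesis using f(3)[OF r] by simp
  qed
  then show ?case using g(1) hr by (intro exI[of _ "\<lambda>x. h r \<oplus> x \<otimes> g x"]) auto
qed

lemma monic_product_polynomial_function:
  assumes "finite B" "B \<subseteq> carrier R"
  shows "\<exists>g. polynomial_function R (card B) g \<and>
    (\<forall>x\<in>carrier R. (\<Otimes>\<beta>\<in>B. x \<ominus> \<beta>) = x [^] card B \<oplus> g x)"
  using assms
proof (induction B rule: finite_induct)
  case empty
  then show ?case by (auto intro!: exI[of _ "\<lambda>_. \<zero>"])
next
  case (insert a B)
  obtain g where g: "polynomial_function R (card B) g"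
    "\<And>x. x \<in> carrier R \<Longrightarrow> (\<Otimes>\<beta>\<in>B. x \<ominus> \<beta>) = x [^] card B \<oplus> g x"
    using insert by auto
  have a: "a \<in> carrier R" using insert by auto
  \<comment> \<open>Multiplying \<open>x^m + g(x)\<close> by \<open>x - a\<close> leaves this remainder below the new leading term.\<close>
  let ?h = "\<lambda>x. (\<ominus> a \<otimes> x [^] card B \<oplus> x \<otimes> g x) \<oplus> \<ominus> a \<otimes> g x"
  have cI: "card (insert a B) = Suc (card B)" using insert by simp
  have "polynomial_function R (card (insert a B)) ?h"
    unfolding cI using a by (intro polynomial_function_add polynomial_function_smult polynomial_function_power
        polynomial_function_mult_var polynomial_function_Suc g(1)) auto
  moreover have "(\<Otimes>\<beta>\<in>insert a B. x \<ominus> \<beta>) = x [^] card (insert a B) \<oplus> ?h x" if x: "x \<in> carrier R" for x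
  proof -
    have gx: "g x \<in> carrier R" by (rule polynomial_function_closed[OF g(1) x])
    have "(\<Otimes>\<beta>\<in>insert a B. x \<ominus> \<beta>) = (x \<ominus> a) \<otimes> (x [^] card B \<oplus> g x)"
      using insert x a g(2)[OF x] by (subst finprod_insert) auto
    also have "\<dots> = x [^] card B \<otimes> x \<oplus> ?h x"
      using x a gx nat_pow_closed[OF x, of "card B"] by algebra
    finally show ?thesis unfolding cI by simp
  qed
  ultimately show ?case by (intro exI[of _ ?h] conjI ballI)
qed

end

text \<open>A polynomial of degree less than \<open>n\<close> with \<open>n\<close> distinct roots vanishes: split off one root.\<close>

lemma (in domain) polynomial_function_eq_zero:
  assumes "polynomial_function R n f" and "finite B" "card B = n" "B \<subseteq> carrier R"
    and "\<And>\<beta>. \<beta> \<in> B \<Longrightarrow> f \<beta> = \<zero>" and "x \<in> carrier R"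
  shows "f x = \<zero>"
  using assms
proof (induction n arbitrary: f B)
  case (Suc n)
  obtain r where r: "r \<in> B" "r \<in> carrier R" using Suc.prems by (metis card_gt_0_iff equals0I subsetD zero_less_Suc)
  obtain g where g: "polynomial_function R n g"
    "\<And>x. x \<in> carrier R \<Longrightarrow> f x = f r \<oplus> (x \<ominus> r) \<otimes> g x"
    using polynomial_function_division[OF Suc.prems(1) r(2)] by blast
  have gc: "g y \<in> carrier R" if "y \<in> carrier R" for y by (rule polynomial_function_closed[OF g(1) that])
  have "g \<beta> = \<zero>" if b: "\<beta> \<in> B - {r}" for \<beta>
  proof -
    have bc: "\<beta> \<in> carrier R" using b Suc.prems(4) by auto
    have "(\<beta> \<ominus> r) \<otimes> g \<beta> = \<zero>"
      using g(2)[OF bc] Suc.prems(5) r b gc[OF bc] bc by auto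
    moreover have "\<beta> \<ominus> r \<noteq> \<zero>" using b bc r by auto
    ultimately show ?thesis using integral[of "\<beta> \<ominus> r" "g \<beta>"] bc r gc[OF bc] by auto
  qed
  then have "g x = \<zero>"
    using Suc.prems r by (intro Suc.IH[OF g(1), of "B - {r}"]) auto
  then show ?case using g(2)[OF Suc.prems(6)] Suc.prems(5)[OF r(1)] Suc.prems(6) r by simp
qed auto

text \<open>Both sides are monic of degree \<open>card B\<close> and vanish on \<open>B\<close>, so their difference has degree less
than \<open>card B\<close> and \<open>card B\<close> roots.\<close>

lemma (in domain) prod_minus_roots:
  assumes B: "finite B" "B \<subseteq> carrier R" "0 < card B" and c: "c \<in> carrier R"
    and roots: "\<And>\<beta>. \<beta> \<in> B \<Longrightarrow> \<beta> [^] card B = c" and x: "x \<in> carrier R"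
  shows "(\<Otimes>\<beta>\<in>B. x \<ominus> \<beta>) = x [^] card B \<ominus> c"
proof -
  obtain g where g: "polynomial_function R (card B) g"
    "\<And>x. x \<in> carrier R \<Longrightarrow> (\<Otimes>\<beta>\<in>B. x \<ominus> \<beta>) = x [^] card B \<oplus> g x"
    using monic_product_polynomial_function[OF B(1,2)] by blast
  have gc: "g y \<in> carrier R" if "y \<in> carrier R" for y by (rule polynomial_function_closed[OF g(1) that])
  obtain m where m: "card B = Suc m" using B(3) by (metis gr0_implies_Suc)
  have const: "polynomial_function R (card B) (\<lambda>_. c)"
    unfolding m using c
  proof (induction m)
    case 0
    then show ?case by (auto intro!: bexI[of _ c] exI[of _ "\<lambda>_. \<zero>"])
  qed (rule polynomial_function_Suc)
  have "g x \<oplus> c = \<zero>"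
  proof (rule polynomial_function_eq_zero[OF polynomial_function_add[OF g(1) const] B(1) refl B(2) _ x])
    fix \<beta> assume b: "\<beta> \<in> B"
    then have bc: "\<beta> \<in> carrier R" using B by auto
    have "(\<Otimes>\<gamma>\<in>B. \<beta> \<ominus> \<gamma>) = \<zero>"
    proof -
      have "(\<Otimes>\<gamma>\<in>insert \<beta> (B - {\<beta>}). \<beta> \<ominus> \<gamma>) = (\<beta> \<ominus> \<beta>) \<otimes> (\<Otimes>\<gamma>\<in>B - {\<beta>}. \<beta> \<ominus> \<gamma>)"
        using B bc by (intro finprod_insert) auto
      moreover have "(\<Otimes>\<gamma>\<in>B - {\<beta>}. \<beta> \<ominus> \<gamma>) \<in> carrier R"
        using B bc by (intro finprod_closed) auto
      ultimately show ?thesis using b bc by (simp add: insert_absorb a_minus_def r_neg)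
    qed
    then show "g \<beta> \<oplus> c = \<zero>" using g(2)[OF bc] roots[OF b] gc[OF bc] c by (simp add: a_comm)
  qed
  then have "g x = \<ominus> c" using gc[OF x] c by (metis minus_equality)
  then show ?thesis using g(2)[OF x] by (simp add: a_minus_def)
qed

section \<open>The subfield of order q\<close>

lemma (in field) exists_primitive_element:
  assumes fin: "finite (carrier R)"
  shows "\<exists>g\<in>carrier R - {\<zero>}. \<forall>k::nat. g [^] k = \<one> \<longleftrightarrow> card (carrier R) - 1 dvd k"
proof -
  interpret G: group "Multiplicative_Group.mult_of R" by (rule field_mult_group)
  obtain g where g: "g \<in> carrier (Multiplicative_Group.mult_of R)"
    "carrier (Multiplicative_Group.mult_of R) = {g [^] i |i::nat. i \<in> UNIV}"
    using finite_field_mult_group_has_gen[OF fin] by blast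
  have fm: "finite (carrier (Multiplicative_Group.mult_of R))" using fin by simp
  have "generate (Multiplicative_Group.mult_of R) {g} = carrier (Multiplicative_Group.mult_of R)"
    unfolding g(2) using G.generate_pow_on_finite_carrier[OF fm g(1)]
    by (simp add: Multiplicative_Group.nat_pow_mult_of)
  then have "G.ord g = card (carrier (Multiplicative_Group.mult_of R))"
    using G.generate_pow_card[OF g(1)] by simp
  also have "\<dots> = card (carrier R) - 1" using fin by simp
  finally have "g [^] k = \<one> \<longleftrightarrow> card (carrier R) - 1 dvd k" for k :: nat
    using G.pow_eq_id[OF g(1), of k] by (simp add: Multiplicative_Group.nat_pow_mult_of)
  then show ?thesis using g(1) by auto
qed

lemma (in monoid) inj_on_pow_lessThan:
  assumes g: "g \<in> Units G" and ord: "\<And>k::nat. g [^] k = \<one> \<longleftrightarrow> N dvd k"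
  shows "inj_on (\<lambda>k::nat. g [^] k) {..<N}"
proof -
  have "i = j" if "i \<le> j" "j < N" "g [^] i = g [^] j" for i j :: nat
  proof -
    have gi: "g [^] i \<in> Units G" using g by (rule Units_pow_closed)
    have gc: "g \<in> carrier G" using g by auto
    have "g [^] i \<otimes> g [^] (j - i) = g [^] (i + (j - i))"
      by (rule nat_pow_mult[OF gc])
    also have "\<dots> = g [^] i \<otimes> \<one>" using that(1) that(3)[symmetric] gc by simp
    finally have "g [^] (j - i) = \<one>"
      using Units_l_cancel[OF gi, of "g [^] (j - i)" \<one>] gc by simp
    then have "N dvd j - i" using ord by simp
    then show "i = j" using that(1,2) using dvd_imp_le[of N "j - i"] by linarith
  qed
  then show ?thesis by (intro inj_onI) (metis lessThan_iff nat_le_linear)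
qed

text \<open>The element \<open>b\<close> is a root of \<open>X^n - c\<close> with \<open>c = b^n\<close> a generator of the multiplicative group of
the subfield of order \<open>q^2\<close>; its order is given by the powers that are \<open>1\<close>.\<close>

locale kummer_generator = field K for K (structure) +
  fixes p e q n :: nat and b :: 'a
  assumes fin: "finite (carrier K)" and card_K: "card (carrier K) = q ^ (2 * n)"
    and p: "Factorial_Ring.prime p" and q: "q = p ^ e" and e: "0 < e"
    and odd_n: "odd n" and n1: "1 < n"
    and n_primes: "\<And>r. Factorial_Ring.prime r \<Longrightarrow> r dvd n \<Longrightarrow> r dvd q + 1"
    and b: "b \<in> carrier K" "b \<noteq> \<zero>"
    and ord_b: "\<And>k::nat. b [^] k = \<one> \<longleftrightarrow> n * (q ^ 2 - 1) dvd k"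
begin

definition F where "F = {x \<in> carrier K. x [^] q = x}"
definition L where "L = {x \<oplus> y \<otimes> b | x y. x \<in> F \<and> y \<in> F}"
text \<open>The norm to the subfield of order \<open>q^2\<close> is the power with exponent \<open>1 + q^2 + \<dots> + q^(2 n - 2)\<close>, and
\<open>M\<close> is this exponent times \<open>q - 1\<close>. Hence \<open>C\<close> consists of the nonzero elements with norm in \<open>F\<close>, and
\<open>x \<mapsto> x^M\<close> separates its \<open>q + 1\<close> cosets.\<close>

definition M :: nat where "M = (q ^ (2 * n) - 1) div (q + 1)"
definition C where "C = {a \<in> carrier K - {\<zero>}. a [^] M = \<one>}"

lemma q2: "2 \<le> q"
proof -
  have "p dvd q" using e q by simp
  then show ?thesis using prime_ge_2_nat[OF p] q p
    by (metis dvd_imp_le le_trans not_prime_0 power_eq_0_iff zero_less_iff_neq_zero)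
qed

lemma q_sq: "q ^ 2 - 1 = (q - 1) * (q + 1)"
  using q2 by (cases q) (auto simp: power2_eq_square)

lemma M_factors: "q ^ (2 * n) - 1 = M * (q + 1)" "M = (q - 1) * (\<Sum>i<n. (q ^ 2) ^ i)"
proof -
  have "q ^ (2 * n) - 1 = (q ^ 2 - 1) * (\<Sum>i<n. (q ^ 2) ^ i)"
    unfolding repunit_geometric by (simp add: power_mult)
  also have "\<dots> = (q + 1) * ((q - 1) * (\<Sum>i<n. (q ^ 2) ^ i))"
    unfolding q_sq by (simp add: algebra_simps)
  finally have *: "q ^ (2 * n) - 1 = (q + 1) * ((q - 1) * (\<Sum>i<n. (q ^ 2) ^ i))" .
  show "M = (q - 1) * (\<Sum>i<n. (q ^ 2) ^ i)" unfolding M_def * by (simp only: nonzero_mult_div_cancel_left)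
  then show "q ^ (2 * n) - 1 = M * (q + 1)" using * by (simp add: mult.commute)
qed

lemma char: "[p] \<cdot> \<one> = \<zero>"
  using finite_field_characteristic[OF p fin, of "e * (2 * n)"] card_K q by (simp add: power_mult)

lemma F_subfield: "subfield F K"
  using frobenius_fixed_subfield[OF p char, of e, folded q] unfolding F_def .

lemma F_closed [simp, intro]:
  "x \<in> F \<Longrightarrow> x \<in> carrier K" "\<zero> \<in> F" "\<one> \<in> F"
  "x \<in> F \<Longrightarrow> y \<in> F \<Longrightarrow> x \<oplus> y \<in> F" "x \<in> F \<Longrightarrow> y \<in> F \<Longrightarrow> x \<otimes> y \<in> F"
  "x \<in> F \<Longrightarrow> \<ominus> x \<in> F" "x \<in> F \<Longrightarrow> y \<in> F \<Longrightarrow> x \<ominus> y \<in> F"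
  using subringE[OF subfieldE(1)[OF F_subfield]] subfieldE(3)[OF F_subfield]
  by (auto simp: a_minus_def)

lemma F_inv [simp, intro]: "x \<in> F \<Longrightarrow> x \<noteq> \<zero> \<Longrightarrow> inv x \<in> F"
  using subfield_m_inv(1)[OF F_subfield, of x] by auto

lemma F_pow [simp, intro]: "x \<in> F \<Longrightarrow> x [^] (k::nat) \<in> F"
  by (induction k) auto

lemma inv_closed [simp, intro]: "x \<in> carrier K \<Longrightarrow> x \<noteq> \<zero> \<Longrightarrow> inv x \<in> carrier K"
  using field_Units by auto

lemma inv_cancel [simp]: "x \<in> carrier K \<Longrightarrow> x \<noteq> \<zero> \<Longrightarrow> x \<otimes> inv x = \<one>"
    "x \<in> carrier K \<Longrightarrow> x \<noteq> \<zero> \<Longrightarrow> inv x \<otimes> x = \<one>"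
  using field_Units by auto

lemma inv_nonzero [simp]: "x \<in> carrier K \<Longrightarrow> x \<noteq> \<zero> \<Longrightarrow> inv x \<noteq> \<zero>"
  using inv_cancel(1)[of x] by (metis r_null zero_not_one)

lemma pow_nonzero [simp]: "x \<in> carrier K \<Longrightarrow> x \<noteq> \<zero> \<Longrightarrow> x [^] (k::nat) \<noteq> \<zero>"
  using nat_pow_eq_zeroD[of x k] by auto

lemma F_iff_pow: "x \<in> carrier K \<Longrightarrow> x \<noteq> \<zero> \<Longrightarrow> x \<in> F \<longleftrightarrow> x [^] (q - 1) = \<one>"
proof -
  assume x: "x \<in> carrier K" "x \<noteq> \<zero>"
  have "x [^] q = x [^] (q - 1) \<otimes> x" using q2 nat_pow_Suc[of x "q - 1"] by simp
  then have "x [^] q = x \<longleftrightarrow> x [^] (q - 1) \<otimes> x = \<one> \<otimes> x" using x by simp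
  also have "\<dots> \<longleftrightarrow> x [^] (q - 1) = \<one>" using m_rcancel[of x "x [^] (q - 1)" \<one>] x by blast
  finally show ?thesis using x(1) unfolding F_def by blast
qed

lemma pow_card: "x \<in> carrier K \<Longrightarrow> x \<noteq> \<zero> \<Longrightarrow> x [^] (q ^ (2 * n) - 1) = \<one>"
proof -
  assume x: "x \<in> carrier K" "x \<noteq> \<zero>"
  interpret G: group "Multiplicative_Group.mult_of K" by (rule field_mult_group)
  have "x [^]\<^bsub>Multiplicative_Group.mult_of K\<^esub> order (Multiplicative_Group.mult_of K) = \<one>"
    using G.pow_order_eq_1[of x] x by simp
  then show ?thesis
    unfolding order_mult_of[OF fin] by (simp add: order_def card_K Multiplicative_Group.nat_pow_mult_of)
qed

lemma card_F: "card F = q"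
proof -
  let ?N = "q ^ (2 * n) - 1"
  obtain g where g: "g \<in> carrier K" "g \<noteq> \<zero>" "\<And>k::nat. g [^] k = \<one> \<longleftrightarrow> ?N dvd k"
    using exists_primitive_element[OF fin] card_K by auto
  \<comment> \<open>The powers of \<open>g^m\<close> are the \<open>(q - 1)\<close>-th roots of unity.\<close>
  define m where "m = (q + 1) * (\<Sum>i<n. (q ^ 2) ^ i)"
  have N: "?N = m * (q - 1)" unfolding m_def M_factors(1) M_factors(2) by (simp only: ac_simps)
  have "1 < q ^ (2 * n)" using q2 n1 by (intro one_less_power) auto
  then have m0: "0 < m" using N by (intro Nat.gr0I) simp
  let ?S = "{x \<in> carrier K. x [^] (q - 1) = \<one>}"
  have F: "F = insert \<zero> ?S"
    using F_iff_pow q2 by (auto simp: nat_pow_zero)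
  have "inj_on (\<lambda>k::nat. (g [^] m) [^] k) {..<q - 1}"
  proof (rule inj_on_pow_lessThan)
    show "g [^] m \<in> Units K" using g by (simp add: field_Units)
    show "(g [^] m) [^] k = \<one> \<longleftrightarrow> q - 1 dvd k" for k :: nat
      using g m0 unfolding nat_pow_pow[OF g(1)] g(3) N by simp
  qed
  then have "card ((\<lambda>k::nat. (g [^] m) [^] k) ` {..<q - 1}) = q - 1"
    by (simp add: card_image)
  moreover have "(\<lambda>k::nat. (g [^] m) [^] k) ` {..<q - 1} \<subseteq> ?S"
    using g(1) nat_pow_pow[OF g(1)] g(3) unfolding N by auto
  moreover have "finite ?S" using fin by simp
  ultimately have "q - 1 \<le> card ?S"
    using card_mono[of ?S "(\<lambda>k::nat. (g [^] m) [^] k) ` {..<q - 1}"] by linarith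
  moreover have "card ?S \<le> q - 1" using num_roots_le_deg[OF fin, of "q - 1"] q2 by simp
  moreover have "card F = Suc (card ?S)"
    unfolding F using \<open>finite ?S\<close> q2 by (subst card_insert_disjoint) (auto simp: nat_pow_zero)
  ultimately show ?thesis using q2 by linarith
qed

end

section \<open>The norm on a two-dimensional subspace\<close>

context kummer_generator
begin

lemma n_coprime: "coprime n (q - 1)"
proof (rule ccontr)
  assume "\<not> coprime n (q - 1)"
  then obtain r where r: "Factorial_Ring.prime r" "r dvd n" "r dvd q - 1"
    by (metis coprime_iff_gcd_eq_1 gcd_greatest_iff prime_factor_nat)
  have "r dvd (q + 1) - (q - 1)" using dvd_diff_nat[OF n_primes[OF r(1,2)] r(3)] .
  then have "r dvd 2" using q2 by simp
  then have "r = 2" using r(1) by (simp add: primes_dvd_imp_eq)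
  then show False using r(2) odd_n by simp
qed

text \<open>The exponent \<open>n\<close> is prime to \<open>q - 1\<close>: a common prime would divide \<open>q + 1\<close> and so be \<open>2\<close>.\<close>

lemma F_pow_n_inj:
  assumes "x \<in> F" "y \<in> F" "x [^] n = y [^] n"
  shows "x = y"
proof (cases "y = \<zero>")
  case True
  then have "x [^] n = \<zero>" using assms n1 by (simp add: nat_pow_zero)
  then show ?thesis using nat_pow_eq_zeroD[of x n] assms True by simp
next
  case False
  define z where "z = x \<otimes> inv y"
  have y: "y \<in> carrier K" "x \<in> carrier K" using assms by auto
  have z: "z \<in> F" unfolding z_def using assms False by auto
  have xz: "x = z \<otimes> y" unfolding z_def using y False by (simp add: m_assoc)
  have zn: "z [^] n = \<one>"
  proof -
    have "z [^] n = x [^] n \<otimes> inv y [^] n" unfolding z_def using y False by (simp add: nat_pow_distrib)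
    also have "\<dots> = (y \<otimes> inv y) [^] n" using y False assms(3) by (subst nat_pow_distrib) auto
    finally show ?thesis using y False by simp
  qed
  have z0: "z \<noteq> \<zero>"
  proof
    assume "z = \<zero>"
    then show False using zn n1 by (simp add: nat_pow_zero)
  qed
  have zq: "z [^] (q - 1) = \<one>" using F_iff_pow[of z] z z0 by blast
  obtain u v where uv: "n * u = (q - 1) * v + 1"
    using coprime_bezout_strong[OF n_coprime] q2 n1 bezout_nat[of n "q - 1"] n_coprime
    by (metis coprime_imp_gcd_eq_1 not_one_less_zero not_less0 less_numeral_extra(3))
  have zc: "z \<in> carrier K" using z by auto
  have "z = z [^] ((q - 1) * v + 1)" using zq zc by (simp add: nat_pow_mult[symmetric] nat_pow_pow[symmetric])
  also have "\<dots> = \<one>" unfolding uv[symmetric] using zn zc by (simp add: nat_pow_pow[symmetric])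
  finally show ?thesis using xz y by simp
qed

lemma b_notin_F: "b \<notin> F"
proof
  assume "b \<in> F"
  then have "n * (q ^ 2 - 1) dvd q - 1" using F_iff_pow[OF b] ord_b by blast
  then have "n * (q ^ 2 - 1) \<le> q - 1" using q2 by (intro dvd_imp_le) auto
  moreover have "1 * (q - 1) < n * (q ^ 2 - 1)"
    unfolding q_sq using n1 q2 by (intro mult_less_le_imp_less) auto
  ultimately show False by simp
qed

lemma bn_notin_F: "b [^] n \<notin> F"
proof
  assume "b [^] n \<in> F"
  then have "(b [^] n) [^] (q - 1) = \<one>" using F_iff_pow[of "b [^] n"] b by simp
  then have "n * (q ^ 2 - 1) dvd n * (q - 1)" using ord_b b by (simp add: nat_pow_pow)
  then have "q ^ 2 - 1 dvd q - 1" using n1 by simp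
  then have "(q - 1) * (q + 1) \<le> q - 1" unfolding q_sq[symmetric] using q2 by (intro dvd_imp_le) auto
  moreover have "(q - 1) * 2 \<le> (q - 1) * (q + 1)" using q2 by (intro mult_le_mono2) simp
  ultimately show False using q2 by linarith
qed

lemma lin_indep:
  assumes t: "t \<in> carrier K" "t \<notin> F" and F: "x \<in> F" "y \<in> F" and z: "x \<oplus> y \<otimes> t = \<zero>"
  shows "x = \<zero> \<and> y = \<zero>"
proof (cases "y = \<zero>")
  case True
  then show ?thesis using z F t by simp
next
  case False
  have c: "x \<in> carrier K" "y \<in> carrier K" using F by auto
  have "t = inv y \<otimes> (y \<otimes> t)" using c t False by (simp add: m_assoc[symmetric])
  also have "y \<otimes> t = \<ominus> x" using z c t by (metis add.m_closed minus_equality a_comm m_closed)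
  finally have "t \<in> F" using F False by simp
  then show ?thesis using t by simp
qed

lemma L_I: "x \<in> F \<Longrightarrow> y \<in> F \<Longrightarrow> x \<oplus> y \<otimes> b \<in> L"
  unfolding L_def by blast

lemma L_E: "s \<in> L \<Longrightarrow> (\<And>x y. x \<in> F \<Longrightarrow> y \<in> F \<Longrightarrow> s = x \<oplus> y \<otimes> b \<Longrightarrow> P) \<Longrightarrow> P"
  unfolding L_def by blast

lemma L_closed [simp, intro]:
  "s \<in> L \<Longrightarrow> s \<in> carrier K" "\<zero> \<in> L" "\<one> \<in> L" "b \<in> L"
  "s \<in> L \<Longrightarrow> t \<in> L \<Longrightarrow> s \<oplus> t \<in> L" "s \<in> L \<Longrightarrow> x \<in> F \<Longrightarrow> x \<otimes> s \<in> L"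
  "s \<in> L \<Longrightarrow> \<ominus> s \<in> L"
proof -
  show "s \<in> L \<Longrightarrow> s \<in> carrier K" using b by (auto elim!: L_E)
  show "\<zero> \<in> L" using L_I[of \<zero> \<zero>] b by simp
  show "\<one> \<in> L" using L_I[of \<one> \<zero>] b by simp
  show "b \<in> L" using L_I[of \<zero> \<one>] b by simp
  show "s \<oplus> t \<in> L" if s: "s \<in> L" and t: "t \<in> L"
  proof -
    obtain x y where xy: "x \<in> F" "y \<in> F" "s = x \<oplus> y \<otimes> b" using s by (rule L_E)
    obtain u v where uv: "u \<in> F" "v \<in> F" "t = u \<oplus> v \<otimes> b" using t by (rule L_E)
    have "s \<oplus> t = (x \<oplus> u) \<oplus> (y \<oplus> v) \<otimes> b"
      unfolding xy uv using F_closed(1)[OF xy(1)] F_closed(1)[OF xy(2)] F_closed(1)[OF uv(1)] F_closed(1)[OF uv(2)] b by algebra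
    then show ?thesis using L_I[of "x \<oplus> u" "y \<oplus> v"] xy uv by simp
  qed
  show sm: "x \<otimes> s \<in> L" if s: "s \<in> L" and x: "x \<in> F" for x
  proof -
    obtain u v where uv: "u \<in> F" "v \<in> F" "s = u \<oplus> v \<otimes> b" using s by (rule L_E)
    have "x \<otimes> s = (x \<otimes> u) \<oplus> (x \<otimes> v) \<otimes> b"
      unfolding uv using F_closed(1)[OF x] F_closed(1)[OF uv(1)] F_closed(1)[OF uv(2)] b by algebra
    then show ?thesis using L_I[of "x \<otimes> u" "x \<otimes> v"] x uv by simp
  qed
  show "\<ominus> s \<in> L" if s: "s \<in> L"
  proof -
    have "s \<in> carrier K" using s b by (auto elim!: L_E)
    then have "\<ominus> s = \<ominus> \<one> \<otimes> s" by algebra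
    then show ?thesis using sm[OF s, of "\<ominus> \<one>"] by simp
  qed
qed

lemma card_L: "card L = q ^ 2"
proof -
  have "inj_on (\<lambda>(x, y). x \<oplus> y \<otimes> b) (F \<times> F)"
  proof (rule inj_onI, clarify)
    fix x y u v assume F: "x \<in> F" "y \<in> F" "u \<in> F" "v \<in> F" and eq: "x \<oplus> y \<otimes> b = u \<oplus> v \<otimes> b"
    have c: "x \<in> carrier K" "y \<in> carrier K" "u \<in> carrier K" "v \<in> carrier K" using F by auto
    have "(x \<ominus> u) \<oplus> (y \<ominus> v) \<otimes> b = (x \<oplus> y \<otimes> b) \<ominus> (u \<oplus> v \<otimes> b)" using c b by algebra
    also have "\<dots> = \<zero>" using eq c b by simp
    finally have "x \<ominus> u = \<zero> \<and> y \<ominus> v = \<zero>" using F by (intro lin_indep[OF b(1) b_notin_F]) auto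
    then show "x = u \<and> y = v" using c by simp
  qed
  moreover have "L = (\<lambda>(x, y). x \<oplus> y \<otimes> b) ` (F \<times> F)" unfolding L_def by auto
  ultimately show ?thesis by (simp add: card_image card_F card_cartesian_product power2_eq_square)
qed

text \<open>The \<open>q^(2i)\<close>-th power map is additive and fixes \<open>F\<close>.\<close>

lemma frob_Q: 
  assumes "x \<in> F" "y \<in> F"
  shows "(x \<oplus> y \<otimes> b) [^] ((q ^ 2) ^ i) = x \<oplus> y \<otimes> b [^] ((q ^ 2) ^ i)"
proof -
  have Fp: "z [^] ((q ^ 2) ^ i) = z" if "z \<in> F" for z
  proof -
    have z: "z \<in> carrier K" "z [^] q = z" using that unfolding F_def by auto
    have "z [^] (q ^ k) = z" for k
    proof (induction k)
      case (Suc k)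
      have "z [^] (q ^ Suc k) = (z [^] (q ^ k)) [^] q"
        unfolding nat_pow_pow[OF z(1)] by (simp add: mult.commute)
      then show ?case using Suc z(2) by simp
    qed (use z in simp)
    from this[of "2 * i"] show ?thesis by (simp add: power_mult)
  qed
  have Q: "(q ^ 2) ^ i = p ^ (e * (2 * i))" unfolding q by (simp add: power_mult)
  have c: "x \<in> carrier K" "y \<in> carrier K" using assms by auto
  have "(x \<oplus> y \<otimes> b) [^] ((q ^ 2) ^ i) = x [^] ((q ^ 2) ^ i) \<oplus> (y \<otimes> b) [^] ((q ^ 2) ^ i)"
    unfolding Q using c b by (intro frobenius_pow_add[OF p char]) auto
  also have "(y \<otimes> b) [^] ((q ^ 2) ^ i) = y [^] ((q ^ 2) ^ i) \<otimes> b [^] ((q ^ 2) ^ i)"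
    using c b by (intro nat_pow_distrib)
  finally show ?thesis using Fp assms by simp
qed

text \<open>If \<open>b^(Q^i) = b^(Q^j)\<close> with \<open>i \<le> j\<close>, the order of \<open>b\<close> gives that \<open>n\<close> divides
\<open>(Q^(j-i) - 1) / (Q - 1)\<close>, hence \<open>j - i\<close>, by lifting the exponent.\<close>

lemma conj_inj: "inj_on (\<lambda>i. b [^] ((q ^ 2) ^ i)) {..<n}"
proof -
  have Q1: "2 \<le> q ^ 2" using q2 by (metis le_trans power2_nat_le_imp_le self_le_power zero_less_numeral le_refl power2_eq_square mult_le_mono1 nat_mult_1 one_le_numeral)
  have "i = j" if ij: "i \<le> j" "j < n" and eq: "b [^] ((q ^ 2) ^ i) = b [^] ((q ^ 2) ^ j)" for i j
  proof -
    let ?Q = "q ^ 2"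
    have le: "?Q ^ i \<le> ?Q ^ j" using ij Q1 by (intro power_increasing) auto
    have split: "?Q ^ j - ?Q ^ i = ?Q ^ i * (?Q ^ (j - i) - 1)"
      using ij by (simp add: diff_mult_distrib2 power_add[symmetric])
    have "b [^] (?Q ^ i) \<otimes> b [^] (?Q ^ j - ?Q ^ i) = b [^] (?Q ^ i) \<otimes> \<one>"
      using b le eq by (subst nat_pow_mult) auto
    then have "b [^] (?Q ^ j - ?Q ^ i) = \<one>"
      using b m_lcancel[of "b [^] (?Q ^ i)" "b [^] (?Q ^ j - ?Q ^ i)" \<one>] by simp
    then have "n * (?Q - 1) dvd ?Q ^ i * ((?Q - 1) * (\<Sum>k<j - i. ?Q ^ k))"
      unfolding ord_b split repunit_geometric .
    then have "(?Q - 1) * n dvd (?Q - 1) * (?Q ^ i * (\<Sum>k<j - i. ?Q ^ k))" by (simp only: ac_simps)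
    then have d: "n dvd ?Q ^ i * (\<Sum>k<j - i. ?Q ^ k)" using Q1 by simp
    have Qc: "[?Q = 1] (mod r)" if "Factorial_Ring.prime r" "r dvd n" for r
    proof -
      have "r dvd ?Q - 1" unfolding q_sq by (intro dvd_mult n_primes that)
      moreover have "[?Q = 1] (mod r) \<longleftrightarrow> r dvd ?Q - 1" using Q1 by (intro cong_altdef_nat) simp
      ultimately show ?thesis by blast
    qed
    have "coprime n ?Q"
    proof (rule ccontr)
      assume "\<not> coprime n ?Q"
      then obtain r where r: "Factorial_Ring.prime r" "r dvd n" "r dvd ?Q"
        by (metis coprime_iff_gcd_eq_1 gcd_greatest_iff prime_factor_nat)
      then have "r dvd 1" using Qc[OF r(1,2)] by (metis cong_dvd_iff)
      then show False using r(1) by simp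
    qed
    then have "n dvd (\<Sum>k<j - i. ?Q ^ k)" using d by (simp add: coprime_dvd_mult_right_iff)
    then have "n dvd j - i" using dvd_repunit_iff[OF odd_n _ Qc, of "j - i"] Q1 q2 by simp
    then show "i = j" using ij dvd_imp_le[of n "j - i"] by linarith
  qed
  then show ?thesis by (intro inj_onI) (metis lessThan_iff nat_le_linear)
qed

lemma minus_pow_odd: "x \<in> carrier K \<Longrightarrow> (\<ominus> x) [^] n = \<ominus> (x [^] n)"
proof -
  assume x: "x \<in> carrier K"
  obtain m where m: "n = 2 * m + 1" using odd_n by (metis oddE)
  have "(\<ominus> x) [^] (2 * m) = ((\<ominus> x) [^] (2::nat)) [^] m" using x by (simp add: nat_pow_pow)
  also have "(\<ominus> x) [^] (2::nat) = x [^] (2::nat)"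
    using x by (simp add: numeral_2_eq_2 l_minus r_minus)
  also have "(x [^] (2::nat)) [^] m = x [^] (2 * m)" using x by (simp add: nat_pow_pow)
  finally show ?thesis unfolding m using x by (simp add: r_minus)
qed

text \<open>The left side is the product of the \<open>x + y b^(Q^i)\<close>. Up to sign and the factor \<open>y^n\<close> it is the
value of \<open>X^n - c\<close> at \<open>- x / y\<close>, where \<open>c = b^n\<close>; the signs cancel as \<open>n\<close> is odd.\<close>

lemma norm_formula:
  assumes F: "x \<in> F" "y \<in> F"
  shows "(x \<oplus> y \<otimes> b) [^] (\<Sum>i<n. (q ^ 2) ^ i) = x [^] n \<oplus> y [^] n \<otimes> b [^] n"
proof -
  have c: "x \<in> carrier K" "y \<in> carrier K" using F by auto
  let ?\<beta> = "\<lambda>i. b [^] ((q ^ 2) ^ i)"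
  have pow_sum: "z [^] (\<Sum>i<m. f i) = (\<Otimes>i\<in>{..<m}. z [^] (f i))" if "z \<in> carrier K" for z and f :: "nat \<Rightarrow> nat" and m
    using that by (induction m) (auto simp: lessThan_Suc nat_pow_mult[symmetric] m_comm)
  have "(x \<oplus> y \<otimes> b) [^] (\<Sum>i<n. (q ^ 2) ^ i) = (\<Otimes>i\<in>{..<n}. (x \<oplus> y \<otimes> b) [^] ((q ^ 2) ^ i))"
    using c b by (intro pow_sum) auto
  also have "\<dots> = (\<Otimes>i\<in>{..<n}. x \<oplus> y \<otimes> ?\<beta> i)"
    using frob_Q[OF F] c b by (intro finprod_cong') auto
  also have "\<dots> = x [^] n \<oplus> y [^] n \<otimes> b [^] n"
  proof (cases "y = \<zero>")
    case True
    have "(\<Otimes>i\<in>{..<n}. x \<oplus> y \<otimes> ?\<beta> i) = (\<Otimes>i\<in>{..<n}. x)"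
      using True c b by (intro finprod_cong') auto
    then show ?thesis using True c b n1 by (simp add: finprod_const nat_pow_zero)
  next
    case False
    \<comment> \<open>The negatives of the conjugates of \<open>b\<close> are the roots of \<open>X^n + b^n\<close>, as \<open>n\<close> is odd.\<close>
    let ?B = "(\<lambda>i. \<ominus> ?\<beta> i) ` {..<n}"
    let ?x = "inv y \<otimes> x"
    have xc: "?x \<in> carrier K" using c False by simp
    have yx: "y \<otimes> ?x = x" using c False m_assoc[of y "inv y" x] by simp
    have inj: "inj_on (\<lambda>i. \<ominus> ?\<beta> i) {..<n}"
      using conj_inj b unfolding inj_on_def by (metis minus_minus nat_pow_closed)
    then have cB: "card ?B = n" by (simp add: card_image)
    have roots: "\<beta> [^] card ?B = \<ominus> (b [^] n)" if bB: "\<beta> \<in> ?B" for \<beta>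
    proof -
      obtain i where i: "\<beta> = \<ominus> ?\<beta> i" using bB by auto
      have dv: "(q ^ 2 - 1) dvd ((q ^ 2) ^ i - 1)"
        unfolding repunit_geometric[symmetric] by simp
      have "(b [^] ((q ^ 2) ^ i)) [^] n = b [^] (n * ((q ^ 2) ^ i - 1) + n)"
      proof -
        have "1 \<le> (q ^ 2) ^ i" using q2 by (intro one_le_power) auto
        then have "(q ^ 2) ^ i * n = n * ((q ^ 2) ^ i - 1) + n"
          by (simp add: diff_mult_distrib2 mult.commute)
        then show ?thesis using b by (simp add: nat_pow_pow)
      qed
      also have "\<dots> = b [^] (n * ((q ^ 2) ^ i - 1)) \<otimes> b [^] n" using b by (simp add: nat_pow_mult)
      also have "b [^] (n * ((q ^ 2) ^ i - 1)) = \<one>"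
        unfolding ord_b using dv by (intro mult_dvd_mono) auto
      finally show ?thesis unfolding cB i using b minus_pow_odd[of "?\<beta> i"] by simp
    qed
    have "(\<Otimes>\<beta>\<in>?B. ?x \<ominus> \<beta>) = ?x [^] card ?B \<ominus> \<ominus> (b [^] n)"
      using b n1 cB roots xc by (intro prod_minus_roots) auto
    moreover have "(\<Otimes>\<beta>\<in>?B. ?x \<ominus> \<beta>) = (\<Otimes>i\<in>{..<n}. ?x \<ominus> \<ominus> ?\<beta> i)"
      using inj xc b by (intro finprod_reindex) auto
    ultimately have pr: "(\<Otimes>i\<in>{..<n}. ?x \<oplus> ?\<beta> i) = ?x [^] n \<oplus> b [^] n"
      using cB b by (simp add: a_minus_def)
    have "(\<Otimes>i\<in>{..<n}. x \<oplus> y \<otimes> ?\<beta> i) = (\<Otimes>i\<in>{..<n}. y \<otimes> (?x \<oplus> ?\<beta> i))"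
    proof (rule finprod_cong')
      fix i
      show "x \<oplus> y \<otimes> ?\<beta> i = y \<otimes> (?x \<oplus> ?\<beta> i)"
        using c b xc yx by (simp add: r_distr)
    qed (use c b xc in auto)
    also have "\<dots> = (\<Otimes>i\<in>{..<n}. y) \<otimes> (\<Otimes>i\<in>{..<n}. ?x \<oplus> ?\<beta> i)"
      using c b xc by (intro finprod_multf) auto
    also have "\<dots> = y [^] n \<otimes> (?x [^] n \<oplus> b [^] n)" using pr c by (simp add: finprod_const)
    also have "\<dots> = (y \<otimes> ?x) [^] n \<oplus> y [^] n \<otimes> b [^] n"
      using c xc b by (simp add: r_distr nat_pow_distrib)
    finally show ?thesis unfolding yx .
  qed
  finally show ?thesis .
qed

end

section \<open>The spread\<close>

lemma card_le_fibres:
  assumes "finite A" and fib: "\<And>r. r \<in> f ` A \<Longrightarrow> card {s \<in> A. f s = r} \<le> m"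
  shows "card A \<le> card (f ` A) * m"
proof -
  have "A = (\<Union>r\<in>f ` A. {s \<in> A. f s = r})" by auto
  then have "card A = card (\<Union>r\<in>f ` A. {s \<in> A. f s = r})" by simp
  also have "\<dots> \<le> (\<Sum>r\<in>f ` A. card {s \<in> A. f s = r})" using assms(1) by (intro card_UN_le) simp
  also have "\<dots> \<le> (\<Sum>r\<in>f ` A. m)" by (rule sum_mono[OF fib])
  finally show ?thesis by simp
qed

context kummer_generator
begin

text \<open>Equal \<open>M\<close>-th powers mean that the norms \<open>x^n + y^n c\<close> and \<open>u^n + v^n c\<close> differ by a factor
\<open>z \<in> F\<close>. As \<open>c\<close> is not in \<open>F\<close>, coefficients can be compared, so \<open>(x v)^n = (u y)^n\<close>, and
\<open>n\<close>-th powers are injective on \<open>F\<close>.\<close>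

lemma pow_M_inj:
  assumes s: "s \<in> L" "s \<noteq> \<zero>" and s': "s' \<in> L" "s' \<noteq> \<zero>" and eq: "s [^] M = s' [^] M"
  shows "\<exists>z\<in>F - {\<zero>}. s' = z \<otimes> s"
proof -
  obtain x y where xy: "x \<in> F" "y \<in> F" "s = x \<oplus> y \<otimes> b" using s(1) by (rule L_E)
  obtain u v where uv: "u \<in> F" "v \<in> F" "s' = u \<oplus> v \<otimes> b" using s'(1) by (rule L_E)
  have c: "x \<in> carrier K" "y \<in> carrier K" "u \<in> carrier K" "v \<in> carrier K" using xy uv by auto
  let ?E = "\<Sum>i<n. (q ^ 2) ^ i" and ?c = "b [^] n"
  define A where "A = x [^] n \<oplus> y [^] n \<otimes> ?c"
  define A' where "A' = u [^] n \<oplus> v [^] n \<otimes> ?c"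
  have AK: "A \<in> carrier K" "A' \<in> carrier K" unfolding A_def A'_def using c b by auto
  have A: "s [^] ?E = A" "s' [^] ?E = A'"
    unfolding xy(3) uv(3) A_def A'_def using norm_formula xy uv by blast+
  have A0: "A \<noteq> \<zero>" "A' \<noteq> \<zero>" using A pow_nonzero s s' by (metis L_closed(1))+
  have sc: "s \<in> carrier K" "s' \<in> carrier K" using s s' by auto
  have Aq: "A [^] (q - 1) = A' [^] (q - 1)"
  proof -
    have "s [^] M = A [^] (q - 1)" "s' [^] M = A' [^] (q - 1)"
      unfolding M_factors(2) A[symmetric] nat_pow_pow[OF sc(1)] nat_pow_pow[OF sc(2)] by (simp_all add: mult.commute)
    then show ?thesis using eq by simp
  qed
  define z where "z = A \<otimes> inv A'"
  have zc: "z \<in> carrier K" "z \<noteq> \<zero>" unfolding z_def using AK A0 integral[of A "inv A'"] by auto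
  have "z [^] (q - 1) = A [^] (q - 1) \<otimes> inv A' [^] (q - 1)"
    unfolding z_def using AK A0 by (intro nat_pow_distrib) auto
  also have "\<dots> = (A' \<otimes> inv A') [^] (q - 1)" unfolding Aq using AK A0 by (intro nat_pow_distrib[symmetric]) auto
  finally have "z [^] (q - 1) = \<one>" using AK A0 by simp
  then have z: "z \<in> F" using F_iff_pow[OF zc] by blast
  have Az: "A = z \<otimes> A'" unfolding z_def using AK A0 by (simp add: m_assoc)
  have xn: "x [^] n \<in> F" "y [^] n \<in> F" "u [^] n \<in> F" "v [^] n \<in> F" using xy uv by auto
  have "(x [^] n \<ominus> z \<otimes> u [^] n) \<oplus> (y [^] n \<ominus> z \<otimes> v [^] n) \<otimes> ?c = A \<ominus> z \<otimes> A'"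
    unfolding A_def A'_def
    using F_closed(1)[OF xn(1)] F_closed(1)[OF xn(2)] F_closed(1)[OF xn(3)] F_closed(1)[OF xn(4)] zc(1) nat_pow_closed[OF b(1), of n]
    by algebra
  also have "\<dots> = \<zero>" using Az AK zc by simp
  finally have "x [^] n \<ominus> z \<otimes> u [^] n = \<zero> \<and> y [^] n \<ominus> z \<otimes> v [^] n = \<zero>"
    using xn z b by (intro lin_indep[OF _ bn_notin_F]) auto
  then have xz: "x [^] n = z \<otimes> u [^] n" "y [^] n = z \<otimes> v [^] n" using c zc by auto
  have "(x \<otimes> v) [^] n = (u \<otimes> y) [^] n"
    using c zc xz by (simp add: nat_pow_distrib m_ac)
  then have xv: "x \<otimes> v = u \<otimes> y" by (rule F_pow_n_inj[OF F_closed(5)[OF xy(1) uv(2)] F_closed(5)[OF uv(1) xy(2)]])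
  have e1: "y \<otimes> s' = v \<otimes> s"
  proof -
    have "y \<otimes> s' = u \<otimes> y \<oplus> y \<otimes> v \<otimes> b" unfolding uv using c b by algebra
    also have "\<dots> = v \<otimes> s" unfolding xv[symmetric] xy using c b by algebra
    finally show ?thesis .
  qed
  have e2: "x \<otimes> s' = u \<otimes> s"
  proof -
    have "x \<otimes> s' = x \<otimes> u \<oplus> (x \<otimes> v) \<otimes> b" unfolding uv using c b by algebra
    also have "\<dots> = u \<otimes> s" unfolding xv xy using c b by algebra
    finally show ?thesis .
  qed
  \<comment> \<open>At least one of the coordinates \<open>x\<close>, \<open>y\<close> of \<open>s\<close> is nonzero, and either relation then serves.\<close>
  have fin: "\<exists>z\<in>F - {\<zero>}. s' = z \<otimes> s" if "y' \<otimes> s' = v' \<otimes> s" "y' \<in> F" "v' \<in> F" "y' \<noteq> \<zero>" for y' v'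
  proof -
    have c': "y' \<in> carrier K" "v' \<in> carrier K" using that by auto
    have "s' = inv y' \<otimes> (y' \<otimes> s')" using c' sc that(4) m_assoc[of "inv y'" y' s'] by simp
    then have "s' = inv y' \<otimes> v' \<otimes> s" using c' sc that(1,4) by (simp add: m_assoc)
    moreover have "inv y' \<otimes> v' \<noteq> \<zero>" using calculation s' sc by auto
    moreover have "inv y' \<otimes> v' \<in> F" using that by auto
    ultimately show ?thesis by blast
  qed
  show ?thesis
  proof (cases "y = \<zero>")
    case True
    then have "x \<noteq> \<zero>" using s xy b by auto
    then show ?thesis using fin[OF e2] xy uv by blast
  next
    case False
    then show ?thesis using fin[OF e1] xy uv by blast
  qed
qed

lemma F_pow_M: "z \<in> F \<Longrightarrow> z \<noteq> \<zero> \<Longrightarrow> z [^] M = \<one>"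
proof -
  assume z: "z \<in> F" "z \<noteq> \<zero>"
  then have "z [^] (q - 1) = \<one>" using F_iff_pow by auto
  then show ?thesis unfolding M_factors(2) using z by (simp add: nat_pow_pow[symmetric])
qed

lemma card_scalar_orbit:
  assumes "s \<in> carrier K" "s \<noteq> \<zero>"
  shows "card ((\<lambda>z. z \<otimes> s) ` (F - {\<zero>})) = q - 1"
proof -
  have "inj_on (\<lambda>z. z \<otimes> s) (F - {\<zero>})"
    using assms m_rcancel by (intro inj_onI) auto
  then show ?thesis
    using card_F by (simp add: card_image)
qed

lemma finite_subset_carrier: "A \<subseteq> carrier K \<Longrightarrow> finite A"
  using fin finite_subset by blast

lemma finite_F [simp]: "finite F" by (rule finite_subset_carrier) auto
lemma finite_L [simp]: "finite L" by (rule finite_subset_carrier) auto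

lemma pow_M_roots:
  assumes "t \<in> carrier K" "t \<noteq> \<zero>"
  shows "(t [^] M) [^] (q + 1) = \<one>"
  unfolding nat_pow_pow[OF assms(1)] M_factors(1)[symmetric] by (rule pow_card[OF assms])

text \<open>The \<open>q^2 - 1\<close> nonzero elements of \<open>L\<close> fall into fibres of size at most \<open>q - 1\<close>, so at least
\<open>q + 1\<close> values are taken; there are at most \<open>q + 1\<close> candidates.\<close>

lemma pow_M_surj:
  assumes t: "t \<in> carrier K" "t [^] (q + 1) = \<one>"
  shows "\<exists>s\<in>L - {\<zero>}. s [^] M = t"
proof -
  let ?\<mu> = "{t \<in> carrier K. t [^] (q + 1) = \<one>}"
  let ?I = "(\<lambda>s. s [^] M) ` (L - {\<zero>})"
  have I: "?I \<subseteq> ?\<mu>" using pow_M_roots by auto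
  have fib: "card {s \<in> L - {\<zero>}. s [^] M = r} \<le> q - 1" if rI: "r \<in> ?I" for r
  proof -
    obtain s where s: "s \<in> L" "s \<noteq> \<zero>" "r = s [^] M" using rI by auto
    have "{s \<in> L - {\<zero>}. s [^] M = r} \<subseteq> (\<lambda>z. z \<otimes> s) ` (F - {\<zero>})"
      using pow_M_inj[OF s(1,2)] s(3) by fastforce
    then have "card {s \<in> L - {\<zero>}. s [^] M = r} \<le> card ((\<lambda>z. z \<otimes> s) ` (F - {\<zero>}))"
      by (intro card_mono) auto
    then show ?thesis using card_scalar_orbit[of s] s by simp
  qed
  have "card (L - {\<zero>}) \<le> card ?I * (q - 1)" using fib by (intro card_le_fibres) auto
  moreover have "card (L - {\<zero>}) = (q + 1) * (q - 1)"
    using card_L q_sq by (simp add: mult.commute)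
  ultimately have "(q + 1) * (q - 1) \<le> card ?I * (q - 1)" by linarith
  then have "q + 1 \<le> card ?I" using q2 mult_le_cancel2[of "q + 1" "q - 1" "card ?I"] by linarith
  moreover have "card ?\<mu> \<le> q + 1" using num_roots_le_deg[OF fin, of "q + 1"] by simp
  ultimately have eq: "?I = ?\<mu>" using I fin by (intro card_seteq) auto
  have "t \<in> ?I" unfolding eq using t by simp
  then show ?thesis by (metis imageE)
qed

lemma C_closed [simp, intro]:
  "a \<in> C \<Longrightarrow> a \<in> carrier K" "a \<in> C \<Longrightarrow> a \<noteq> \<zero>" "\<one> \<in> C" "a \<in> C \<Longrightarrow> a' \<in> C \<Longrightarrow> a \<otimes> a' \<in> C"
  "a \<in> C \<Longrightarrow> inv a \<in> C"
proof -
  show *: "a \<in> C \<Longrightarrow> a \<in> carrier K" "a \<in> C \<Longrightarrow> a \<noteq> \<zero>" "\<one> \<in> C" unfolding C_def by auto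
  show "a \<otimes> a' \<in> C" if "a \<in> C" "a' \<in> C"
    using that integral[of a a'] unfolding C_def by (auto simp: nat_pow_distrib)
  show "inv a \<in> C" if a: "a \<in> C"
  proof -
    have aK: "a \<in> carrier K" "a \<noteq> \<zero>" "a [^] M = \<one>" using a unfolding C_def by auto
    have "inv a [^] M = a [^] M \<otimes> inv a [^] M" using aK by simp
    also have "\<dots> = (a \<otimes> inv a) [^] M" using aK(1,2) by (intro nat_pow_distrib[symmetric]) auto
    finally have "inv a [^] M = \<one>" using aK(1,2) by simp
    then show ?thesis using aK unfolding C_def by simp
  qed
qed

lemma C_mult_pow_M:
  assumes "k \<in> C" "s \<in> carrier K"
  shows "(k \<otimes> s) [^] M = s [^] M"
proof -
  have "k [^] M = \<one>" "k \<in> carrier K" using assms(1) unfolding C_def by auto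
  then show ?thesis using nat_pow_distrib[of k s M] assms(2) by simp
qed

lemma F_sub_C: "z \<in> F \<Longrightarrow> z \<noteq> \<zero> \<Longrightarrow> z \<in> C"
  using F_pow_M unfolding C_def by auto

text \<open>Some \<open>s \<in> L\<close> has the same \<open>M\<close>-th power as \<open>w\<close>; then \<open>w / s\<close> lies in \<open>C\<close>.\<close>

lemma spread_cover:
  assumes w: "w \<in> carrier K" "w \<noteq> \<zero>"
  shows "\<exists>k\<in>C. \<exists>s\<in>L - {\<zero>}. w = k \<otimes> s"
proof -
  obtain s where s: "s \<in> L" "s \<noteq> \<zero>" "s [^] M = w [^] M"
    using pow_M_surj[of "w [^] M"] pow_M_roots[OF w] w by auto
  have sK: "s \<in> carrier K" using s by auto
  let ?k = "w \<otimes> inv s"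
  have "?k [^] M = w [^] M \<otimes> inv s [^] M" using w sK s by (intro nat_pow_distrib) auto
  also have "\<dots> = (s \<otimes> inv s) [^] M" unfolding s(3)[symmetric] using sK s(2) by (intro nat_pow_distrib[symmetric]) auto
  finally have "?k [^] M = \<one>" using sK s by simp
  moreover have "?k \<noteq> \<zero>" using w sK s integral[of w "inv s"] by auto
  ultimately have "?k \<in> C" unfolding C_def using w sK s by simp
  moreover have "w = ?k \<otimes> s" using w sK s by (simp add: m_assoc)
  ultimately show ?thesis using s by blast
qed

definition dilate :: "'a \<Rightarrow> 'a set \<Rightarrow> 'a set" where
  "dilate k A = (\<lambda>s. k \<otimes> s) ` A"

lemma dilate_one: "A \<subseteq> carrier K \<Longrightarrow> dilate \<one> A = A"
  unfolding dilate_def by force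

lemma dilate_dilate: "k \<in> carrier K \<Longrightarrow> k' \<in> carrier K \<Longrightarrow> A \<subseteq> carrier K \<Longrightarrow> dilate k (dilate k' A) = dilate (k \<otimes> k') A"
  unfolding dilate_def image_image by (intro image_cong refl) (auto simp: m_assoc)

lemma dilate_F_L: "z \<in> F \<Longrightarrow> z \<noteq> \<zero> \<Longrightarrow> dilate z L = L"
proof -
  assume z: "z \<in> F" "z \<noteq> \<zero>"
  have "dilate z L \<subseteq> L" using z unfolding dilate_def by auto
  moreover have "L \<subseteq> dilate z L"
  proof
    fix s assume s: "s \<in> L"
    have "z \<otimes> (inv z \<otimes> s) = s" using z s m_assoc[of z "inv z" s] by simp
    moreover have "inv z \<otimes> s \<in> L" using z s by auto
    ultimately show "s \<in> dilate z L" unfolding dilate_def by force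
  qed
  ultimately show ?thesis by blast
qed

lemma spread_unique:
  assumes k: "k \<in> C" "k' \<in> C" and w: "w \<in> dilate k L" "w \<in> dilate k' L" "w \<noteq> \<zero>"
  shows "dilate k L = dilate k' L"
proof -
  obtain s s' where s: "s \<in> L" "w = k \<otimes> s" "s' \<in> L" "w = k' \<otimes> s'" using w unfolding dilate_def by auto
  have K: "k \<in> carrier K" "k' \<in> carrier K" "s \<in> carrier K" "s' \<in> carrier K" "k \<noteq> \<zero>" "k' \<noteq> \<zero>"
    using k s by auto
  have s0: "s \<noteq> \<zero>" "s' \<noteq> \<zero>" using s w(3) K by auto
  have "w [^] M = s [^] M" unfolding s(2) by (rule C_mult_pow_M[OF k(1) K(3)])
  moreover have "w [^] M = s' [^] M" unfolding s(4) by (rule C_mult_pow_M[OF k(2) K(4)])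
  ultimately obtain z where z: "z \<in> F" "z \<noteq> \<zero>" "s' = z \<otimes> s"
    using pow_M_inj[OF s(1) s0(1) s(3) s0(2)] by auto
  have "k \<otimes> s = (k' \<otimes> z) \<otimes> s" using s(2,4) z K by (simp add: m_assoc)
  then have "k = k' \<otimes> z" using K s0 z m_rcancel[of s k "k' \<otimes> z"] by auto
  then have "dilate k L = dilate k' (dilate z L)" using K z by (subst dilate_dilate) auto
  then show ?thesis using dilate_F_L z by simp
qed

lemma card_dilate: "k \<in> carrier K \<Longrightarrow> k \<noteq> \<zero> \<Longrightarrow> A \<subseteq> carrier K \<Longrightarrow> card (dilate k A) = card A"
  unfolding dilate_def by (intro card_image inj_onI) (auto simp: m_lcancel subset_iff)

text \<open>By \<open>pow_M_inj\<close> and \<open>pow_M_surj\<close> the \<open>M\<close>-th power takes each admissible value on exactly one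
projective point of \<open>L\<close>; here the value is the inverse of \<open>g^M\<close>. This
covers all two-dimensional spaces \<open>g L\<close>, not only those of the spread.\<close>

lemma card_C_dilate_L:
  assumes g: "g \<in> carrier K" "g \<noteq> \<zero>"
  shows "card (C \<inter> dilate g L) = q - 1"
proof -
  obtain k s where ks: "k \<in> C" "s \<in> L" "s \<noteq> \<zero>" "inv g = k \<otimes> s"
    using spread_cover[of "inv g"] g by auto
  have K: "k \<in> carrier K" "k \<noteq> \<zero>" "s \<in> carrier K" using ks by auto
  have es: "g \<otimes> s = inv k"
  proof -
    have "g \<otimes> s \<otimes> k = g \<otimes> inv g" unfolding ks(4) using g K by (simp add: m_ac)
    then have "g \<otimes> s \<otimes> k = inv k \<otimes> k" using g K by simp
    then show ?thesis using g K m_rcancel[of k "g \<otimes> s" "inv k"] by auto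
  qed
  have esC: "g \<otimes> s \<in> C" unfolding es using ks by auto
  have "C \<inter> dilate g L = (\<lambda>z. z \<otimes> (g \<otimes> s)) ` (F - {\<zero>})"
  proof (intro equalityI subsetI)
    fix w assume "w \<in> C \<inter> dilate g L"
    then obtain s' where s': "s' \<in> L" "w = g \<otimes> s'" "w \<in> C" unfolding dilate_def by auto
    have K': "s' \<in> carrier K" "s' \<noteq> \<zero>"
    proof -
      show "s' \<in> carrier K" using s'(1) by (rule L_closed(1))
      show "s' \<noteq> \<zero>"
      proof
        assume "s' = \<zero>"
        then have "w = \<zero>" using s'(2) g by simp
        then show False using C_closed(2)[OF s'(3)] by blast
      qed
    qed
    have "(g \<otimes> s') [^] M = \<one>" using s'(2,3) unfolding C_def by blast
    then have "g [^] M \<otimes> s' [^] M = \<one>" unfolding nat_pow_distrib[OF g(1) K'(1)] .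
    moreover have "(g \<otimes> s) [^] M = \<one>" using esC unfolding C_def by blast
    then have "g [^] M \<otimes> s [^] M = \<one>" unfolding nat_pow_distrib[OF g(1) K(3)] .
    ultimately have "s [^] M = s' [^] M"
      using m_lcancel[of "g [^] M" "s [^] M" "s' [^] M"] g K K' by auto
    then obtain z where z: "z \<in> F - {\<zero>}" "s' = z \<otimes> s"
      using pow_M_inj[OF ks(2,3) s'(1) K'(2)] by auto
    then have "w = z \<otimes> (g \<otimes> s)" using s'(2) g K by (auto simp: m_ac)
    then show "w \<in> (\<lambda>z. z \<otimes> (g \<otimes> s)) ` (F - {\<zero>})" using z by blast
  next
    fix w assume "w \<in> (\<lambda>z. z \<otimes> (g \<otimes> s)) ` (F - {\<zero>})"
    then obtain z where z: "z \<in> F" "z \<noteq> \<zero>" "w = z \<otimes> (g \<otimes> s)" by auto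
    have "w = g \<otimes> (z \<otimes> s)" using z g K F_closed(1)[OF z(1)] by (simp add: m_ac)
    moreover have "z \<otimes> s \<in> L" using z ks by auto
    moreover have "w \<in> C" using z esC F_sub_C by auto
    ultimately show "w \<in> C \<inter> dilate g L" unfolding dilate_def by auto
  qed
  then show ?thesis using card_scalar_orbit[of "g \<otimes> s"] esC by auto
qed

end

section \<open>Counting in additive subgroups\<close>

context kummer_generator
begin

text \<open>Multiplication by \<open>b\<close> splits \<open>A\<close> into orbits whose length is the order of \<open>b\<close>.\<close>

lemma no_b_invariant_set:
  assumes A: "A \<subseteq> carrier K - {\<zero>}" "dilate b A = A" "\<not> n * (q ^ 2 - 1) dvd card A"
  shows False
proof -
  let ?N = "n * (q ^ 2 - 1)"
  have finA: "finite A" using A(1) by (intro finite_subset_carrier) auto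
  have binv: "b [^] (k::nat) \<otimes> x \<in> A" if "x \<in> A" for x k
  proof (induction k)
    case 0
    then show ?case using that A(1) by auto
  next
    case (Suc k)
    have xK: "x \<in> carrier K" using that A(1) by auto
    have "b [^] Suc k \<otimes> x = b \<otimes> (b [^] k \<otimes> x)" using b xK by (simp add: m_ac)
    then have "b [^] Suc k \<otimes> x \<in> dilate b A" using Suc unfolding dilate_def by simp
    then show ?case using A(2) by simp
  qed
  define orb where "orb x = (\<lambda>k::nat. b [^] k \<otimes> x) ` {..<?N}" for x
  have N0: "0 < ?N" using n1 q2 q_sq by simp
  have orbk: "b [^] (k::nat) \<otimes> x \<in> orb x" if "x \<in> A" for x k
  proof -
    have "b [^] k = b [^] (?N * (k div ?N) + k mod ?N)" by simp
    also have "\<dots> = b [^] (?N * (k div ?N)) \<otimes> b [^] (k mod ?N)" using b by (simp only: nat_pow_mult)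
    also have "b [^] (?N * (k div ?N)) = \<one>" unfolding ord_b by simp
    finally have "b [^] k = b [^] (k mod ?N)" using b by simp
    then show ?thesis unfolding orb_def using N0 by (intro image_eqI[of _ _ "k mod ?N"]) auto
  qed
  have card_orb: "card (orb x) = ?N" if "x \<in> A" for x
  proof -
    have "inj_on (\<lambda>k::nat. b [^] k) {..<?N}"
      using b ord_b by (intro inj_on_pow_lessThan) (auto simp: field_Units)
    moreover have "x \<in> carrier K" "x \<noteq> \<zero>" using that A(1) by auto
    then have "b [^] i = b [^] j" if "b [^] i \<otimes> x = b [^] j \<otimes> x" for i j :: nat
      using that m_rcancel[of x "b [^] i" "b [^] j"] b by simp
    ultimately have "inj_on (\<lambda>k::nat. b [^] k \<otimes> x) {..<?N}"
      unfolding inj_on_def by blast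
    then show ?thesis unfolding orb_def by (simp add: card_image)
  qed
  have self: "x \<in> orb x" if "x \<in> A" for x using orbk[OF that, of 0] that A(1) by auto
  have sub: "orb y \<subseteq> orb x" if x: "x \<in> A" and y: "y \<in> orb x" for x y
  proof
    fix w assume "w \<in> orb y"
    then obtain i j :: nat where "y = b [^] i \<otimes> x" "w = b [^] j \<otimes> y" using y unfolding orb_def by auto
    then have "w = b [^] (j + i) \<otimes> x" using x A(1) b nat_pow_mult[OF b(1), of j i] m_assoc[of "b [^] j" "b [^] i" x] by auto
    then show "w \<in> orb x" using orbk[OF x] by simp
  qed
  have orbA: "orb x \<subseteq> A" if "x \<in> A" for x using binv[OF that] unfolding orb_def by auto
  have eq: "orb y = orb x" if "x \<in> A" "y \<in> orb x" for x y
  proof (rule card_subset_eq)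
    show "finite (orb x)" unfolding orb_def by simp
    show "orb y \<subseteq> orb x" using sub that by blast
    show "card (orb y) = card (orb x)" using card_orb[OF that(1)] card_orb[of y] orbA[OF that(1)] that(2) by auto
  qed
  have U: "\<Union>(orb ` A) = A" using self orbA by blast
  have "?N * card (orb ` A) = card (\<Union>(orb ` A))"
  proof (rule card_partition)
    show "finite (orb ` A)" "finite (\<Union>(orb ` A))" using finA U by auto
    show "card c = ?N" if "c \<in> orb ` A" for c using card_orb that by auto
    show "c1 \<inter> c2 = {}" if "c1 \<in> orb ` A" "c2 \<in> orb ` A" "c1 \<noteq> c2" for c1 c2
      using that eq by blast
  qed
  then show False using A(3) unfolding U by (metis dvd_triv_left)
qed

definition F_module :: "'a set \<Rightarrow> bool" where
  "F_module A \<longleftrightarrow> A \<subseteq> carrier K \<and> \<zero> \<in> A \<and> (\<forall>x\<in>A. \<forall>y\<in>A. x \<oplus> y \<in> A) \<and> (\<forall>z\<in>F. \<forall>x\<in>A. z \<otimes> x \<in> A)"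

lemma F_moduleD:
  assumes "F_module A"
  shows "A \<subseteq> carrier K" "\<zero> \<in> A" "\<And>x y. x \<in> A \<Longrightarrow> y \<in> A \<Longrightarrow> x \<oplus> y \<in> A"
    "\<And>z x. z \<in> F \<Longrightarrow> x \<in> A \<Longrightarrow> z \<otimes> x \<in> A"
  using assms unfolding F_module_def by auto

lemma F_module_minus:
  assumes A: "F_module A" and x: "x \<in> A" and y: "y \<in> A"
  shows "x \<ominus> y \<in> A"
proof -
  have c: "x \<in> carrier K" "y \<in> carrier K" using x y F_moduleD(1)[OF A] by auto
  have "x \<ominus> y = x \<oplus> \<ominus> \<one> \<otimes> y" using c by algebra
  then show ?thesis using F_moduleD(3)[OF A x F_moduleD(4)[OF A _ y, of "\<ominus> \<one>"]] by simp
qed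

lemma F_module_Int: "F_module A \<Longrightarrow> F_module B \<Longrightarrow> F_module (A \<inter> B)"
  unfolding F_module_def by blast

lemma F_module_L: "F_module L"
  unfolding F_module_def by auto

lemma F_module_dilate:
  assumes A: "F_module A" and g: "g \<in> carrier K"
  shows "F_module (dilate g A)"
  unfolding F_module_def
proof (intro conjI ballI)
  note D = F_moduleD[OF A]
  show "dilate g A \<subseteq> carrier K" using D(1) g unfolding dilate_def by auto
  show "\<zero> \<in> dilate g A" using D(2) g unfolding dilate_def by (intro image_eqI[of _ _ \<zero>]) auto
  fix x assume "x \<in> dilate g A"
  then obtain s where s: "s \<in> A" "x = g \<otimes> s" unfolding dilate_def by auto
  have sK: "s \<in> carrier K" using s D(1) by auto
  show "x \<oplus> y \<in> dilate g A" if y: "y \<in> dilate g A" for y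
  proof -
    obtain t where t: "t \<in> A" "y = g \<otimes> t" using y unfolding dilate_def by auto
    have "x \<oplus> y = g \<otimes> (s \<oplus> t)" unfolding s t using g sK t D(1) by (auto simp: r_distr)
    then show ?thesis using D(3)[OF s(1) t(1)] unfolding dilate_def by blast
  qed
  show "z \<otimes> x \<in> dilate g A" if z: "z \<in> F" for z
  proof -
    have "z \<otimes> x = g \<otimes> (z \<otimes> s)" unfolding s using g sK F_closed(1)[OF z] by (simp add: m_ac)
    then show ?thesis using D(4)[OF z s(1)] unfolding dilate_def by blast
  qed
qed

lemma F_module_preimage:
  assumes A: "F_module A" and g: "g \<in> carrier K"
  shows "F_module {x \<in> carrier K. g \<otimes> x \<in> A}"
  unfolding F_module_def
proof (intro conjI ballI)
  note D = F_moduleD[OF A]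
  let ?B = "{x \<in> carrier K. g \<otimes> x \<in> A}"
  show "?B \<subseteq> carrier K" "\<zero> \<in> ?B" using g D(2) by auto
  fix x assume x: "x \<in> ?B"
  show "x \<oplus> y \<in> ?B" if "y \<in> ?B" for y using that x g D(3) by (simp add: r_distr)
  show "z \<otimes> x \<in> ?B" if z: "z \<in> F" for z
  proof -
    have "g \<otimes> (z \<otimes> x) = z \<otimes> (g \<otimes> x)" using x g F_closed(1)[OF z] by (simp add: m_ac)
    then show ?thesis using x D(4)[OF z] F_closed(1)[OF z] by simp
  qed
qed

text \<open>For \<open>w\<close> in \<open>W\<close> but not in \<open>U\<close>, the \<open>q\<close> translates \<open>z w + U\<close> with \<open>z \<in> F\<close> are disjoint.\<close>

lemma F_module_extend:
  assumes mU: "F_module U" and mW: "F_module W" and U: "U \<subseteq> W" "U \<noteq> W"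
  shows "q * card U \<le> card W"
proof -
  note W = F_moduleD(1)[OF mW] and sub = F_moduleD(3,4)[OF mU] and subW = F_moduleD(3,4)[OF mW]
  obtain w where w: "w \<in> W" "w \<notin> U" using U by blast
  have wK: "w \<in> carrier K" using w W by auto
  have UK: "U \<subseteq> carrier K" using U W by auto
  have inj: "inj_on (\<lambda>(z, u). z \<otimes> w \<oplus> u) (F \<times> U)"
  proof (rule inj_onI, clarify)
    fix z u z' u' assume h: "z \<in> F" "u \<in> U" "z' \<in> F" "u' \<in> U" and eq: "z \<otimes> w \<oplus> u = z' \<otimes> w \<oplus> u'"
    have c: "z \<in> carrier K" "z' \<in> carrier K" "u \<in> carrier K" "u' \<in> carrier K" using h UK by auto
    have "(z \<ominus> z') \<otimes> w = (z \<otimes> w \<oplus> u) \<ominus> (z' \<otimes> w \<oplus> u') \<oplus> (u' \<oplus> \<ominus> \<one> \<otimes> u)"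
      using c wK by algebra
    also have "\<dots> = u' \<oplus> \<ominus> \<one> \<otimes> u" unfolding eq using c wK by algebra
    finally have e1: "(z \<ominus> z') \<otimes> w = u' \<oplus> \<ominus> \<one> \<otimes> u" .
    then have in_U: "(z \<ominus> z') \<otimes> w \<in> U" using sub h by auto
    have "z \<ominus> z' = \<zero>"
    proof (rule ccontr)
      assume nz: "z \<ominus> z' \<noteq> \<zero>"
      have "inv (z \<ominus> z') \<otimes> ((z \<ominus> z') \<otimes> w) \<in> U" using nz h by (intro sub(2) in_U F_inv) auto
      then show False using w(2) c wK nz m_assoc[of "inv (z \<ominus> z')" "z \<ominus> z'" w] by simp
    qed
    then have z: "z = z'" using c by simp
    then show "z = z' \<and> u = u'" using eq c wK by simp
  qed
  have img: "(\<lambda>(z, u). z \<otimes> w \<oplus> u) ` (F \<times> U) \<subseteq> W" using w U subW by auto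
  have "q * card U = card ((\<lambda>(z, u). z \<otimes> w \<oplus> u) ` (F \<times> U))"
    using inj by (simp add: card_image card_cartesian_product card_F)
  also have "\<dots> \<le> card W" using img W by (intro card_mono finite_subset_carrier)
  finally show ?thesis .
qed

text \<open>The difference map from \<open>A \<times> A'\<close> to \<open>B\<close> has fibres of size at most \<open>card (A \<inter> A')\<close>. This
is the dimension formula for a sum of subspaces in terms of cardinalities.\<close>

lemma card_add_inter:
  assumes A: "A \<subseteq> B" and A': "A' \<subseteq> B" and mA: "F_module A" and mA': "F_module A'" and mB: "F_module B"
  shows "card A * card A' \<le> card B * card (A \<inter> A')"
proof -
  note B = F_moduleD(1)[OF mB]
  and sA = F_module_minus[OF mA] and sA' = F_module_minus[OF mA'] and sB = F_module_minus[OF mB]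
  have fins: "finite A" "finite A'" "finite B" using A A' B by (auto intro!: finite_subset_carrier)
  let ?f = "\<lambda>(x, y). x \<ominus> y"
  have img: "?f ` (A \<times> A') \<subseteq> B" using A A' sB by auto
  have fib: "card {t \<in> A \<times> A'. ?f t = r} \<le> card (A \<inter> A')" if rI: "r \<in> ?f ` (A \<times> A')" for r
  proof -
    obtain x y where xy: "x \<in> A" "y \<in> A'" "r = x \<ominus> y" using rI by auto
    have c: "x \<in> carrier K" "y \<in> carrier K" using xy A A' B by auto
    have "inj_on (\<lambda>t. fst t \<ominus> x) {t \<in> A \<times> A'. ?f t = r}"
    proof (rule inj_onI)
      fix t t' assume t: "t \<in> {t \<in> A \<times> A'. ?f t = r}" "t' \<in> {t \<in> A \<times> A'. ?f t = r}"
        and eq: "fst t \<ominus> x = fst t' \<ominus> x"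
      obtain u v u' v' where tt: "t = (u, v)" "t' = (u', v')" by (metis surj_pair)
      have h: "u \<in> A" "v \<in> A'" "u' \<in> A" "v' \<in> A'" "r = u \<ominus> v" "u \<ominus> v = u' \<ominus> v'"
        "u \<ominus> x = u' \<ominus> x" using t eq unfolding tt by auto
      have c': "u \<in> carrier K" "v \<in> carrier K" "u' \<in> carrier K" "v' \<in> carrier K" using h A A' B by auto
      have uu: "u = u'" using h(7) c c' by (simp add: a_minus_def)
      have "v = u \<ominus> (u \<ominus> v)" using c' by algebra
      also have "\<dots> = u' \<ominus> (u' \<ominus> v')" using h(6) uu by simp
      also have "\<dots> = v'" using c' by algebra
      finally show "t = t'" using uu tt by simp
    qed
    moreover have "(\<lambda>t. fst t \<ominus> x) ` {t \<in> A \<times> A'. ?f t = r} \<subseteq> A \<inter> A'"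
    proof (rule image_subsetI)
      fix t assume "t \<in> {t \<in> A \<times> A'. ?f t = r}"
      then obtain u v where t: "t = (u, v)" and h: "u \<in> A" "v \<in> A'" "r = u \<ominus> v" by auto
      have c': "u \<in> carrier K" "v \<in> carrier K" using h A A' B by auto
      have "u \<ominus> x = (u \<ominus> v) \<ominus> (x \<ominus> y) \<oplus> (v \<ominus> y)" using c c' by algebra
      also have "\<dots> = v \<ominus> y" using h(3) xy(3) c c' by (simp add: r_right_minus_eq)
      finally have "u \<ominus> x = v \<ominus> y" .
      then show "fst t \<ominus> x \<in> A \<inter> A'" using sA[OF h(1) xy(1)] sA'[OF h(2) xy(2)] t by simp
    qed
    ultimately show ?thesis using fins by (intro card_inj_on_le) auto
  qed
  have "card (A \<times> A') \<le> card (?f ` (A \<times> A')) * card (A \<inter> A')"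
    using fib fins by (intro card_le_fibres) auto
  also have "\<dots> \<le> card B * card (A \<inter> A')"
    by (intro mult_le_mono1 card_mono img fins)
  finally show ?thesis by (simp add: card_cartesian_product)
qed

end

section \<open>No four-dimensional subspace is a union of spread elements\<close>

text \<open>The factor on the right is the number of elements of \<open>C\<close> and \<open>0\<close> in a union of \<open>q^2 + 1\<close> spread
elements, a lower bound for the size of \<open>U\<close>; the inequality makes \<open>V\<close> larger than a one-dimensional
subspace.\<close>

lemma fifth_power_less:
  fixes q :: nat
  assumes "2 \<le> q"
  shows "q ^ 4 * q < ((q ^ 2 + 1) * (q - 1) + 1) * ((q ^ 2 + 1) * (q - 1) + 1)"
proof -
  obtain m where m: "q = m + 2" using assms le_Suc_ex by (metis add.commute)
  have a: "(q ^ 2 + 1) * (q - 1) + 1 = m*m*m + 5*(m*m) + 9*m + 6"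
    unfolding m by (simp add: power2_eq_square algebra_simps)
  have b: "q ^ 2 = m*m + 4*m + 4" unfolding m by (simp add: power2_eq_square algebra_simps)
  have "q ^ 4 = q ^ 2 * q ^ 2" by (simp add: power_add[symmetric])
  then show ?thesis unfolding a b by (simp add: m algebra_simps)
qed

lemma cube_split:
  fixes q :: nat
  assumes "1 \<le> q"
  shows "q ^ 3 = (q ^ 2 - q) + ((q ^ 2 + 1) * (q - 1) + 1)"
proof -
  obtain m where m: "q = m + 1" using assms le_Suc_ex by (metis add.commute)
  show ?thesis unfolding m by (simp add: power2_eq_square power3_eq_cube algebra_simps)
qed

lemma square_less:
  fixes q :: nat
  assumes "2 \<le> q"
  shows "q ^ 2 < q * (q ^ 2 - q + 1)"
proof -
  obtain m where m: "q = m + 2" using assms le_Suc_ex by (metis add.commute)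
  show ?thesis unfolding m by (simp add: power2_eq_square algebra_simps)
qed

context kummer_generator
begin

text \<open>A prime of \<open>n\<close> divides \<open>q + 1\<close>, hence \<open>q^2 - 1\<close>; if it divided \<open>q^2 + 1\<close> too, it would be \<open>2\<close>.\<close>

lemma not_dvd_sq_plus_one: "\<not> n dvd q ^ 2 + 1"
proof
  assume d: "n dvd q ^ 2 + 1"
  obtain r where r: "Factorial_Ring.prime r" "r dvd n" using n1 prime_factor_nat[of n] by auto
  have "r dvd q ^ 2 + 1" using r d dvd_trans by blast
  moreover have "r dvd q ^ 2 - 1" unfolding q_sq by (intro dvd_mult n_primes r)
  ultimately have "r dvd (q ^ 2 + 1) - (q ^ 2 - 1)" by (rule dvd_diff_nat)
  moreover have "1 \<le> q ^ 2" using q2 by (intro one_le_power) simp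
  ultimately have "r dvd 2" by simp
  then have "r = 2" using r(1) by (simp add: primes_dvd_imp_eq)
  then show False using r odd_n by simp
qed

lemma zero_notin_C: "\<zero> \<notin> C"
  unfolding C_def by simp

lemma q_fourth: "q ^ 4 - 1 = (q ^ 2 - 1) * (q ^ 2 + 1)"
proof -
  have "1 \<le> q ^ 2" using q2 by (intro one_le_power) simp
  then obtain m where m: "q ^ 2 = Suc m" using Suc_le_D by auto
  have "q ^ 4 = q ^ 2 * q ^ 2" by (simp add: power_add[symmetric])
  then show ?thesis unfolding m by simp
qed

lemma dilate_L_F_module:
  assumes g: "g \<in> carrier K"
  shows "dilate g L \<subseteq> carrier K" "\<zero> \<in> dilate g L" "g \<in> dilate g L" "g \<otimes> b \<in> dilate g L"
    "\<And>x y. x \<in> dilate g L \<Longrightarrow> y \<in> dilate g L \<Longrightarrow> x \<oplus> y \<in> dilate g L"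
    "\<And>z x. z \<in> F \<Longrightarrow> x \<in> dilate g L \<Longrightarrow> z \<otimes> x \<in> dilate g L"
proof -
  show "g \<in> dilate g L" using g unfolding dilate_def by (intro image_eqI[of _ _ \<one>]) auto
  show "g \<otimes> b \<in> dilate g L" unfolding dilate_def by auto
qed (use F_moduleD[OF F_module_dilate[OF F_module_L g]] in auto)

text \<open>The algebraic core of the non-Desarguesian property: \<open>W\<close> would contain too many elements of \<open>C\<close>
in too small a subspace. Dimensions over \<open>F\<close> appear as cardinalities throughout.\<close>

lemma no_spread_closed_plane:
  assumes W: "W \<subseteq> carrier K" "card W = q ^ 4" "\<zero> \<in> W"
    and add: "\<And>x y. x \<in> W \<Longrightarrow> y \<in> W \<Longrightarrow> x \<oplus> y \<in> W"
    and lines: "\<And>k s. k \<in> C \<Longrightarrow> s \<in> L \<Longrightarrow> s \<noteq> \<zero> \<Longrightarrow> k \<otimes> s \<in> W \<Longrightarrow> dilate k L \<subseteq> W"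
  shows False
proof -
  have finW: "finite W" using W(1) by (rule finite_subset_carrier)
  have smult: "z \<otimes> x \<in> W" if z: "z \<in> F" and x: "x \<in> W" for z x
  proof (cases "x = \<zero>")
    case True
    then show ?thesis using z W(3) by simp
  next
    case False
    obtain k s where ks: "k \<in> C" "s \<in> L" "s \<noteq> \<zero>" "x = k \<otimes> s"
      using spread_cover[of x] False x W(1) by auto
    then have "dilate k L \<subseteq> W" using lines x by blast
    moreover have "x \<in> dilate k L" using ks unfolding dilate_def by blast
    ultimately show ?thesis using dilate_L_F_module(6)[of k z x] z ks by blast
  qed
  have mW: "F_module W" unfolding F_module_def using W add smult by blast
  have Wk: "dilate k L \<subseteq> W" if k: "k \<in> C" "k \<in> W" for k
    using lines[of k \<one>] k by auto

  \<comment> \<open>\<open>W\<close> is the union of \<open>q^2 + 1\<close> spread elements, each with \<open>q - 1\<close> elements of \<open>C\<close>.\<close>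
  have card_CW: "card (C \<inter> W) = (q ^ 2 + 1) * (q - 1)"
  proof -
    define LL where "LL = (\<lambda>k. dilate k L) ` (C \<inter> W)"
    have finLL: "finite LL" unfolding LL_def using finW by simp
    have sub: "l \<subseteq> W" "\<zero> \<in> l" "card l = q ^ 2" "card (C \<inter> l) = q - 1" if l: "l \<in> LL" for l
    proof -
      obtain k where k: "k \<in> C" "k \<in> W" "l = dilate k L" using l unfolding LL_def by auto
      have kK: "k \<in> carrier K" "k \<noteq> \<zero>" using k by auto
      show "l \<subseteq> W" using Wk k by blast
      show "\<zero> \<in> l" unfolding k(3) by (rule dilate_L_F_module(2)[OF kK(1)])
      show "card l = q ^ 2" unfolding k(3) using card_dilate[OF kK, of L] card_L by auto
      show "card (C \<inter> l) = q - 1" unfolding k(3) by (rule card_C_dilate_L[OF kK])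
    qed
    have disj: "(l - {\<zero>}) \<inter> (l' - {\<zero>}) = {}" if l: "l \<in> LL" "l' \<in> LL" "l \<noteq> l'" for l l'
      using l spread_unique unfolding LL_def by blast
    have cover: "W - {\<zero>} = (\<Union>l\<in>LL. l - {\<zero>})"
    proof
      show "(\<Union>l\<in>LL. l - {\<zero>}) \<subseteq> W - {\<zero>}" using sub(1) by blast
      show "W - {\<zero>} \<subseteq> (\<Union>l\<in>LL. l - {\<zero>})"
      proof
        fix x assume x: "x \<in> W - {\<zero>}"
        then obtain k s where ks: "k \<in> C" "s \<in> L" "s \<noteq> \<zero>" "x = k \<otimes> s"
          using spread_cover[of x] W(1) by auto
        have "dilate k L \<subseteq> W" using lines ks x by blast
        then have "k \<in> W" using dilate_L_F_module(3)[of k] ks(1) by auto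
        then have "dilate k L \<in> LL" unfolding LL_def using ks(1) by blast
        moreover have "x \<in> dilate k L" using ks unfolding dilate_def by blast
        ultimately show "x \<in> (\<Union>l\<in>LL. l - {\<zero>})" using x by blast
      qed
    qed
    have "card (W - {\<zero>}) = (\<Sum>l\<in>LL. card (l - {\<zero>}))"
      unfolding cover using finLL sub(1) finW disj
      by (intro card_UN_disjoint) (auto intro: finite_subset)
    also have "\<dots> = (\<Sum>l\<in>LL. q ^ 2 - 1)"
    proof (rule sum.cong[OF refl])
      fix l assume l: "l \<in> LL"
      then have "finite l" using sub(1) finW finite_subset by blast
      then show "card (l - {\<zero>}) = q ^ 2 - 1" using sub(2,3)[OF l] by simp
    qed
    also have "\<dots> = card LL * (q ^ 2 - 1)" by simp
    finally have "(q ^ 2 + 1) * (q ^ 2 - 1) = card LL * (q ^ 2 - 1)"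
      using W(2,3) finW q_fourth by (simp add: mult.commute)
    moreover have "0 < q ^ 2 - 1" unfolding q_sq using q2 by simp
    ultimately have cLL: "card LL = q ^ 2 + 1" by (metis mult_cancel2 not_gr0)
    have C_cover: "C \<inter> W = (\<Union>l\<in>LL. C \<inter> l)"
    proof -
      have "C \<inter> W = C \<inter> (W - {\<zero>})" using C_closed(2) by blast
      also have "\<dots> = (\<Union>l\<in>LL. C \<inter> l)" unfolding cover using C_closed(2) by blast
      finally show ?thesis .
    qed
    have disjC: "(C \<inter> l) \<inter> (C \<inter> l') = {}" if l: "l \<in> LL" "l' \<in> LL" "l \<noteq> l'" for l l'
      using disj[OF l] C_closed(2) by blast
    have "card (C \<inter> W) = (\<Sum>l\<in>LL. card (C \<inter> l))"
      unfolding C_cover using finLL disjC finite_subset[OF sub(1) finW]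
      by (intro card_UN_disjoint) blast+
    also have "\<dots> = (\<Sum>l\<in>LL. q - 1)" using sub(4) by (intro sum.cong) auto
    finally show ?thesis using cLL by simp
  qed

  define W' where "W' = {x \<in> carrier K. b \<otimes> x \<in> W}"
  define U where "U = W \<inter> W'"
  have mW': "F_module W'" unfolding W'_def by (rule F_module_preimage[OF mW b(1)])
  have mU: "F_module U" unfolding U_def by (rule F_module_Int[OF mW mW'])
  have UK: "U \<subseteq> carrier K" "U \<subseteq> W" using W unfolding U_def by auto
  have U0: "\<zero> \<in> U" by (rule F_moduleD(2)[OF mU])
  \<comment> \<open>With \<open>k\<close> also \<open>b k\<close> lies in the spread element \<open>k L\<close>.\<close>
  have CU: "C \<inter> W \<subseteq> U"
  proof
    fix k assume k: "k \<in> C \<inter> W"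
    then have kK: "k \<in> carrier K" by auto
    have "b \<otimes> k \<in> dilate k L" using dilate_L_F_module(4)[OF kK] m_comm[OF kK b(1)] by simp
    then show "k \<in> U" unfolding U_def W'_def using k kK Wk by blast
  qed
  have finU: "finite U" using UK(1) by (rule finite_subset_carrier)
  \<comment> \<open>Otherwise \<open>b\<close> would permute the \<open>q^4 - 1\<close> nonzero elements of \<open>W\<close>.\<close>
  have U_neq: "U \<noteq> W"
  proof
    assume eq: "U = W"
    have "dilate b (W - {\<zero>}) \<subseteq> W - {\<zero>}"
      using eq b W(1) integral[OF _ b(1)] unfolding dilate_def U_def W'_def by (auto simp: integral_iff)
    moreover have "card (dilate b (W - {\<zero>})) = card (W - {\<zero>})"
      using W(1) b by (intro card_dilate) auto
    ultimately have "dilate b (W - {\<zero>}) = W - {\<zero>}"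
      using finW by (intro card_subset_eq) auto
    moreover have "\<not> n * (q ^ 2 - 1) dvd card (W - {\<zero>})"
    proof
      assume "n * (q ^ 2 - 1) dvd card (W - {\<zero>})"
      then have "n * (q ^ 2 - 1) dvd (q ^ 2 + 1) * (q ^ 2 - 1)"
        using W(2,3) finW q_fourth by (simp add: mult.commute)
      moreover have "0 < q ^ 2 - 1" unfolding q_sq using q2 by simp
      ultimately have "n dvd q ^ 2 + 1" by (metis dvd_times_right_cancel_iff not_gr0)
      then show False using not_dvd_sq_plus_one by blast
    qed
    ultimately show False using no_b_invariant_set[of "W - {\<zero>}"] W(1) by blast
  qed
  have "q * card U \<le> card W" by (rule F_module_extend[OF mU mW UK(2) U_neq])
  then have "q * card U \<le> q * q ^ 3" unfolding W(2) by (simp add: power_Suc[symmetric] del: power_Suc)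
  then have cU: "card U \<le> q ^ 3" using q2 by simp
  have "card (insert \<zero> (C \<inter> W)) \<le> card U" using CU U0 finU by (intro card_mono) auto
  moreover have "\<zero> \<notin> C \<inter> W" using C_closed(2) by blast
  ultimately have cU2: "(q ^ 2 + 1) * (q - 1) + 1 \<le> card U" using card_CW finW by simp

  define U' where "U' = {x \<in> carrier K. b \<otimes> x \<in> U}"
  \<comment> \<open>The elements \<open>g\<close> with \<open>g L \<subseteq> U\<close>.\<close>
  define V where "V = U \<inter> U'"
  have mU': "F_module U'" unfolding U'_def by (rule F_module_preimage[OF mU b(1)])
  have mV: "F_module V" unfolding V_def by (rule F_module_Int[OF mU mU'])
  have VU: "V \<subseteq> U" unfolding V_def by auto
  have V0: "\<zero> \<in> V" by (rule F_moduleD(2)[OF mV])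
  have preimage: "card {x \<in> carrier K. b \<otimes> x \<in> A} = card A" if A: "A \<subseteq> carrier K" for A
  proof -
    have "dilate b {x \<in> carrier K. b \<otimes> x \<in> A} = A"
    proof (intro equalityI subsetI)
      fix a assume a: "a \<in> A"
      then have aK: "a \<in> carrier K" using A by auto
      have "b \<otimes> (inv b \<otimes> a) = a" using aK b m_assoc[of b "inv b" a] by simp
      then show "a \<in> dilate b {x \<in> carrier K. b \<otimes> x \<in> A}"
        unfolding dilate_def using a aK b by (intro image_eqI[of _ _ "inv b \<otimes> a"]) auto
    qed (auto simp: dilate_def)
    then show ?thesis using card_dilate[OF b, of "{x \<in> carrier K. b \<otimes> x \<in> A}"] by simp
  qed
  \<comment> \<open>\<open>U\<close> and \<open>U'\<close> both lie in \<open>W'\<close>, which is no larger than \<open>W\<close>, so their intersection \<open>V\<close> is large.\<close>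
  have "card U * card U' \<le> card W' * card V"
    unfolding V_def
    by (rule card_add_inter[OF _ _ mU mU' mW']) (auto simp: U_def U'_def W'_def)
  then have cV: "card U * card U \<le> q ^ 4 * card V"
    using preimage[OF UK(1)] preimage[OF W(1)] W(2) unfolding U'_def W'_def by simp
  have cV2: "q < card V"
  proof (rule ccontr)
    assume "\<not> q < card V"
    then have "q ^ 4 * card V \<le> q ^ 4 * q" by simp
    then have "((q ^ 2 + 1) * (q - 1) + 1) * ((q ^ 2 + 1) * (q - 1) + 1) \<le> q ^ 4 * q"
      using cV mult_le_mono[OF cU2 cU2] by linarith
    then show False using fifth_power_less[OF q2] by linarith
  qed

  have L_in_U: "dilate g L \<subseteq> U" if g: "g \<in> V" for g
  proof
    fix w assume "w \<in> dilate g L"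
    then obtain s where s: "s \<in> L" "w = g \<otimes> s" unfolding dilate_def by auto
    obtain x y where xy: "x \<in> F" "y \<in> F" "s = x \<oplus> y \<otimes> b" using s(1) by (rule L_E)
    have c: "g \<in> carrier K" "x \<in> carrier K" "y \<in> carrier K" using g VU UK xy by auto
    have "w = x \<otimes> g \<oplus> y \<otimes> (b \<otimes> g)" unfolding s(2) xy(3) using c b by algebra
    moreover have "g \<in> U" "b \<otimes> g \<in> U" using g unfolding V_def U'_def by auto
    ultimately show "w \<in> U" using F_moduleD(3,4)[OF mU] xy by simp
  qed
  \<comment> \<open>The set \<open>g L\<close> has as many nonzero elements outside \<open>C\<close> as \<open>U\<close> can have at all.\<close>
  define D where "D = U - C - {\<zero>}"
  have card_D: "card D \<le> q ^ 2 - q"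
  proof -
    have "D = U - insert \<zero> (C \<inter> W)" unfolding D_def using UK by auto
    then have "card D = card U - card (insert \<zero> (C \<inter> W))"
      using CU U0 finW by (simp add: card_Diff_subset)
    also have "card (insert \<zero> (C \<inter> W)) = (q ^ 2 + 1) * (q - 1) + 1"
      using card_CW finW zero_notin_C by (subst card_insert_disjoint) auto
    finally have "card D = card U - ((q ^ 2 + 1) * (q - 1) + 1)" .
    moreover have "q ^ 3 = (q ^ 2 - q) + ((q ^ 2 + 1) * (q - 1) + 1)"
      using q2 by (intro cube_split) simp
    ultimately show ?thesis using cU by linarith
  qed
  have D_eq: "dilate g L - C - {\<zero>} = D" "card D = q ^ 2 - q" if g: "g \<in> V" "g \<noteq> \<zero>" for g
  proof -
    have gK: "g \<in> carrier K" using g VU UK by auto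
    have finL: "finite (dilate g L)" unfolding dilate_def by simp
    have "dilate g L - C - {\<zero>} = dilate g L - insert \<zero> (C \<inter> dilate g L)" by auto
    then have "card (dilate g L - C - {\<zero>}) = card (dilate g L) - card (insert \<zero> (C \<inter> dilate g L))"
      using finL dilate_L_F_module(2)[OF gK] by (simp add: card_Diff_subset)
    also have "card (dilate g L) = q ^ 2" using card_dilate[OF gK g(2), of L] card_L by auto
    also have "card (insert \<zero> (C \<inter> dilate g L)) = q"
      using card_C_dilate_L[OF gK g(2)] finL zero_notin_C q2 by (subst card_insert_disjoint) auto
    finally have cd: "card (dilate g L - C - {\<zero>}) = q ^ 2 - q" .
    have sub: "dilate g L - C - {\<zero>} \<subseteq> D" using L_in_U[OF g(1)] unfolding D_def by auto
    show "dilate g L - C - {\<zero>} = D"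
      using sub finU card_D cd by (intro card_seteq) (auto simp: D_def)
    then show "card D = q ^ 2 - q" using cd by simp
  qed
  \<comment> \<open>Two different sets \<open>g L\<close> meet in at most \<open>q\<close> elements, fewer than \<open>D\<close> has together with \<open>0\<close>.\<close>
  have same_line: "dilate g L = dilate g' L" if g: "g \<in> V" "g \<noteq> \<zero>" "g' \<in> V" "g' \<noteq> \<zero>" for g g'
  proof -
    have gK: "g \<in> carrier K" "g' \<in> carrier K" using g VU UK by auto
    have fins: "finite (dilate g L)" "finite (dilate g' L)" unfolding dilate_def by auto
    have cs: "card (dilate g L) = q ^ 2" "card (dilate g' L) = q ^ 2"
      using card_dilate[OF gK(1) g(2), of L] card_dilate[OF gK(2) g(4), of L] card_L by auto
    let ?I = "dilate g L \<inter> dilate g' L"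
    have "?I = dilate g L"
    proof (rule ccontr)
      assume ne: "?I \<noteq> dilate g L"
      have "q * card ?I \<le> card (dilate g L)"
        using F_module_dilate[OF F_module_L] gK by (intro F_module_extend[OF F_module_Int _ _ ne]) auto
      moreover have "insert \<zero> D \<subseteq> ?I"
        using D_eq(1)[OF g(1,2)] D_eq(1)[OF g(3,4)] dilate_L_F_module(2)[OF gK(1)] dilate_L_F_module(2)[OF gK(2)] by blast
      then have "card (insert \<zero> D) \<le> card ?I" using fins by (intro card_mono) auto
      moreover have "card (insert \<zero> D) = q ^ 2 - q + 1"
        using D_eq(2)[OF g(1,2)] finU by (subst card_insert_disjoint) (auto simp: D_def)
      ultimately have "q * (q ^ 2 - q + 1) \<le> q ^ 2"
        using cs(1) by (metis le_trans mult_le_mono2)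
      then show False using square_less[OF q2] by linarith
    qed
    then show ?thesis using fins cs by (intro card_subset_eq) auto
  qed
  have "1 < card V" using cV2 q2 by simp
  then obtain g where g: "g \<in> V" "g \<noteq> \<zero>"
  proof -
    have "\<not> V \<subseteq> {\<zero>}"
      using \<open>1 < card V\<close> card_mono[of "{\<zero>}" V] by auto
    then show ?thesis using that by blast
  qed
  have gK: "g \<in> carrier K" using g VU UK by auto
  have cg: "card (dilate g L) = q ^ 2" using card_dilate[OF gK g(2), of L] card_L by auto
  have V_sub: "V \<subseteq> dilate g L"
  proof
    fix x assume x: "x \<in> V"
    have xK: "x \<in> carrier K" using x VU UK by auto
    show "x \<in> dilate g L"
    proof (cases "x = \<zero>")
      case True
      then show ?thesis using dilate_L_F_module(2)[OF gK] by simp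
    next
      case False
      then show ?thesis using same_line[OF g x] dilate_L_F_module(3)[OF xK] by simp
    qed
  qed
  have V_eq: "V = dilate g L"
  proof (rule ccontr)
    assume ne: "V \<noteq> dilate g L"
    have "q * card V \<le> card (dilate g L)"
      by (rule F_module_extend[OF mV F_module_dilate[OF F_module_L gK] V_sub ne])
    then have "card V \<le> q" using cg q2 by (simp add: power2_eq_square)
    then show False using cV2 by simp
  qed
  let ?A = "V - {\<zero>}"
  have finV: "finite V" unfolding V_eq dilate_def by simp
  have AK: "?A \<subseteq> carrier K - {\<zero>}" using VU UK by auto
  have "dilate b ?A \<subseteq> ?A"
  proof
    fix w assume "w \<in> dilate b ?A"
    then obtain x where x: "x \<in> V" "x \<noteq> \<zero>" "w = b \<otimes> x" unfolding dilate_def by auto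
    have xK: "x \<in> carrier K" using x VU UK by auto
    have "w \<in> dilate x L" using dilate_L_F_module(4)[OF xK] m_comm[OF xK b(1)] x(3) by simp
    then have "w \<in> V" using same_line[OF g x(1,2)] V_eq by simp
    moreover have "w \<noteq> \<zero>" using x xK b integral[of b x] by auto
    ultimately show "w \<in> ?A" by simp
  qed
  moreover have "card (dilate b ?A) = card ?A" using AK b by (intro card_dilate) auto
  ultimately have "dilate b ?A = ?A" using finV by (intro card_subset_eq) auto
  moreover have "\<not> n * (q ^ 2 - 1) dvd card ?A"
  proof
    assume "n * (q ^ 2 - 1) dvd card ?A"
    moreover have cA: "card ?A = q ^ 2 - 1" using V0 finV cg V_eq by simp
    moreover have p0: "0 < q ^ 2 - 1" unfolding q_sq using q2 by simp
    ultimately have "n * (q ^ 2 - 1) \<le> 1 * (q ^ 2 - 1)" using dvd_imp_le by simp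
    then show False using n1 p0 by simp
  qed
  ultimately show False using no_b_invariant_set[OF AK] by blast
qed

end

section \<open>Planes in linear spaces and in affine spaces\<close>

text \<open>Defined by incidence alone, subspaces and the planes they generate are carried along by every
isomorphism, so the number of points of a plane can tell two linear spaces apart.\<close>

definition closed_set :: "('p, 'l) incidence_structure \<Rightarrow> 'p set \<Rightarrow> bool" where
  "closed_set S A \<longleftrightarrow> A \<subseteq> points S \<and>
     (\<forall>l\<in>lines S. \<forall>x\<in>A. \<forall>y\<in>A. x \<noteq> y \<longrightarrow> inc S x l \<longrightarrow> inc S y l \<longrightarrow> points_on S l \<subseteq> A)"

definition plane_span :: "('p, 'l) incidence_structure \<Rightarrow> 'p set \<Rightarrow> 'p set" where
  "plane_span S A = \<Inter>{B. closed_set S B \<and> A \<subseteq> B}"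

definition planes_have_card :: "('p, 'l) incidence_structure \<Rightarrow> nat \<Rightarrow> bool" where
  "planes_have_card S m \<longleftrightarrow> (\<forall>l\<in>lines S. \<forall>x\<in>points S. \<not> inc S x l \<longrightarrow>
     card (plane_span S (insert x (points_on S l))) = m)"

lemma closed_set_points: "closed_set S (points S)"
  by (auto simp: closed_set_def points_on_def)

lemma plane_span_superset: "A \<subseteq> plane_span S A"
  unfolding plane_span_def by blast

lemma plane_span_least: "closed_set S B \<Longrightarrow> A \<subseteq> B \<Longrightarrow> plane_span S A \<subseteq> B"
  unfolding plane_span_def by blast

lemma closed_set_line:
  "closed_set S A \<Longrightarrow> l \<in> lines S \<Longrightarrow> x \<in> A \<Longrightarrow> y \<in> A \<Longrightarrow> x \<noteq> y \<Longrightarrow> inc S x l \<Longrightarrow> inc S y l \<Longrightarrow>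
     points_on S l \<subseteq> A"
  unfolding closed_set_def by blast

lemma plane_span_closed:
  assumes "A \<subseteq> points S"
  shows "closed_set S (plane_span S A)"
  unfolding closed_set_def
proof (intro conjI ballI impI)
  show "plane_span S A \<subseteq> points S" by (rule plane_span_least[OF closed_set_points assms])
  fix l x y assume h: "l \<in> lines S" "x \<in> plane_span S A" "y \<in> plane_span S A" "x \<noteq> y"
    "inc S x l" "inc S y l"
  have "points_on S l \<subseteq> B" if B: "closed_set S B" "A \<subseteq> B" for B
  proof -
    have "x \<in> B" "y \<in> B" using plane_span_least[OF B] h(2,3) by auto
    then show ?thesis using closed_set_line[OF B(1) h(1) _ _ h(4,5,6)] by blast
  qed
  then show "points_on S l \<subseteq> plane_span S A" unfolding plane_span_def by blast
qed

lemma points_on_iso: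
  assumes f: "bij_betw f (points S) (points T)"
    and fg: "\<And>x l. x \<in> points S \<Longrightarrow> l \<in> lines S \<Longrightarrow> inc T (f x) (g l) \<longleftrightarrow> inc S x l"
    and l: "l \<in> lines S"
  shows "points_on T (g l) = f ` points_on S l"
proof
  show "points_on T (g l) \<subseteq> f ` points_on S l"
  proof
    fix y assume y: "y \<in> points_on T (g l)"
    then obtain x where "x \<in> points S" "y = f x" using f by (auto simp: bij_betw_def points_on_def)
    then show "y \<in> f ` points_on S l" using y fg l by (auto simp: points_on_def)
  qed
  show "f ` points_on S l \<subseteq> points_on T (g l)" using f fg l by (auto simp: points_on_def bij_betw_def)
qed

lemma closed_set_iso:
  assumes f: "bij_betw f (points S) (points T)" and g: "bij_betw g (lines S) (lines T)"
    and fg: "\<And>x l. x \<in> points S \<Longrightarrow> l \<in> lines S \<Longrightarrow> inc T (f x) (g l) \<longleftrightarrow> inc S x l"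
    and A: "A \<subseteq> points S"
  shows "closed_set T (f ` A) \<longleftrightarrow> closed_set S A"
proof -
  have inj: "inj_on f (points S)" using f by (simp add: bij_betw_def)
  have fp: "f x \<in> points T" if "x \<in> points S" for x using f that by (auto simp: bij_betw_def)
  have fA: "f ` A \<subseteq> points T" using fp A by auto
  have pts: "points_on T (g l) = f ` points_on S l" if "l \<in> lines S" for l
    by (rule points_on_iso[OF f fg that])
  have sub: "f ` B \<subseteq> f ` A \<longleftrightarrow> B \<subseteq> A" if "B \<subseteq> points S" for B
    unfolding image_subset_iff using inj_on_image_mem_iff[OF inj _ A] that by blast
  have on_sub: "points_on S l \<subseteq> points S" for l by (auto simp: points_on_def)
  have "closed_set T (f ` A) \<longleftrightarrow> f ` A \<subseteq> points T \<and>
      (\<forall>l\<in>g ` lines S. \<forall>x\<in>A. \<forall>y\<in>A. f x \<noteq> f y \<longrightarrow> inc T (f x) l \<longrightarrow> inc T (f y) l \<longrightarrow> points_on T l \<subseteq> f ` A)"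
    using g unfolding closed_set_def bij_betw_def by simp
  also have "\<dots> \<longleftrightarrow> (\<forall>l\<in>lines S. \<forall>x\<in>A. \<forall>y\<in>A. f x \<noteq> f y \<longrightarrow> inc T (f x) (g l) \<longrightarrow> inc T (f y) (g l) \<longrightarrow> points_on T (g l) \<subseteq> f ` A)"
    using fA by (simp only: ball_simps simp_thms)
  also have "\<dots> \<longleftrightarrow> (\<forall>l\<in>lines S. \<forall>x\<in>A. \<forall>y\<in>A. x \<noteq> y \<longrightarrow> inc S x l \<longrightarrow> inc S y l \<longrightarrow> points_on S l \<subseteq> A)"
  proof (intro ball_cong refl)
    fix l x y assume h: "l \<in> lines S" "x \<in> A" "y \<in> A"
    then have p: "x \<in> points S" "y \<in> points S" using A by auto
    show "(f x \<noteq> f y \<longrightarrow> inc T (f x) (g l) \<longrightarrow> inc T (f y) (g l) \<longrightarrow> points_on T (g l) \<subseteq> f ` A) \<longleftrightarrow>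
          (x \<noteq> y \<longrightarrow> inc S x l \<longrightarrow> inc S y l \<longrightarrow> points_on S l \<subseteq> A)"
      unfolding pts[OF h(1)] sub[OF on_sub] fg[OF p(1) h(1)] fg[OF p(2) h(1)]
      using inj_on_eq_iff[OF inj p] by simp
  qed
  finally show ?thesis using A unfolding closed_set_def by simp
qed

lemma plane_span_iso:
  assumes f: "bij_betw f (points S) (points T)" and g: "bij_betw g (lines S) (lines T)"
    and fg: "\<And>x l. x \<in> points S \<Longrightarrow> l \<in> lines S \<Longrightarrow> inc T (f x) (g l) \<longleftrightarrow> inc S x l"
    and A: "A \<subseteq> points S"
  shows "plane_span T (f ` A) = f ` plane_span S A"
proof
  have sp: "plane_span S A \<subseteq> points S" using plane_span_closed[OF A] by (simp add: closed_set_def)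
  show "plane_span T (f ` A) \<subseteq> f ` plane_span S A"
    using closed_set_iso[OF f g fg sp] plane_span_closed[OF A] plane_span_superset[of A S]
    by (intro plane_span_least) auto
  let ?B = "{x \<in> points S. f x \<in> plane_span T (f ` A)}"
  have fA: "f ` A \<subseteq> points T" using f A by (auto simp: bij_betw_def)
  have cT: "closed_set T (plane_span T (f ` A))" by (rule plane_span_closed[OF fA])
  then have "plane_span T (f ` A) \<subseteq> f ` points S" using f by (simp add: closed_set_def bij_betw_def)
  then have "f ` ?B = plane_span T (f ` A)" by auto
  then have "closed_set S ?B" using closed_set_iso[OF f g fg, of ?B] cT by auto
  moreover have "A \<subseteq> ?B" using A plane_span_superset[of "f ` A" T] by auto
  ultimately have "plane_span S A \<subseteq> ?B" by (rule plane_span_least)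
  then show "f ` plane_span S A \<subseteq> plane_span T (f ` A)" by auto
qed

lemma planes_have_card_iso:
  assumes iso: "isomorphic_spaces S T" and T: "planes_have_card T m"
  shows "planes_have_card S m"
proof -
  obtain f g where f: "bij_betw f (points S) (points T)" and g: "bij_betw g (lines S) (lines T)"
    and fg: "\<And>x l. x \<in> points S \<Longrightarrow> l \<in> lines S \<Longrightarrow> inc T (f x) (g l) \<longleftrightarrow> inc S x l"
    using iso unfolding isomorphic_spaces_def by blast
  show ?thesis
    unfolding planes_have_card_def
  proof (intro ballI impI)
    fix l x assume h: "l \<in> lines S" "x \<in> points S" "\<not> inc S x l"
    let ?A = "insert x (points_on S l)"
    have A: "?A \<subseteq> points S" using h by (auto simp: points_on_def)
    have "f ` points_on S l = points_on T (g l)" by (rule points_on_iso[OF f fg h(1), symmetric])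
    then have fA: "f ` ?A = insert (f x) (points_on T (g l))" by simp
    have "plane_span T (insert (f x) (points_on T (g l))) = f ` plane_span S ?A"
      using plane_span_iso[OF f g fg A] unfolding fA by simp
    moreover have "g l \<in> lines T" "f x \<in> points T" "\<not> inc T (f x) (g l)"
      using f g h fg[OF h(2,1)] by (auto simp: bij_betw_def)
    ultimately have "card (f ` plane_span S ?A) = m"
      using T unfolding planes_have_card_def by metis
    moreover have "plane_span S ?A \<subseteq> points S" using plane_span_closed[OF A] by (simp add: closed_set_def)
    then have "inj_on f (plane_span S ?A)" using f by (auto simp: bij_betw_def intro: inj_on_subset)
    ultimately show "card (plane_span S ?A) = m" by (simp add: card_image)
  qed
qed

context field
begin

definition affine_point :: "nat \<Rightarrow> (nat \<Rightarrow> 'a) \<Rightarrow> 'a \<Rightarrow> (nat \<Rightarrow> 'a) \<Rightarrow> 'a \<Rightarrow> (nat \<Rightarrow> 'a) \<Rightarrow> nat \<Rightarrow> 'a" where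
  "affine_point n v \<alpha> d \<beta> w = (\<lambda>i\<in>{..<n}. v i \<oplus> (\<alpha> \<otimes> d i \<oplus> \<beta> \<otimes> w i))"

lemma affine_point_closed:
  "v \<in> vectors R n \<Longrightarrow> d \<in> vectors R n \<Longrightarrow> w \<in> vectors R n \<Longrightarrow> \<alpha> \<in> carrier R \<Longrightarrow> \<beta> \<in> carrier R \<Longrightarrow>
     affine_point n v \<alpha> d \<beta> w \<in> vectors R n"
  unfolding vectors_def affine_point_def by (auto simp: PiE_iff)

lemma vec_coset_span:
  "vec_coset R n v (vec_span1 R n d) = {(\<lambda>i\<in>{..<n}. v i \<oplus> c \<otimes> d i) |c. c \<in> carrier R}"
proof -
  have "(\<lambda>i\<in>{..<n}. v i \<oplus> (\<lambda>i\<in>{..<n}. c \<otimes> d i) i) = (\<lambda>i\<in>{..<n}. v i \<oplus> c \<otimes> d i)" for c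
    by (rule restrict_ext) simp
  moreover have "vec_coset R n v (vec_span1 R n d) =
      {(\<lambda>i\<in>{..<n}. v i \<oplus> (\<lambda>i\<in>{..<n}. c \<otimes> d i) i) |c. c \<in> carrier R}"
    unfolding vec_coset_def vec_span1_def by blast
  ultimately show ?thesis by simp
qed

lemma line_in_closed_set:
  assumes B: "closed_set (desarguesian_affine_space R n) B" and P: "P \<in> B" "Q \<in> B" and t: "t \<in> carrier R"
  shows "(\<lambda>i\<in>{..<n}. P i \<oplus> t \<otimes> (Q i \<ominus> P i)) \<in> B"
proof (cases "P = Q")
  case True
  have "P \<in> vectors R n" using B P unfolding closed_set_def desarguesian_affine_space_def by auto
  then have "(\<lambda>i\<in>{..<n}. P i \<oplus> t \<otimes> (Q i \<ominus> P i)) = P"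
    using True t unfolding vectors_def
    by (auto simp: PiE_iff extensional_def restrict_def fun_eq_iff a_minus_def r_neg)
  then show ?thesis using P by simp
next
  case False
  have V: "P \<in> vectors R n" "Q \<in> vectors R n"
    using B P unfolding closed_set_def desarguesian_affine_space_def by auto
  have c: "P i \<in> carrier R" "Q i \<in> carrier R" if "i < n" for i
    using V that unfolding vectors_def by (auto simp: PiE_iff)
  define d where "d = (\<lambda>i\<in>{..<n}. Q i \<ominus> P i)"
  have d: "d \<in> vectors R n" unfolding d_def vectors_def using c by auto
  have d0: "d \<noteq> (\<lambda>i\<in>{..<n}. \<zero>)"
  proof
    assume eq: "d = (\<lambda>i\<in>{..<n}. \<zero>)"
    have "P i = Q i" if "i < n" for i
    proof -
      have "Q i \<ominus> P i = \<zero>" using fun_cong[OF eq, of i] that unfolding d_def by simp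
      then show ?thesis using c[OF that] by simp
    qed
    then have "P = Q" using V unfolding vectors_def by (auto intro: PiE_ext)
    then show False using False by simp
  qed
  let ?l = "vec_coset R n P (vec_span1 R n d)"
  have l: "?l \<in> lines (desarguesian_affine_space R n)"
    unfolding desarguesian_affine_space_def one_dim_subspaces_def using V d d0 by auto
  have Pl: "P \<in> ?l"
  proof -
    have e0: "(\<lambda>i\<in>{..<n}. P i \<oplus> \<zero> \<otimes> d i) = P"
      using V c d unfolding vectors_def by (auto simp: PiE_iff extensional_def restrict_def fun_eq_iff)
    show ?thesis unfolding vec_coset_span mem_Collect_eq using e0[symmetric] zero_closed by blast
  qed
  have Ql: "Q \<in> ?l"
  proof -
    have e0: "(\<lambda>i\<in>{..<n}. P i \<oplus> \<one> \<otimes> d i) = Q"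
    proof
      fix i
      show "(\<lambda>i\<in>{..<n}. P i \<oplus> \<one> \<otimes> d i) i = Q i"
      proof (cases "i < n")
        case True
        have "P i \<oplus> (Q i \<ominus> P i) = Q i" using c[OF True] by algebra
        then show ?thesis using True c unfolding d_def by simp
      next
        case False
        then show ?thesis using V unfolding vectors_def by (auto simp: PiE_iff extensional_def)
      qed
    qed
    show ?thesis unfolding vec_coset_span mem_Collect_eq using e0[symmetric] one_closed by blast
  qed
  let ?X = "\<lambda>i\<in>{..<n}. P i \<oplus> t \<otimes> (Q i \<ominus> P i)"
  have X: "?X = (\<lambda>i\<in>{..<n}. P i \<oplus> t \<otimes> d i)" unfolding d_def by (auto simp: restrict_def)
  have "?X \<in> ?l" unfolding X vec_coset_span using t by blast
  moreover have "?X \<in> vectors R n" unfolding vectors_def using c t by auto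
  ultimately have "?X \<in> points_on (desarguesian_affine_space R n) ?l"
    unfolding points_on_def desarguesian_affine_space_def by simp
  moreover have "points_on (desarguesian_affine_space R n) ?l \<subseteq> B"
    using closed_set_line[OF B l P False] Pl Ql by (simp add: desarguesian_affine_space_def)
  ultimately show ?thesis by blast
qed

text \<open>The plane through a line \<open>v + \<alpha> d\<close> and a point \<open>v + w\<close> consists of the points
\<open>v + \<alpha> d + \<beta> w\<close>. Joining points of the line to \<open>v + w\<close> reaches those with \<open>\<beta> \<noteq> 1\<close>; the
others are reached from there because the field has a third element.\<close>

lemma planes_have_card_affine_space:
  assumes fin: "finite (carrier R)" and c3: "3 \<le> card (carrier R)"
  shows "planes_have_card (desarguesian_affine_space R n) (card (carrier R) ^ 2)"
  unfolding planes_have_card_def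
proof (intro ballI impI)
  let ?S = "desarguesian_affine_space R n"
  fix l x assume l: "l \<in> lines ?S" and x: "x \<in> points ?S" and nl: "\<not> inc ?S x l"
  obtain v d where v: "v \<in> vectors R n" and d: "d \<in> vectors R n" "d \<noteq> (\<lambda>i\<in>{..<n}. \<zero>)"
    and ld: "l = vec_coset R n v (vec_span1 R n d)"
    using l unfolding desarguesian_affine_space_def one_dim_subspaces_def by auto
  have xV: "x \<in> vectors R n" using x by (simp add: desarguesian_affine_space_def)
  have cv: "v i \<in> carrier R" "d i \<in> carrier R" "x i \<in> carrier R" if "i < n" for i
    using v d xV that unfolding vectors_def by (auto simp: PiE_iff)
  define w where "w = (\<lambda>i\<in>{..<n}. x i \<ominus> v i)"
  have w: "w \<in> vectors R n" unfolding w_def vectors_def using cv by auto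
  have cw: "w i \<in> carrier R" if "i < n" for i using w that unfolding vectors_def by (auto simp: PiE_iff)
  let ?a = "\<lambda>\<alpha> \<beta>. affine_point n v \<alpha> d \<beta> w"
  let ?Pl = "(\<lambda>(\<alpha>, \<beta>). ?a \<alpha> \<beta>) ` (carrier R \<times> carrier R)"
  have l_eq: "l = {?a \<alpha> \<zero> |\<alpha>. \<alpha> \<in> carrier R}"
  proof -
    have "?a \<alpha> \<zero> = (\<lambda>i\<in>{..<n}. v i \<oplus> \<alpha> \<otimes> d i)" if "\<alpha> \<in> carrier R" for \<alpha>
      unfolding affine_point_def using cv cw that by (intro restrict_ext) simp
    then show ?thesis unfolding ld vec_coset_span by force
  qed
  have x_eq: "x = ?a \<zero> \<one>"
  proof
    fix i
    show "x i = ?a \<zero> \<one> i"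
    proof (cases "i < n")
      case True
      have "v i \<oplus> (x i \<ominus> v i) = x i" using cv[OF True] by algebra
      then show ?thesis using True cv cw unfolding affine_point_def w_def by simp
    next
      case False
      then show ?thesis using xV unfolding vectors_def affine_point_def by (auto simp: PiE_iff extensional_def)
    qed
  qed
  have on_l: "points_on ?S l = l"
    unfolding points_on_def l_eq desarguesian_affine_space_def using affine_point_closed[OF v d(1) w] by auto
  have xl: "x \<notin> l" using nl by (simp add: desarguesian_affine_space_def)
  have indep: "\<alpha> = \<zero> \<and> \<beta> = \<zero>"
    if ab: "\<alpha> \<in> carrier R" "\<beta> \<in> carrier R" and z: "\<And>i. i < n \<Longrightarrow> \<alpha> \<otimes> d i \<oplus> \<beta> \<otimes> w i = \<zero>" for \<alpha> \<beta>
  proof -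
    have b0: "\<beta> = \<zero>"
    proof (rule ccontr)
      assume nz: "\<beta> \<noteq> \<zero>"
      then have ib: "inv \<beta> \<in> carrier R" "inv \<beta> \<otimes> \<beta> = \<one>" using ab field_Units by auto
      have "x = ?a (\<ominus> (inv \<beta> \<otimes> \<alpha>)) \<zero>"
        unfolding x_eq affine_point_def
      proof (rule restrict_ext)
        fix i assume "i \<in> {..<n}"
        then have i: "i < n" by simp
        have "w i = (inv \<beta> \<otimes> \<beta>) \<otimes> w i" using ib cw[OF i] by simp
        also have "\<dots> = inv \<beta> \<otimes> (\<alpha> \<otimes> d i \<oplus> \<beta> \<otimes> w i) \<ominus> (inv \<beta> \<otimes> \<alpha>) \<otimes> d i"
          using ib(1) ab cv[OF i] cw[OF i] by algebra
        also have "\<dots> = \<ominus> (inv \<beta> \<otimes> \<alpha>) \<otimes> d i" unfolding z[OF i] using ib(1) ab cv[OF i] by algebra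
        finally show "v i \<oplus> (\<zero> \<otimes> d i \<oplus> \<one> \<otimes> w i) = v i \<oplus> (\<ominus> (inv \<beta> \<otimes> \<alpha>) \<otimes> d i \<oplus> \<zero> \<otimes> w i)"
          using cv[OF i] cw[OF i] ab ib by simp
      qed
      then show False using xl l_eq ab ib by blast
    qed
    have "\<exists>i<n. d i \<noteq> \<zero>"
    proof (rule ccontr)
      assume "\<not> (\<exists>i<n. d i \<noteq> \<zero>)"
      then have "d = (\<lambda>i\<in>{..<n}. \<zero>)"
        using d(1) unfolding vectors_def by (auto simp: PiE_iff extensional_def restrict_def fun_eq_iff)
      then show False using d(2) by simp
    qed
    then obtain i where i: "i < n" "d i \<noteq> \<zero>" by blast
    have "\<alpha> \<otimes> d i = \<zero>" using z[OF i(1)] b0 ab cv[OF i(1)] cw[OF i(1)] by simp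
    then have "\<alpha> = \<zero>" using integral[of \<alpha> "d i"] i cv[OF i(1)] ab by auto
    then show ?thesis using b0 by simp
  qed
  have inj: "inj_on (\<lambda>(\<alpha>, \<beta>). ?a \<alpha> \<beta>) (carrier R \<times> carrier R)"
  proof (rule inj_onI)
    fix s s' assume s: "s \<in> carrier R \<times> carrier R" "s' \<in> carrier R \<times> carrier R"
      and eq0: "(\<lambda>(\<alpha>, \<beta>). ?a \<alpha> \<beta>) s = (\<lambda>(\<alpha>, \<beta>). ?a \<alpha> \<beta>) s'"
    obtain \<alpha> \<beta> \<alpha>' \<beta>' where ss: "s = (\<alpha>, \<beta>)" "s' = (\<alpha>', \<beta>')" by (metis surj_pair)
    have ab: "\<alpha> \<in> carrier R" "\<beta> \<in> carrier R" "\<alpha>' \<in> carrier R" "\<beta>' \<in> carrier R" using s ss by auto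
    have "(\<alpha> \<ominus> \<alpha>') \<otimes> d i \<oplus> (\<beta> \<ominus> \<beta>') \<otimes> w i = \<zero>" if i: "i < n" for i
    proof -
      have "?a \<alpha> \<beta> i = ?a \<alpha>' \<beta>' i" using eq0 ss by simp
      then have e: "v i \<oplus> (\<alpha> \<otimes> d i \<oplus> \<beta> \<otimes> w i) = v i \<oplus> (\<alpha>' \<otimes> d i \<oplus> \<beta>' \<otimes> w i)"
        using i unfolding affine_point_def by simp
      have "(\<alpha> \<ominus> \<alpha>') \<otimes> d i \<oplus> (\<beta> \<ominus> \<beta>') \<otimes> w i
          = (v i \<oplus> (\<alpha> \<otimes> d i \<oplus> \<beta> \<otimes> w i)) \<ominus> (v i \<oplus> (\<alpha>' \<otimes> d i \<oplus> \<beta>' \<otimes> w i))"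
        using ab cv[OF i] cw[OF i] by algebra
      then show ?thesis unfolding e using ab cv[OF i] cw[OF i] by simp
    qed
    then have "\<alpha> \<ominus> \<alpha>' = \<zero> \<and> \<beta> \<ominus> \<beta>' = \<zero>" using ab by (intro indep) auto
    then show "s = s'" using ab ss by simp
  qed
  have closed: "closed_set ?S ?Pl"
    unfolding closed_set_def
  proof (intro conjI ballI impI)
    show "?Pl \<subseteq> points ?S"
      unfolding desarguesian_affine_space_def using affine_point_closed[OF v d(1) w] by auto
    fix m P P' assume m: "m \<in> lines ?S" and P: "P \<in> ?Pl" "P' \<in> ?Pl" "P \<noteq> P'" "inc ?S P m" "inc ?S P' m"
    obtain u e where u: "u \<in> vectors R n" and e: "e \<in> vectors R n"
      and me: "m = vec_coset R n u (vec_span1 R n e)"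
      using m unfolding desarguesian_affine_space_def one_dim_subspaces_def by auto
    have cu: "u i \<in> carrier R" "e i \<in> carrier R" if "i < n" for i
      using u e that unfolding vectors_def by (auto simp: PiE_iff)
    obtain \<alpha> \<beta> \<alpha>' \<beta>' where ab: "\<alpha> \<in> carrier R" "\<beta> \<in> carrier R" "\<alpha>' \<in> carrier R" "\<beta>' \<in> carrier R"
      and Pa: "P = ?a \<alpha> \<beta>" "P' = ?a \<alpha>' \<beta>'" using P(1,2) by auto
    obtain r r' where r: "r \<in> carrier R" "r' \<in> carrier R"
      and Pr: "P = (\<lambda>i\<in>{..<n}. u i \<oplus> r \<otimes> e i)" "P' = (\<lambda>i\<in>{..<n}. u i \<oplus> r' \<otimes> e i)"
      using P(4,5) unfolding me vec_coset_span by (auto simp: desarguesian_affine_space_def)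
    have rr: "r' \<ominus> r \<noteq> \<zero>" using P(3) Pr r by auto
    then have ir: "inv (r' \<ominus> r) \<in> carrier R" "inv (r' \<ominus> r) \<otimes> (r' \<ominus> r) = \<one>" using r field_Units by auto
    show "points_on ?S m \<subseteq> ?Pl"
    proof
      fix Y assume "Y \<in> points_on ?S m"
      then obtain s where s: "s \<in> carrier R" "Y = (\<lambda>i\<in>{..<n}. u i \<oplus> s \<otimes> e i)"
        unfolding points_on_def me vec_coset_span by (auto simp: desarguesian_affine_space_def)
      define t where "t = (s \<ominus> r) \<otimes> inv (r' \<ominus> r)"
      have t: "t \<in> carrier R" unfolding t_def using s r ir by simp
      have tr: "t \<otimes> (r' \<ominus> r) = s \<ominus> r" unfolding t_def using s r ir by (simp add: m_assoc)
      have "Y = ?a (\<alpha> \<oplus> t \<otimes> (\<alpha>' \<ominus> \<alpha>)) (\<beta> \<oplus> t \<otimes> (\<beta>' \<ominus> \<beta>))"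
        unfolding s(2) affine_point_def
      proof (rule restrict_ext)
        fix i assume "i \<in> {..<n}"
        then have i: "i < n" by simp
        have e1: "u i \<oplus> r \<otimes> e i = v i \<oplus> (\<alpha> \<otimes> d i \<oplus> \<beta> \<otimes> w i)"
          using fun_cong[OF Pa(1)[unfolded Pr(1)], of i] i unfolding affine_point_def by simp
        have e2: "u i \<oplus> r' \<otimes> e i = v i \<oplus> (\<alpha>' \<otimes> d i \<oplus> \<beta>' \<otimes> w i)"
          using fun_cong[OF Pa(2)[unfolded Pr(2)], of i] i unfolding affine_point_def by simp
        have "v i \<oplus> ((\<alpha> \<oplus> t \<otimes> (\<alpha>' \<ominus> \<alpha>)) \<otimes> d i \<oplus> (\<beta> \<oplus> t \<otimes> (\<beta>' \<ominus> \<beta>)) \<otimes> w i)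
            = (v i \<oplus> (\<alpha> \<otimes> d i \<oplus> \<beta> \<otimes> w i)) \<oplus>
              t \<otimes> ((v i \<oplus> (\<alpha>' \<otimes> d i \<oplus> \<beta>' \<otimes> w i)) \<ominus> (v i \<oplus> (\<alpha> \<otimes> d i \<oplus> \<beta> \<otimes> w i)))"
          using ab cv[OF i] cw[OF i] t by algebra
        also have "\<dots> = (u i \<oplus> r \<otimes> e i) \<oplus> t \<otimes> ((u i \<oplus> r' \<otimes> e i) \<ominus> (u i \<oplus> r \<otimes> e i))"
          unfolding e1 e2 by simp
        also have "\<dots> = (u i \<oplus> r \<otimes> e i) \<oplus> (t \<otimes> (r' \<ominus> r)) \<otimes> e i"
          using cu[OF i] r t by algebra
        also have "\<dots> = u i \<oplus> s \<otimes> e i" unfolding tr using cu[OF i] r s by algebra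
        finally show "u i \<oplus> s \<otimes> e i = v i \<oplus> ((\<alpha> \<oplus> t \<otimes> (\<alpha>' \<ominus> \<alpha>)) \<otimes> d i \<oplus> (\<beta> \<oplus> t \<otimes> (\<beta>' \<ominus> \<beta>)) \<otimes> w i)" by simp
      qed
      then show "Y \<in> ?Pl" using ab t by (auto intro!: image_eqI[of _ _ "(\<alpha> \<oplus> t \<otimes> (\<alpha>' \<ominus> \<alpha>), \<beta> \<oplus> t \<otimes> (\<beta>' \<ominus> \<beta>))"])
    qed
  qed
  have least: "?Pl \<subseteq> B" if B: "closed_set ?S B" and lB: "insert x l \<subseteq> B" for B
  proof -
    have comb: "?a (\<alpha> \<oplus> t \<otimes> (\<alpha>' \<ominus> \<alpha>)) (\<beta> \<oplus> t \<otimes> (\<beta>' \<ominus> \<beta>)) \<in> B"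
      if "?a \<alpha> \<beta> \<in> B" "?a \<alpha>' \<beta>' \<in> B" "\<alpha> \<in> carrier R" "\<beta> \<in> carrier R" "\<alpha>' \<in> carrier R" "\<beta>' \<in> carrier R" "t \<in> carrier R"
      for \<alpha> \<beta> \<alpha>' \<beta>' t
    proof -
      have "?a (\<alpha> \<oplus> t \<otimes> (\<alpha>' \<ominus> \<alpha>)) (\<beta> \<oplus> t \<otimes> (\<beta>' \<ominus> \<beta>)) = (\<lambda>i\<in>{..<n}. ?a \<alpha> \<beta> i \<oplus> t \<otimes> (?a \<alpha>' \<beta>' i \<ominus> ?a \<alpha> \<beta> i))"
        unfolding affine_point_def
      proof (rule restrict_ext)
        fix i assume "i \<in> {..<n}"
        then have i: "i < n" by simp
        show "v i \<oplus> ((\<alpha> \<oplus> t \<otimes> (\<alpha>' \<ominus> \<alpha>)) \<otimes> d i \<oplus> (\<beta> \<oplus> t \<otimes> (\<beta>' \<ominus> \<beta>)) \<otimes> w i) =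
          (\<lambda>i\<in>{..<n}. v i \<oplus> (\<alpha> \<otimes> d i \<oplus> \<beta> \<otimes> w i)) i \<oplus>
          t \<otimes> ((\<lambda>i\<in>{..<n}. v i \<oplus> (\<alpha>' \<otimes> d i \<oplus> \<beta>' \<otimes> w i)) i \<ominus> (\<lambda>i\<in>{..<n}. v i \<oplus> (\<alpha> \<otimes> d i \<oplus> \<beta> \<otimes> w i)) i)"
          using i apply simp
          using that(3-) cv[OF i] cw[OF i] by algebra
      qed
      then show ?thesis using line_in_closed_set[OF B that(1,2,7)] by simp
    qed
    have b0: "?a \<alpha> \<zero> \<in> B" if "\<alpha> \<in> carrier R" for \<alpha> using that lB l_eq by blast
    have xB: "?a \<zero> \<one> \<in> B" using lB x_eq by simp
    \<comment> \<open>The point lies on the line joining \<open>v + (\<alpha> / (1 - \<beta>)) d\<close> to \<open>v + w\<close>.\<close>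
    have bn1: "?a \<alpha> \<beta> \<in> B" if ab: "\<alpha> \<in> carrier R" "\<beta> \<in> carrier R" "\<beta> \<noteq> \<one>" for \<alpha> \<beta>
    proof -
      have nz: "\<one> \<ominus> \<beta> \<noteq> \<zero>" using ab by auto
      then have ib: "inv (\<one> \<ominus> \<beta>) \<in> carrier R" "inv (\<one> \<ominus> \<beta>) \<otimes> (\<one> \<ominus> \<beta>) = \<one>" using ab field_Units by auto
      let ?\<gamma> = "\<alpha> \<otimes> inv (\<one> \<ominus> \<beta>)"
      have "?\<gamma> \<oplus> \<beta> \<otimes> (\<zero> \<ominus> ?\<gamma>) = \<alpha> \<otimes> (inv (\<one> \<ominus> \<beta>) \<otimes> (\<one> \<ominus> \<beta>))"
        using ab ib(1) by algebra
      then have e1: "?\<gamma> \<oplus> \<beta> \<otimes> (\<zero> \<ominus> ?\<gamma>) = \<alpha>" using ib ab by simp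
      have e2: "\<zero> \<oplus> \<beta> \<otimes> (\<one> \<ominus> \<zero>) = \<beta>" using ab by algebra
      show ?thesis using comb[OF b0[of ?\<gamma>] xB, of \<beta>] ab ib(1) unfolding e1 e2 by simp
    qed
    have "carrier R - {\<zero>, \<one>} \<noteq> {}"
    proof
      assume "carrier R - {\<zero>, \<one>} = {}"
      then have "card (carrier R) \<le> card {\<zero>, \<one>}" by (intro card_mono) auto
      then show False using c3 by simp
    qed
    then obtain \<gamma> where g: "\<gamma> \<in> carrier R" "\<gamma> \<noteq> \<zero>" "\<gamma> \<noteq> \<one>" by auto
    then have ig: "inv \<gamma> \<in> carrier R" "inv \<gamma> \<otimes> \<gamma> = \<one>" using field_Units by auto
    \<comment> \<open>Extend the segment from \<open>v\<close> to a point with \<open>\<beta> = \<gamma>\<close> until \<open>\<beta> = 1\<close>.\<close>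
    have b1: "?a \<alpha> \<one> \<in> B" if a: "\<alpha> \<in> carrier R" for \<alpha>
    proof -
      have "\<zero> \<oplus> inv \<gamma> \<otimes> (\<alpha> \<otimes> \<gamma> \<ominus> \<zero>) = \<alpha> \<otimes> (inv \<gamma> \<otimes> \<gamma>)" using a ig(1) g(1) by algebra
      then have e1: "\<zero> \<oplus> inv \<gamma> \<otimes> (\<alpha> \<otimes> \<gamma> \<ominus> \<zero>) = \<alpha>" using ig a by simp
      have "\<zero> \<oplus> inv \<gamma> \<otimes> (\<gamma> \<ominus> \<zero>) = inv \<gamma> \<otimes> \<gamma>" using ig(1) g(1) by algebra
      then have e2: "\<zero> \<oplus> inv \<gamma> \<otimes> (\<gamma> \<ominus> \<zero>) = \<one>" using ig by simp
      show ?thesis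
        using comb[OF b0[of \<zero>] bn1[of "\<alpha> \<otimes> \<gamma>" \<gamma>], of "inv \<gamma>"] a g ig(1) unfolding e1 e2 by simp
    qed
    show ?thesis using bn1 b1 by fastforce
  qed
  have ins: "insert x l \<subseteq> ?Pl" unfolding l_eq x_eq by auto
  have "plane_span ?S (insert x (points_on ?S l)) = ?Pl"
    unfolding on_l
  proof (rule equalityI)
    show "plane_span ?S (insert x l) \<subseteq> ?Pl" by (rule plane_span_least[OF closed ins])
    show "?Pl \<subseteq> plane_span ?S (insert x l)"
      unfolding plane_span_def
    proof (rule Inter_greatest)
      fix B assume "B \<in> {B. closed_set ?S B \<and> insert x l \<subseteq> B}"
      then show "?Pl \<subseteq> B" using least[of B] by simp
    qed
  qed
  then show "card (plane_span ?S (insert x (points_on ?S l))) = card (carrier R) ^ 2"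
    using inj by (simp add: card_image card_cartesian_product power2_eq_square)
qed

end

section \<open>The linear space of the spread\<close>

text \<open>Otherwise all orbit lengths are powers of \<open>p\<close> different from \<open>1\<close>.\<close>

lemma (in group_action) p_group_fixed_point:
  assumes p: "Factorial_Ring.prime p" and G: "order G = p ^ k" and E: "finite E" "\<not> p dvd card E"
  shows "\<exists>x\<in>E. \<forall>g\<in>carrier G. \<phi> g x = x"
proof (rule ccontr)
  assume neg: "\<not> (\<exists>x\<in>E. \<forall>g\<in>carrier G. \<phi> g x = x)"
  have dvd: "p dvd card Y" if Y: "Y \<in> orbits G E \<phi>" for Y
  proof -
    obtain x where x: "x \<in> E" "Y = orbit G \<phi> x" using Y unfolding orbits_def by auto
    have "card Y * card (stabilizer G \<phi> x) = p ^ k"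
      using orbit_stabilizer_theorem[OF x(1)] G x(2) by simp
    then have "card Y dvd p ^ k" by (metis dvd_triv_left)
    then obtain i where i: "card Y = p ^ i" using divides_primepow_nat[OF p] by blast
    have "i \<noteq> 0"
    proof
      assume "i = 0"
      then have "card Y = 1" using i by simp
      moreover have "x \<in> Y" using orbit_refl[OF x(1)] x(2) by simp
      ultimately have "Y = {x}" by (metis card_1_singletonE singletonD)
      then have "\<phi> g x = x" if "g \<in> carrier G" for g using that x(2) unfolding orbit_def by blast
      then show False using neg x(1) by blast
    qed
    then show ?thesis using i by simp
  qed
  have "card E = card (\<Union>(orbits G E \<phi>))" by (simp add: orbits_coverture)
  also have "\<dots> = (\<Sum>Y\<in>orbits G E \<phi>. card Y)"
  proof (rule card_Union_disjoint)
    show "pairwise disjnt (orbits G E \<phi>)"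
      using disjoint_union unfolding pairwise_def disjnt_def by blast
    show "finite Y" if "Y \<in> orbits G E \<phi>" for Y
      using that orbits_coverture E(1) by (metis Union_upper finite_subset)
  qed
  finally have "p dvd card E" using dvd by (simp add: dvd_sum)
  then show False using E by blast
qed

context kummer_generator
begin

definition translate :: "'a \<Rightarrow> 'a set \<Rightarrow> 'a set" where
  "translate v A = (\<lambda>x. v \<oplus> x) ` A"

definition space :: "('a, 'a set) incidence_structure" where
  "space = \<lparr>points = carrier K, lines = {translate v (dilate k L) |v k. v \<in> carrier K \<and> k \<in> C}, inc = (\<in>)\<rparr>"

lemma space_simps [simp]:
  "points space = carrier K" "lines space = {translate v (dilate k L) |v k. v \<in> carrier K \<and> k \<in> C}"
  "inc space = (\<in>)"
  by (simp_all add: space_def)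

lemma translate_translate:
  "v \<in> carrier K \<Longrightarrow> w \<in> carrier K \<Longrightarrow> A \<subseteq> carrier K \<Longrightarrow> translate v (translate w A) = translate (v \<oplus> w) A"
  unfolding translate_def image_image by (intro image_cong refl) (auto simp: a_assoc)

lemma translate_zero: "A \<subseteq> carrier K \<Longrightarrow> translate \<zero> A = A"
  unfolding translate_def by force

lemma translate_closed: "v \<in> carrier K \<Longrightarrow> A \<subseteq> carrier K \<Longrightarrow> translate v A \<subseteq> carrier K"
  unfolding translate_def by auto

lemma card_translate: "v \<in> carrier K \<Longrightarrow> A \<subseteq> carrier K \<Longrightarrow> card (translate v A) = card A"
  unfolding translate_def by (intro card_image inj_onI) (auto simp: subset_iff)

lemma minus_self [simp]: "x \<in> carrier K \<Longrightarrow> x \<ominus> x = \<zero>"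
  by (simp add: a_minus_def r_neg)

lemma line_in_space: "v \<in> carrier K \<Longrightarrow> k \<in> C \<Longrightarrow> translate v (dilate k L) \<in> lines space"
  by auto

lemma dilate_L_minus: "g \<in> carrier K \<Longrightarrow> x \<in> dilate g L \<Longrightarrow> y \<in> dilate g L \<Longrightarrow> x \<ominus> y \<in> dilate g L"
  by (rule F_module_minus[OF F_module_dilate[OF F_module_L]])

lemma translate_dilate_iff:
  assumes "v \<in> carrier K" "k \<in> carrier K"
  shows "x \<in> translate v (dilate k L) \<longleftrightarrow> x \<in> carrier K \<and> x \<ominus> v \<in> dilate k L"
proof
  assume "x \<in> translate v (dilate k L)"
  then obtain s where s: "s \<in> dilate k L" "x = v \<oplus> s" unfolding translate_def by auto
  have sK: "s \<in> carrier K" using s dilate_L_F_module(1)[OF assms(2)] by auto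
  have "x \<ominus> v = s" unfolding s(2) using sK assms(1) by algebra
  then show "x \<in> carrier K \<and> x \<ominus> v \<in> dilate k L" using s sK assms(1) by simp
next
  assume h: "x \<in> carrier K \<and> x \<ominus> v \<in> dilate k L"
  then have "x = v \<oplus> (x \<ominus> v)" using assms(1) by algebra
  then show "x \<in> translate v (dilate k L)" using h unfolding translate_def by blast
qed

lemma line_base_point:
  assumes v: "v \<in> carrier K" "k \<in> carrier K" and x: "x \<in> translate v (dilate k L)"
  shows "translate v (dilate k L) = translate x (dilate k L)"
proof -
  have xK: "x \<in> carrier K" "x \<ominus> v \<in> dilate k L" using x translate_dilate_iff[OF v] by auto
  have "y \<ominus> v \<in> dilate k L \<longleftrightarrow> y \<ominus> x \<in> dilate k L" if y: "y \<in> carrier K" for y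
  proof
    assume h: "y \<ominus> v \<in> dilate k L"
    have "y \<ominus> x = (y \<ominus> v) \<ominus> (x \<ominus> v)" using y xK(1) v(1) by algebra
    then show "y \<ominus> x \<in> dilate k L" using dilate_L_minus[OF v(2) h xK(2)] by simp
  next
    assume h: "y \<ominus> x \<in> dilate k L"
    have "y \<ominus> v = (y \<ominus> x) \<oplus> (x \<ominus> v)" using y xK(1) v(1) by algebra
    then show "y \<ominus> v \<in> dilate k L" using dilate_L_F_module(5)[OF v(2) h xK(2)] by simp
  qed
  then show ?thesis using translate_dilate_iff[OF v] translate_dilate_iff[OF xK(1) v(2)] by blast
qed

lemma line_closed: "l \<in> lines space \<Longrightarrow> l \<subseteq> carrier K"
  using translate_closed dilate_L_F_module(1) by auto

lemma points_on_line: "l \<in> lines space \<Longrightarrow> points_on space l = l"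
  using line_closed unfolding points_on_def by auto

lemma card_line: "l \<in> lines space \<Longrightarrow> card l = q ^ 2"
proof -
  assume "l \<in> lines space"
  then obtain v k where vk: "v \<in> carrier K" "k \<in> C" "l = translate v (dilate k L)" by auto
  have "card (dilate k L) = card L" using vk by (intro card_dilate) auto
  then show ?thesis using card_translate[OF vk(1), of "dilate k L"] dilate_L_F_module(1)[of k] vk card_L by auto
qed

lemma line_through_two_points:
  assumes xy: "x \<in> carrier K" "y \<in> carrier K" "x \<noteq> y"
  shows "\<exists>!l. l \<in> lines space \<and> x \<in> l \<and> y \<in> l"
proof -
  have d: "y \<ominus> x \<in> carrier K" "y \<ominus> x \<noteq> \<zero>" using xy by auto
  obtain k s where ks: "k \<in> C" "s \<in> L" "s \<noteq> \<zero>" "y \<ominus> x = k \<otimes> s" using spread_cover[OF d] by auto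
  have kK: "k \<in> carrier K" using ks by auto
  have dk: "y \<ominus> x \<in> dilate k L" using ks unfolding dilate_def by auto
  show ?thesis
  proof (intro ex1I[of _ "translate x (dilate k L)"] conjI)
    show "translate x (dilate k L) \<in> lines space" using xy ks by auto
    show "x \<in> translate x (dilate k L)" using translate_dilate_iff[OF xy(1) kK] dilate_L_F_module(2)[OF kK] xy by simp
    show "y \<in> translate x (dilate k L)" using translate_dilate_iff[OF xy(1) kK] dk xy by simp
    fix l assume l: "l \<in> lines space \<and> x \<in> l \<and> y \<in> l"
    then obtain v k' where vk: "v \<in> carrier K" "k' \<in> C" "l = translate v (dilate k' L)" by auto
    have k'K: "k' \<in> carrier K" using vk by auto
    have lx: "l = translate x (dilate k' L)" using line_base_point[OF vk(1) k'K] l vk(3) by simp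
    then have "y \<ominus> x \<in> dilate k' L" using l translate_dilate_iff[OF xy(1) k'K] by simp
    then have "dilate k' L = dilate k L" using spread_unique[OF vk(2) ks(1)] dk d(2) by blast
    then show "l = translate x (dilate k L)" using lx by simp
  qed
qed

lemma Q_bounds: "4 \<le> q ^ 2" "q ^ 2 < q ^ (2 * n)"
proof -
  have "2 * 2 \<le> q * q" using q2 by (intro mult_le_mono)
  then show "4 \<le> q ^ 2" by (simp add: power2_eq_square)
  show "q ^ 2 < q ^ (2 * n)" using q2 n1 by (intro power_strict_increasing) auto
qed

lemma exists_other_line: "\<exists>k\<in>C. k \<notin> L \<and> dilate k L \<inter> L = {\<zero>}"
proof -
  have "\<not> carrier K \<subseteq> L"
  proof
    assume "carrier K \<subseteq> L"
    then have "card (carrier K) \<le> card L" by (intro card_mono) auto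
    then show False using card_K card_L Q_bounds by simp
  qed
  then obtain w where w: "w \<in> carrier K" "w \<notin> L" by blast
  then have "w \<noteq> \<zero>" by auto
  then obtain k s where ks: "k \<in> C" "s \<in> L" "s \<noteq> \<zero>" "w = k \<otimes> s" using spread_cover[OF w(1)] by auto
  have kK: "k \<in> carrier K" using ks by auto
  have oneL: "dilate \<one> L = L" by (rule dilate_one) auto
  have "dilate k L \<noteq> L" using w(2) ks unfolding dilate_def by blast
  then have int: "dilate k L \<inter> L \<subseteq> {\<zero>}"
    using spread_unique[OF ks(1) C_closed(3)] unfolding oneL by blast
  then have "dilate k L \<inter> L = {\<zero>}" using dilate_L_F_module(2)[OF kK] by auto
  moreover have "k \<notin> L" using int dilate_L_F_module(3)[OF kK] C_closed(2)[OF ks(1)] by blast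
  ultimately show ?thesis using ks(1) by blast
qed

lemma finite_lines: "finite (lines space)"
proof (rule finite_subset)
  show "lines space \<subseteq> Pow (carrier K)" using line_closed by blast
  show "finite (Pow (carrier K))" using fin by simp
qed

lemma finite_linear_space_space: "finite_linear_space space"
proof
  show "finite (points space)" using fin by simp
  show "\<exists>!l. l \<in> lines space \<and> inc space x l \<and> inc space y l"
    if "x \<in> points space" "y \<in> points space" "x \<noteq> y" for x y
    using line_through_two_points that by simp
  show "2 \<le> card (points_on space l)" if "l \<in> lines space" for l
    using card_line[OF that] points_on_line[OF that] Q_bounds by simp
  show "2 \<le> card (lines_through space x)" if x: "x \<in> points space" for x
  proof -
    obtain k where k: "k \<in> C" "k \<notin> L" using exists_other_line by blast
    have xK: "x \<in> carrier K" using x by simp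
    have kK: "k \<in> carrier K" using k by auto
    have oneL: "dilate \<one> L = L" by (rule dilate_one) auto
    have m1: "y \<in> translate x L \<longleftrightarrow> y \<in> carrier K \<and> y \<ominus> x \<in> L" for y
      using translate_dilate_iff[OF xK one_closed] unfolding oneL .
    have e: "(x \<oplus> k) \<ominus> x = k" using xK kK by algebra
    have "x \<oplus> k \<in> translate x (dilate k L)"
      using translate_dilate_iff[OF xK kK] e dilate_L_F_module(3)[OF kK] xK kK by simp
    moreover have "x \<oplus> k \<notin> translate x L" using m1 e k by simp
    ultimately have ne: "translate x (dilate k L) \<noteq> translate x L" by blast
    have "translate x L \<in> lines space" using line_in_space[OF xK C_closed(3)] oneL by simp
    moreover have "translate x (dilate k L) \<in> lines space" by (rule line_in_space[OF xK k(1)])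
    moreover have "x \<in> translate x L" using m1 xK by simp
    moreover have "x \<in> translate x (dilate k L)"
      using translate_dilate_iff[OF xK kK] dilate_L_F_module(2)[OF kK] xK by simp
    ultimately have "{translate x (dilate k L), translate x L} \<subseteq> lines_through space x"
      unfolding lines_through_def by (simp del: space_simps(2))
    moreover have "finite (lines_through space x)"
      using finite_lines unfolding lines_through_def by simp
    ultimately have "card {translate x (dilate k L), translate x L} \<le> card (lines_through space x)"
      by (intro card_mono)
    then show ?thesis using ne by simp
  qed
qed

lemma L_line: "L \<in> lines space"
proof -
  have "dilate \<one> L = L" by (rule dilate_one) auto
  moreover have "translate \<zero> L = L" by (rule translate_zero) auto
  ultimately have "translate \<zero> (dilate \<one> L) = L" by simp
  then show ?thesis using C_closed(3) zero_closed unfolding space_simps by blast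
qed

lemma dilate_L_line: "k \<in> C \<Longrightarrow> dilate k L \<in> lines space"
proof -
  assume k: "k \<in> C"
  have "translate \<zero> (dilate k L) = dilate k L" using k dilate_L_F_module(1)[of k] by (intro translate_zero) auto
  then show ?thesis using k zero_closed unfolding space_simps by blast
qed

lemma nontrivial_space_space: "nontrivial_space space"
  unfolding nontrivial_space_def
  using L_line card_line[OF L_line] points_on_line[OF L_line] Q_bounds by (intro bexI[of _ L]) auto

text \<open>Two points different from \<open>0\<close> on each of two lines through \<open>0\<close>.\<close>

lemma nondegenerate_space_space: "nondegenerate_space space"
proof -
  obtain k where k: "k \<in> C" "k \<notin> L" "dilate k L \<inter> L = {\<zero>}" using exists_other_line by blast
  have kK: "k \<in> carrier K" "k \<noteq> \<zero>" using k by auto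
  have b1: "b \<noteq> \<one>" using b_notin_F by auto
  have kb: "k \<otimes> b \<in> dilate k L" "k \<in> dilate k L" using dilate_L_F_module[OF kK(1)] by auto
  have kbn: "k \<otimes> b \<noteq> \<zero>" "k \<otimes> b \<noteq> k"
    using kK b integral[of k b] b1 m_lcancel[of k b \<one>] by auto
  have notL: "k \<otimes> b \<notin> L" using kb k(3) kbn by blast
  have notk: "\<one> \<notin> dilate k L" "b \<notin> dilate k L"
    using k(3) L_closed(3,4) b(2) one_not_zero by blast+
  let ?A = "{\<one>, b, k, k \<otimes> b}"
  have ne: "k \<noteq> \<one>" "k \<noteq> b" "k \<otimes> b \<noteq> \<one>" "k \<otimes> b \<noteq> b"
    using k(2) notL L_closed(3,4) by metis+
  have "card ?A = 4" using b1 b1[symmetric] ne ne[symmetric] kbn(2) kbn(2)[symmetric] by simp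
  moreover have "?A \<subseteq> points space" using b kK by simp
  moreover have "\<not> collinear_points space B" if B: "B \<subseteq> ?A" "card B = 3" for B
  proof
    assume "collinear_points space B"
    then obtain l where l: "l \<in> lines space" "B \<subseteq> l"
      unfolding collinear_points_def using points_on_line by (metis)
    have miss: "x \<in> B \<or> y \<in> B" if "x \<in> ?A" "y \<in> ?A" "x \<noteq> y" for x y
    proof (rule ccontr)
      assume "\<not> (x \<in> B \<or> y \<in> B)"
      then have "B \<subseteq> ?A - {x, y}" using B(1) by blast
      then have "card B \<le> card (?A - {x, y})" by (intro card_mono) auto
      also have "\<dots> = 4 - 2" using \<open>card ?A = 4\<close> that by (subst card_Diff_subset) auto
      finally show False using B(2) by simp
    qed
    have uniq: "l = l'" if "x \<in> l" "y \<in> l" "x \<noteq> y" "l' \<in> lines space" "x \<in> l'" "y \<in> l'" for l' x y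
      using line_through_two_points[of x y] that l(1) line_closed by blast
    have "\<one> \<in> B \<and> b \<in> B \<or> k \<in> B \<and> k \<otimes> b \<in> B"
      using miss[of \<one> k] miss[of \<one> "k \<otimes> b"] miss[of b k] miss[of b "k \<otimes> b"] ne ne[symmetric] by auto
    then show False
    proof
      assume h: "\<one> \<in> B \<and> b \<in> B"
      then have "l = L" using l b1 by (intro uniq[of \<one> b L] L_line) auto
      moreover have "k \<in> B \<or> k \<otimes> b \<in> B" using kbn by (intro miss) auto
      ultimately show False using l k(2) notL by blast
    next
      assume h: "k \<in> B \<and> k \<otimes> b \<in> B"
      then have "l = dilate k L" using l kbn kb by (intro uniq[of k "k \<otimes> b"] dilate_L_line k(1)) auto
      moreover have "\<one> \<in> B \<or> b \<in> B" using b1 by (intro miss) auto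
      ultimately show False using l notk by blast
    qed
  qed
  ultimately show ?thesis unfolding nondegenerate_space_def by blast
qed

lemma closed_set_translate:
  assumes A: "closed_set space A" and v: "v \<in> carrier K"
  shows "closed_set space (translate v A)"
  unfolding closed_set_def
proof (intro conjI ballI impI)
  have AK: "A \<subseteq> carrier K" using A by (simp add: closed_set_def)
  show "translate v A \<subseteq> points space" using translate_closed[OF v AK] by simp
  fix l x y assume l: "l \<in> lines space" and x: "x \<in> translate v A" "y \<in> translate v A" "x \<noteq> y"
    and inc: "inc space x l" "inc space y l"
  obtain u k where uk: "u \<in> carrier K" "k \<in> C" "l = translate u (dilate k L)" using l by auto
  have mk: "dilate k L \<subseteq> carrier K" using uk dilate_L_F_module(1) by auto
  let ?l = "translate (\<ominus> v) l"
  have undo: "translate (\<ominus> v) (translate v B) = B" "translate v (translate (\<ominus> v) B) = B" if "B \<subseteq> carrier K" for B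
    using that v by (simp_all add: translate_translate translate_zero l_neg r_neg)
  have "?l = translate (\<ominus> v \<oplus> u) (dilate k L)" unfolding uk(3) using v uk mk by (simp add: translate_translate)
  then have ll: "?l \<in> lines space" using v uk by auto
  have "\<ominus> v \<oplus> x \<in> translate (\<ominus> v) (translate v A)" "\<ominus> v \<oplus> y \<in> translate (\<ominus> v) (translate v A)"
    using x unfolding translate_def by auto
  then have xA: "\<ominus> v \<oplus> x \<in> A" "\<ominus> v \<oplus> y \<in> A" using undo(1)[OF AK] by auto
  have xl: "\<ominus> v \<oplus> x \<in> ?l" "\<ominus> v \<oplus> y \<in> ?l" using inc unfolding translate_def by auto
  have xK: "x \<in> carrier K" "y \<in> carrier K" using x translate_closed[OF v AK] by auto
  have ne: "\<ominus> v \<oplus> x \<noteq> \<ominus> v \<oplus> y" using add.l_cancel[of "\<ominus> v" x y] x(3) xK v by simp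
  have "points_on space ?l \<subseteq> A" using closed_set_line[OF A ll xA ne] xl by simp
  then have "?l \<subseteq> A" using points_on_line[OF ll] by simp
  then have "translate v ?l \<subseteq> translate v A" unfolding translate_def by blast
  then show "points_on space l \<subseteq> translate v A"
    using points_on_line[OF l] undo(2)[OF line_closed[OF l]] by simp
qed

text \<open>The planes on \<open>L\<close> partition the points off \<open>L\<close>, so their number \<open>N\<close> satisfies
\<open>N (q^2 - 1) = q^(2 n - 2) - 1\<close> and is prime to \<open>p\<close>. The translations by \<open>L\<close> permute them, and a
fixed plane is the sum of \<open>L\<close> and any other spread element inside it.\<close>

lemma not_planes_have_card: "\<not> planes_have_card space (q ^ 4)"
proof
  assume pl: "planes_have_card space (q ^ 4)"
  define P where "P x = plane_span space (insert x L)" for x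
  have onL: "points_on space L = L" by (rule points_on_line[OF L_line])
  have LK: "L \<subseteq> carrier K" by auto
  have cP: "card (P x) = q ^ 4" if "x \<in> carrier K - L" for x
    using pl L_line that onL unfolding planes_have_card_def P_def by (auto simp del: space_simps(2))
  have closP: "closed_set space (P x)" if "x \<in> carrier K" for x
    unfolding P_def using that LK by (intro plane_span_closed) auto
  have PK: "P x \<subseteq> carrier K" if "x \<in> carrier K" for x
    using closP[OF that] by (simp add: closed_set_def)
  have sup: "insert x L \<subseteq> P x" for x unfolding P_def by (rule plane_span_superset)
  have PL: "L \<subseteq> P x" "x \<in> P x" for x using sup[of x] by auto
  have finP: "finite (P x)" if "x \<in> carrier K" for x using PK[OF that] by (rule finite_subset_carrier)
  have Peq: "P y = P x" if x: "x \<in> carrier K - L" and y: "y \<in> P x - L" for x y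
  proof -
    have yK: "y \<in> carrier K - L" using x y PK by auto
    have "P y \<subseteq> P x"
      unfolding P_def[of y] using closP x y PL by (intro plane_span_least) auto
    then show ?thesis using cP[OF x] cP[OF yK] finP x by (intro card_subset_eq) auto
  qed
  define E where "E = P ` (carrier K - L)"
  have finE: "finite E" unfolding E_def using fin by simp
  have shift_notin: "s \<oplus> x \<in> carrier K - L" if s: "s \<in> L" and x: "x \<in> carrier K - L" for s x
  proof -
    have sK: "s \<in> carrier K" "x \<in> carrier K" using s x by auto
    have "x = \<ominus> s \<oplus> (s \<oplus> x)" using sK by algebra
    then have "s \<oplus> x \<notin> L" using x s L_closed(5)[of "\<ominus> s" "s \<oplus> x"] L_closed(7)[OF s] by auto
    then show ?thesis using sK by simp
  qed
  have transP: "translate s (P x) = P (s \<oplus> x)" if s: "s \<in> L" and x: "x \<in> carrier K - L" for s x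
  proof -
    have sK: "s \<in> carrier K" "x \<in> carrier K" using s x by auto
    have sx: "s \<oplus> x \<in> carrier K - L" by (rule shift_notin[OF s x])
    have "L \<subseteq> translate s (P x)"
    proof
      fix t assume t: "t \<in> L"
      have "t = s \<oplus> (\<ominus> s \<oplus> t)" using sK L_closed(1)[OF t] by algebra
      moreover have "\<ominus> s \<oplus> t \<in> P x"
        using PL(1)[of x] L_closed(5)[OF L_closed(7)[OF s] t] by blast
      ultimately show "t \<in> translate s (P x)" unfolding translate_def by blast
    qed
    moreover have "s \<oplus> x \<in> translate s (P x)" unfolding translate_def using PL by blast
    ultimately have "P (s \<oplus> x) \<subseteq> translate s (P x)"
      unfolding P_def[of "s \<oplus> x"] using closed_set_translate[OF closP[OF sK(2)] sK(1)]
      by (intro plane_span_least) auto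
    moreover have "card (translate s (P x)) = q ^ 4" using card_translate[OF sK(1) PK[OF sK(2)]] cP[OF x] by simp
    moreover have "finite (translate s (P x))" using finP[OF sK(2)] unfolding translate_def by simp
    ultimately show ?thesis using cP[OF sx] by (metis card_subset_eq)
  qed
  have count: "card E * (q ^ 2 - 1) = q ^ (2 * n - 2) - 1"
  proof -
    have "carrier K - L = (\<Union>D\<in>E. D - L)"
    proof
      show "carrier K - L \<subseteq> (\<Union>D\<in>E. D - L)" unfolding E_def using PL(2) by blast
      show "(\<Union>D\<in>E. D - L) \<subseteq> carrier K - L"
      proof
        fix y assume "y \<in> (\<Union>D\<in>E. D - L)"
        then obtain x where x: "x \<in> carrier K" "y \<in> P x" "y \<notin> L" unfolding E_def by blast
        then show "y \<in> carrier K - L" using PK[OF x(1)] by blast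
      qed
    qed
    then have "card (carrier K - L) = card (\<Union>D\<in>E. D - L)" by simp
    also have "\<dots> = (\<Sum>D\<in>E. card (D - L))"
    proof (rule card_UN_disjoint[OF finE])
      show "\<forall>D\<in>E. finite (D - L)" unfolding E_def using finP by auto
      show "\<forall>D\<in>E. \<forall>D'\<in>E. D \<noteq> D' \<longrightarrow> (D - L) \<inter> (D' - L) = {}"
        unfolding E_def using Peq by blast
    qed
    also have "\<dots> = (\<Sum>D\<in>E. q ^ 4 - q ^ 2)"
    proof (rule sum.cong[OF refl])
      fix D assume "D \<in> E"
      then obtain x where x: "x \<in> carrier K - L" "D = P x" unfolding E_def by auto
      show "card (D - L) = q ^ 4 - q ^ 2"
        unfolding x(2) using cP[OF x(1)] card_L PL by (subst card_Diff_subset) auto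
    qed
    also have "\<dots> = card E * (q ^ 4 - q ^ 2)" by simp
    also have "q ^ 4 - q ^ 2 = q ^ 2 * (q ^ 2 - 1)"
      by (simp add: diff_mult_distrib2 power_add[symmetric])
    also have "card (carrier K - L) = q ^ 2 * (q ^ (2 * n - 2) - 1)"
    proof -
      have "q ^ (2 * n) = q ^ 2 * q ^ (2 * n - 2)"
      proof -
        have "2 * n = 2 + (2 * n - 2)" using n1 by simp
        then show ?thesis by (metis power_add)
      qed
      then show ?thesis using card_K card_L LK by (simp add: card_Diff_subset diff_mult_distrib2)
    qed
    finally have "q ^ 2 * (q ^ (2 * n - 2) - 1) = card E * (q ^ 2 * (q ^ 2 - 1))" .
    then have "q ^ 2 * (q ^ (2 * n - 2) - 1) = q ^ 2 * (card E * (q ^ 2 - 1))" by (simp only: ac_simps)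
    moreover have "q ^ 2 \<noteq> 0" using q2 by simp
    ultimately show ?thesis by (simp only: mult_cancel1) simp
  qed
  have "\<not> p dvd card E"
  proof
    assume "p dvd card E"
    then have "p dvd q ^ (2 * n - 2) - 1" unfolding count[symmetric] by simp
    moreover have "p dvd q" using e q by simp
    then have "p dvd q ^ (2 * n - 2)" by (rule dvd_trans[OF _ dvd_power]) (use n1 in simp)
    moreover have "1 \<le> q ^ (2 * n - 2)" using q2 by (intro one_le_power) simp
    ultimately have "p dvd 1" by (metis dvd_diffD1)
    then show False using p by simp
  qed
  \<comment> \<open>The group of translations by elements of \<open>L\<close>, acting on the planes.\<close>
  define G where "G = \<lparr>carrier = L, monoid.mult = (\<lambda>x y. x \<oplus> y), one = \<zero>\<rparr>"
  have gG: "group G"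
  proof (rule groupI)
    fix x assume "x \<in> carrier G"
    then have x: "x \<in> L" by (simp add: G_def)
    then show "\<exists>y\<in>carrier G. y \<otimes>\<^bsub>G\<^esub> x = \<one>\<^bsub>G\<^esub>"
      using L_closed(7)[OF x] L_closed(1)[OF x] l_neg unfolding G_def by (intro bexI[of _ "\<ominus> x"]) auto
  qed (auto simp: G_def a_assoc)
  define \<phi> where "\<phi> s = (\<lambda>D\<in>E. translate s D)" for s
  have \<phi>E: "translate s D \<in> E" if "s \<in> L" "D \<in> E" for s D
    using that transP shift_notin unfolding E_def by blast
  have EK: "D \<subseteq> carrier K" if "D \<in> E" for D using that PK unfolding E_def by auto
  have \<phi>_Bij: "\<phi> s \<in> Bij E" if s: "s \<in> L" for s
  proof -
    have "bij_betw (\<phi> s) E E"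
    proof (rule bij_betwI[where g = "\<phi> (\<ominus> s)"])
      show "\<phi> s \<in> E \<rightarrow> E" "\<phi> (\<ominus> s) \<in> E \<rightarrow> E" using \<phi>E s L_closed(7)[OF s] unfolding \<phi>_def by auto
      show "\<phi> (\<ominus> s) (\<phi> s D) = D" "\<phi> s (\<phi> (\<ominus> s) D) = D" if "D \<in> E" for D
        using that \<phi>E[OF s that] \<phi>E[OF L_closed(7)[OF s] that] EK[OF that] L_closed(1)[OF s]
        unfolding \<phi>_def by (auto simp: translate_translate translate_zero l_neg r_neg)
    qed
    then show ?thesis unfolding Bij_def \<phi>_def by simp
  qed
  have "group_hom G (BijGroup E) \<phi>"
  proof (rule group_hom.intro[OF gG group_BijGroup], unfold group_hom_axioms_def hom_def, safe)
    fix s assume "s \<in> carrier G"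
    then show "\<phi> s \<in> carrier (BijGroup E)" using \<phi>_Bij by (simp add: G_def BijGroup_def)
  next
    fix s t assume "s \<in> carrier G" "t \<in> carrier G"
    then have st: "s \<in> L" "t \<in> L" by (auto simp: G_def)
    have "\<phi> (s \<oplus> t) = compose E (\<phi> s) (\<phi> t)"
      unfolding \<phi>_def compose_def
      by (rule restrict_ext) (use \<phi>E st EK in \<open>auto simp: translate_translate\<close>)
    then show "\<phi> (s \<otimes>\<^bsub>G\<^esub> t) = \<phi> s \<otimes>\<^bsub>BijGroup E\<^esub> \<phi> t"
      using \<phi>_Bij st by (simp add: G_def BijGroup_def)
  qed
  then interpret act: group_action G E \<phi> by (rule group_action.intro)
  have ord: "order G = p ^ (e * 2)" using card_L unfolding order_def G_def q by (simp add: power_mult)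
  then obtain W where W: "W \<in> E" "\<And>s. s \<in> L \<Longrightarrow> translate s W = W"
    using act.p_group_fixed_point[OF p ord finE \<open>\<not> p dvd card E\<close>] unfolding G_def \<phi>_def by auto
  obtain x where x: "x \<in> carrier K - L" "W = P x" using W(1) unfolding E_def by auto
  have WK: "W \<subseteq> carrier K" and cW: "card W = q ^ 4" and clW: "closed_set space W"
    and LW: "L \<subseteq> W" and xW: "x \<in> W"
    using x PK cP closP PL by auto
  \<comment> \<open>Together with \<open>0\<close> and a nonzero point, \<open>W\<close> contains the line joining them.\<close>
  have spread_sub: "dilate k L \<subseteq> W" if k: "k \<in> C" and s: "s \<in> L" "s \<noteq> \<zero>" "k \<otimes> s \<in> W" for k s
  proof -
    have kK: "k \<in> carrier K" "k \<noteq> \<zero>" using k by auto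
    have "\<zero> \<in> W" using LW by auto
    moreover have "k \<otimes> s \<noteq> \<zero>" using kK s integral[of k s] by auto
    moreover have "k \<otimes> s \<in> dilate k L" "\<zero> \<in> dilate k L" using s dilate_L_F_module(2)[OF kK(1)] unfolding dilate_def by auto
    ultimately have "points_on space (dilate k L) \<subseteq> W"
      using closed_set_line[OF clW dilate_L_line[OF k] _ s(3), of \<zero>] by auto
    then show ?thesis using points_on_line[OF dilate_L_line[OF k]] by simp
  qed
  have x0: "x \<noteq> \<zero>" using x(1) by auto
  obtain k s where ks: "k \<in> C" "s \<in> L" "s \<noteq> \<zero>" "x = k \<otimes> s" using spread_cover[of x] x x0 by auto
  have kK: "k \<in> carrier K" "k \<noteq> \<zero>" using ks by auto
  have kW: "dilate k L \<subseteq> W" using spread_sub[OF ks(1-3)] ks(4) xW by simp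
  have xk: "x \<in> dilate k L" using ks unfolding dilate_def by auto
  have oneL: "dilate \<one> L = L" by (rule dilate_one) auto
  have disj: "w = \<zero>" if "w \<in> dilate k L" "w \<in> L" for w
  proof (rule ccontr)
    assume "w \<noteq> \<zero>"
    then have "dilate k L = L" using spread_unique[OF ks(1) C_closed(3), of w] that unfolding oneL by blast
    then show False using xk x(1) by blast
  qed
  let ?f = "\<lambda>(s, y). s \<oplus> y"
  have "inj_on ?f (L \<times> dilate k L)"
  proof (rule inj_onI)
    fix u u' assume u: "u \<in> L \<times> dilate k L" "u' \<in> L \<times> dilate k L" and eq0: "?f u = ?f u'"
    obtain s y s' y' where uu: "u = (s, y)" "u' = (s', y')" by (metis surj_pair)
    have h: "s \<in> L" "y \<in> dilate k L" "s' \<in> L" "y' \<in> dilate k L" and eq: "s \<oplus> y = s' \<oplus> y'" using u eq0 uu by auto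
    have c: "s \<in> carrier K" "y \<in> carrier K" "s' \<in> carrier K" "y' \<in> carrier K"
      using h dilate_L_F_module(1)[OF kK(1)] by auto
    have "y \<ominus> y' = (s \<oplus> y) \<ominus> (s' \<oplus> y') \<oplus> (s' \<ominus> s)" using c by algebra
    also have "\<dots> = s' \<ominus> s" unfolding eq using c by algebra
    finally have e1: "y \<ominus> y' = s' \<ominus> s" .
    have "s' \<ominus> s \<in> L" by (rule F_module_minus[OF F_module_L h(3,1)])
    then have "y \<ominus> y' = \<zero>" using disj dilate_L_minus[OF kK(1) h(2,4)] e1 by simp
    then have "y = y'" "s = s'" using e1 c by auto
    then show "u = u'" using uu by simp
  qed
  then have "card (?f ` (L \<times> dilate k L)) = q ^ 4"
    using card_L card_dilate[OF kK LK] by (simp add: card_image card_cartesian_product power_add[symmetric])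
  moreover have "?f ` (L \<times> dilate k L) \<subseteq> W" using W(2) kW unfolding translate_def by auto
  ultimately have W_sum: "W = ?f ` (L \<times> dilate k L)"
    using cW finite_subset_carrier[OF WK] by (metis card_subset_eq)
  have addW: "w \<oplus> w' \<in> W" if w: "w \<in> W" "w' \<in> W" for w w'
  proof -
    obtain s y s' y' where h: "s \<in> L" "y \<in> dilate k L" "s' \<in> L" "y' \<in> dilate k L" "w = s \<oplus> y" "w' = s' \<oplus> y'"
      using w unfolding W_sum by auto
    have c: "s \<in> carrier K" "y \<in> carrier K" "s' \<in> carrier K" "y' \<in> carrier K"
      using h dilate_L_F_module(1)[OF kK(1)] by auto
    have "w \<oplus> w' = (s \<oplus> s') \<oplus> (y \<oplus> y')" unfolding h(5,6) using c by algebra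
    moreover have "y \<oplus> y' \<in> dilate k L" by (rule dilate_L_F_module(5)[OF kK(1) h(2,4)])
    ultimately show ?thesis using h(1,3) unfolding W_sum by auto
  qed
  show False
    by (rule no_spread_closed_plane[OF WK cW _ addW spread_sub]) (use LW in auto)
qed

lemma not_desarguesian: "\<not> desarguesian q n space"
proof
  assume "desarguesian q n space"
  then obtain R :: "nat ring" where R: "finite_field_of_order R (q ^ 2)"
    and iso: "isomorphic_spaces space (desarguesian_affine_space R n)"
    unfolding desarguesian_def by blast
  interpret R: field R using R by (simp add: finite_field_of_order_def)
  have "planes_have_card (desarguesian_affine_space R n) ((q ^ 2) ^ 2)"
    using R.planes_have_card_affine_space[of n] R Q_bounds by (simp add: finite_field_of_order_def)
  then have "planes_have_card space (q ^ 4)"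
    using planes_have_card_iso[OF iso] by (simp add: power_mult[symmetric])
  then show False using not_planes_have_card by blast
qed

end

section \<open>The one-dimensional affine group\<close>

context kummer_generator
begin

definition affine_map :: "'a \<Rightarrow> 'a \<Rightarrow> 'a \<Rightarrow> 'a" where
  "affine_map a v = (\<lambda>x\<in>carrier K. a \<otimes> x \<oplus> v)"

definition affine_line_map :: "'a \<Rightarrow> 'a \<Rightarrow> 'a set \<Rightarrow> 'a set" where
  "affine_line_map a v = (\<lambda>l\<in>lines space. affine_map a v ` l)"

definition affine_group :: "(('a \<Rightarrow> 'a) \<times> ('a set \<Rightarrow> 'a set)) set" where
  "affine_group = {(affine_map a v, affine_line_map a v) |a v. a \<in> C \<and> v \<in> carrier K}"

lemma affine_map_closed: "a \<in> carrier K \<Longrightarrow> v \<in> carrier K \<Longrightarrow> x \<in> carrier K \<Longrightarrow> affine_map a v x \<in> carrier K"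
  unfolding affine_map_def by simp

lemma affine_map_comp:
  assumes "a \<in> carrier K" "v \<in> carrier K" "a' \<in> carrier K" "v' \<in> carrier K" "x \<in> carrier K"
  shows "affine_map a v (affine_map a' v' x) = affine_map (a \<otimes> a') (a \<otimes> v' \<oplus> v) x"
  unfolding affine_map_def using assms by (simp add: r_distr m_assoc a_assoc)

lemma affine_map_one: "x \<in> carrier K \<Longrightarrow> affine_map \<one> \<zero> x = x"
  unfolding affine_map_def by simp

lemma affine_map_inverse:
  assumes "a \<in> C" "v \<in> carrier K" "x \<in> carrier K"
  shows "affine_map (inv a) (\<ominus> (inv a \<otimes> v)) (affine_map a v x) = x"
    "affine_map a v (affine_map (inv a) (\<ominus> (inv a \<otimes> v)) x) = x"
proof -
  have a: "a \<in> carrier K" "a \<noteq> \<zero>" using assms by auto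
  have i: "inv a \<in> carrier K" using a by simp
  have e: "a \<otimes> \<ominus> (inv a \<otimes> v) \<oplus> v = \<zero>"
    using a i assms(2) by (simp add: r_minus m_assoc[symmetric] l_neg)
  show "affine_map (inv a) (\<ominus> (inv a \<otimes> v)) (affine_map a v x) = x"
    using a i assms by (subst affine_map_comp) (auto simp: r_neg affine_map_one)
  show "affine_map a v (affine_map (inv a) (\<ominus> (inv a \<otimes> v)) x) = x"
    using a i assms by (subst affine_map_comp) (auto simp: e affine_map_one)
qed

lemma affine_map_line:
  assumes a: "a \<in> C" and v: "v \<in> carrier K" and u: "u \<in> carrier K" and k: "k \<in> C"
  shows "affine_map a v ` translate u (dilate k L) = translate (a \<otimes> u \<oplus> v) (dilate (a \<otimes> k) L)"
  unfolding translate_def dilate_def image_image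
proof (intro image_cong refl)
  fix s assume "s \<in> L"
  then have c: "s \<in> carrier K" "a \<in> carrier K" "k \<in> carrier K" using a k by auto
  have "a \<otimes> (u \<oplus> k \<otimes> s) \<oplus> v = (a \<otimes> u \<oplus> v) \<oplus> a \<otimes> k \<otimes> s" using c u v by algebra
  then show "affine_map a v (u \<oplus> k \<otimes> s) = (a \<otimes> u \<oplus> v) \<oplus> a \<otimes> k \<otimes> s"
    unfolding affine_map_def using c u by simp
qed

lemma affine_map_lines:
  assumes a: "a \<in> C" and v: "v \<in> carrier K" and l: "l \<in> lines space"
  shows "affine_map a v ` l \<in> lines space"
proof -
  obtain u k where uk: "u \<in> carrier K" "k \<in> C" "l = translate u (dilate k L)" using l by auto
  have "a \<in> carrier K" using a by auto
  then show ?thesis unfolding uk(3) affine_map_line[OF a v uk(1,2)]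
    using a v uk by (intro line_in_space) auto
qed

lemma affine_map_image_comp:
  assumes "a \<in> C" "v \<in> carrier K" "a' \<in> C" "v' \<in> carrier K" "l \<in> lines space"
  shows "affine_map a v ` affine_map a' v' ` l = affine_map (a \<otimes> a') (a \<otimes> v' \<oplus> v) ` l"
  unfolding image_image
proof (intro image_cong refl)
  fix x assume "x \<in> l"
  then have "x \<in> carrier K" using line_closed assms(5) by blast
  then show "affine_map a v (affine_map a' v' x) = affine_map (a \<otimes> a') (a \<otimes> v' \<oplus> v) x"
    using assms by (intro affine_map_comp) auto
qed

lemma affine_inverse_closed:
  "a \<in> C \<Longrightarrow> v \<in> carrier K \<Longrightarrow> inv a \<in> C \<and> \<ominus> (inv a \<otimes> v) \<in> carrier K"
  by (auto intro!: a_inv_closed m_closed)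

lemma affine_map_Bij:
  assumes a: "a \<in> C" and v: "v \<in> carrier K"
  shows "affine_map a v \<in> Bij (points space)"
proof -
  have "bij_betw (affine_map a v) (carrier K) (carrier K)"
  proof (rule bij_betwI[where g = "affine_map (inv a) (\<ominus> (inv a \<otimes> v))"])
    show "affine_map a v \<in> carrier K \<rightarrow> carrier K"
      using a v affine_map_closed by auto
    show "affine_map (inv a) (\<ominus> (inv a \<otimes> v)) \<in> carrier K \<rightarrow> carrier K"
      using affine_inverse_closed[OF a v] affine_map_closed by auto
  qed (use affine_map_inverse[OF a v] in auto)
  then show ?thesis unfolding Bij_def by (simp add: affine_map_def)
qed

lemma affine_line_map_Bij:
  assumes a: "a \<in> C" and v: "v \<in> carrier K"
  shows "affine_line_map a v \<in> Bij (lines space)"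
proof -
  note inv = affine_inverse_closed[OF a v]
  have id: "(\<lambda>x. affine_map (inv a) (\<ominus> (inv a \<otimes> v)) (affine_map a v x)) ` l = l"
    "(\<lambda>x. affine_map a v (affine_map (inv a) (\<ominus> (inv a \<otimes> v)) x)) ` l = l" if "l \<in> lines space" for l
    using affine_map_inverse[OF a v] line_closed[OF that] by (auto simp: subset_iff image_iff)
  have "bij_betw (affine_line_map a v) (lines space) (lines space)"
  proof (rule bij_betwI[where g = "affine_line_map (inv a) (\<ominus> (inv a \<otimes> v))"])
    show "affine_line_map a v \<in> lines space \<rightarrow> lines space"
      unfolding affine_line_map_def using affine_map_lines[OF a v] by simp
    show "affine_line_map (inv a) (\<ominus> (inv a \<otimes> v)) \<in> lines space \<rightarrow> lines space"
      unfolding affine_line_map_def using affine_map_lines inv by simp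
    show "affine_line_map (inv a) (\<ominus> (inv a \<otimes> v)) (affine_line_map a v l) = l" if "l \<in> lines space" for l
      unfolding affine_line_map_def using that affine_map_lines[OF a v that] id(1)[OF that]
      by (simp del: space_simps(2) add: image_image)
    show "affine_line_map a v (affine_line_map (inv a) (\<ominus> (inv a \<otimes> v)) l) = l" if "l \<in> lines space" for l
      unfolding affine_line_map_def using that affine_map_lines[OF _ _ that, of "inv a" "\<ominus> (inv a \<otimes> v)"] inv id(2)[OF that]
      by (simp del: space_simps(2) add: image_image)
  qed
  then show ?thesis unfolding Bij_def by (simp add: affine_line_map_def del: space_simps(2))
qed

lemma affine_incidence:
  assumes a: "a \<in> C" and v: "v \<in> carrier K" and x: "x \<in> points space" and l: "l \<in> lines space"
  shows "inc space (affine_map a v x) (affine_line_map a v l) \<longleftrightarrow> inc space x l"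
proof -
  have xK: "x \<in> carrier K" using x by simp
  have "inj_on (affine_map a v) (carrier K)"
    using affine_map_Bij[OF a v] unfolding Bij_def bij_betw_def by simp
  then have "affine_map a v x \<in> affine_map a v ` l \<longleftrightarrow> x \<in> l"
    using inj_on_image_mem_iff[OF _ xK line_closed[OF l]] by blast
  then show ?thesis using l unfolding affine_line_map_def by (simp del: space_simps(2))
qed

lemma mult_Aut_space:
  assumes "f \<in> Bij (points S)" "f' \<in> Bij (points S)" "g \<in> Bij (lines S)" "g' \<in> Bij (lines S)"
  shows "(f, g) \<otimes>\<^bsub>Aut_space S\<^esub> (f', g') = (compose (points S) f f', compose (lines S) g g')"
  using assms unfolding Aut_space_def DirProd_def BijGroup_def by simp

lemma one_Aut_space: "\<one>\<^bsub>Aut_space S\<^esub> = ((\<lambda>x\<in>points S. x), (\<lambda>l\<in>lines S. l))"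
  unfolding Aut_space_def DirProd_def BijGroup_def by simp

lemma affine_group_mult:
  assumes a: "a \<in> C" "v \<in> carrier K" "a' \<in> C" "v' \<in> carrier K"
  shows "(affine_map a v, affine_line_map a v) \<otimes>\<^bsub>Aut_space space\<^esub> (affine_map a' v', affine_line_map a' v')
    = (affine_map (a \<otimes> a') (a \<otimes> v' \<oplus> v), affine_line_map (a \<otimes> a') (a \<otimes> v' \<oplus> v))"
proof -
  have "compose (points space) (affine_map a v) (affine_map a' v') = affine_map (a \<otimes> a') (a \<otimes> v' \<oplus> v)"
  proof
    fix x
    show "compose (points space) (affine_map a v) (affine_map a' v') x = affine_map (a \<otimes> a') (a \<otimes> v' \<oplus> v) x"
    proof (cases "x \<in> carrier K")
      case True
      then show ?thesis using a by (simp add: compose_def affine_map_comp)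
    next
      case False
      then show ?thesis by (simp add: compose_def affine_map_def)
    qed
  qed
  moreover have "compose (lines space) (affine_line_map a v) (affine_line_map a' v') = affine_line_map (a \<otimes> a') (a \<otimes> v' \<oplus> v)"
  proof
    fix l
    show "compose (lines space) (affine_line_map a v) (affine_line_map a' v') l = affine_line_map (a \<otimes> a') (a \<otimes> v' \<oplus> v) l"
      using affine_map_lines[OF a(3,4), of l] affine_map_image_comp[OF a, of l]
      by (simp add: compose_def affine_line_map_def del: space_simps(2))
  qed
  ultimately show ?thesis
    by (subst mult_Aut_space) (use affine_map_Bij affine_line_map_Bij a in auto)
qed

lemma affine_one: "(affine_map \<one> \<zero>, affine_line_map \<one> \<zero>) = \<one>\<^bsub>Aut_space space\<^esub>"
proof -
  have "affine_map \<one> \<zero> = (\<lambda>x\<in>points space. x)"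
    unfolding affine_map_def by (auto simp: restrict_def)
  moreover have "affine_map \<one> \<zero> ` l = l" if "l \<in> lines space" for l
    using affine_map_one line_closed[OF that] by (force simp: subset_iff)
  then have "affine_line_map \<one> \<zero> = (\<lambda>l\<in>lines space. l)"
    unfolding affine_line_map_def by (intro restrict_ext) simp
  ultimately show ?thesis unfolding one_Aut_space by simp
qed

lemma affine_group_subgroup: "automorphism_group space affine_group"
proof -
  interpret A: group "Aut_space space" by (rule group_Aut_space)
  have sub: "affine_group \<subseteq> carrier (Aut_space space)"
    unfolding affine_group_def Aut_space_def
    using affine_map_Bij affine_line_map_Bij affine_incidence by (auto simp del: space_simps)
  show ?thesis
  proof (rule A.subgroupI[OF sub])
    show "affine_group \<noteq> {}" unfolding affine_group_def using C_closed(3) zero_closed by blast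
  next
    fix h assume h: "h \<in> affine_group"
    then obtain a v where av: "a \<in> C" "v \<in> carrier K" "h = (affine_map a v, affine_line_map a v)"
      unfolding affine_group_def by blast
    have aK: "a \<in> carrier K" "a \<noteq> \<zero>" using av by auto
    let ?a = "inv a" and ?v = "\<ominus> (inv a \<otimes> v)"
    let ?h = "(affine_map ?a ?v, affine_line_map ?a ?v)"
    note inv = affine_inverse_closed[OF av(1,2)]
    have hG: "?h \<in> affine_group" unfolding affine_group_def using inv by blast
    have "?h \<otimes>\<^bsub>Aut_space space\<^esub> h = (affine_map (?a \<otimes> a) (?a \<otimes> v \<oplus> ?v), affine_line_map (?a \<otimes> a) (?a \<otimes> v \<oplus> ?v))"
      unfolding av(3) using affine_group_mult[of ?a ?v a v] inv av by blast
    also have "\<dots> = \<one>\<^bsub>Aut_space space\<^esub>"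
      unfolding affine_one[symmetric] using aK av(2) by (simp add: r_neg)
    finally have "inv\<^bsub>Aut_space space\<^esub> h = ?h"
      using sub h hG by (intro A.inv_equality) auto
    then show "inv\<^bsub>Aut_space space\<^esub> h \<in> affine_group" using hG by simp
  next
    fix h h' assume "h \<in> affine_group" "h' \<in> affine_group"
    then obtain a v a' v' where av: "a \<in> C" "v \<in> carrier K" "h = (affine_map a v, affine_line_map a v)"
      "a' \<in> C" "v' \<in> carrier K" "h' = (affine_map a' v', affine_line_map a' v')"
      unfolding affine_group_def by blast
    have "a \<otimes> a' \<in> C" "a \<otimes> v' \<oplus> v \<in> carrier K" using av by auto
    then show "h \<otimes>\<^bsub>Aut_space space\<^esub> h' \<in> affine_group"
      unfolding av(3,6) affine_group_mult[OF av(1,2,4,5)] unfolding affine_group_def by blast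
  qed
qed

text \<open>The flag \<open>(x, x + k L)\<close> goes to \<open>(y, y + k' L)\<close> under \<open>z \<mapsto> (k' / k) (z - x) + y\<close>.\<close>

lemma affine_group_flag_transitive: "flag_transitive_group space affine_group"
proof -
  have tr: "\<exists>(f, g)\<in>affine_group. f x = y \<and> g l = m"
    if xl: "x \<in> carrier K" "l \<in> lines space" "x \<in> l" and ym: "y \<in> carrier K" "m \<in> lines space" "y \<in> m" for x l y m
  proof -
    obtain u k where uk: "u \<in> carrier K" "k \<in> C" "l = translate u (dilate k L)" using xl by auto
    obtain u' k' where uk': "u' \<in> carrier K" "k' \<in> C" "m = translate u' (dilate k' L)" using ym by auto
    have kK: "k \<in> carrier K" "k \<noteq> \<zero>" "k' \<in> carrier K" using uk uk' by auto
    have l: "l = translate x (dilate k L)" unfolding uk(3) using xl(3) uk kK by (intro line_base_point) auto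
    have m: "m = translate y (dilate k' L)" unfolding uk'(3) using ym(3) uk' kK by (intro line_base_point) auto
    let ?a = "k' \<otimes> inv k" let ?v = "y \<ominus> ?a \<otimes> x"
    have a: "?a \<in> C" using uk uk' by auto
    have aK: "?a \<in> carrier K" using a by auto
    have v: "?v \<in> carrier K" using aK ym xl by simp
    have ax: "?a \<otimes> x \<oplus> ?v = y" using aK xl(1) ym(1) by algebra
    have ak: "?a \<otimes> k = k'" using kK by (simp add: m_assoc)
    have "affine_map ?a ?v x = y" unfolding affine_map_def using xl(1) ax by simp
    moreover have "affine_line_map ?a ?v l = m"
    proof -
      have "affine_line_map ?a ?v l = affine_map ?a ?v ` l"
        unfolding affine_line_map_def using xl(2) by (simp del: space_simps(2))
      also have "\<dots> = m" unfolding l m affine_map_line[OF a v xl(1) uk(2)] ax ak by simp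
      finally show ?thesis .
    qed
    moreover have "(affine_map ?a ?v, affine_line_map ?a ?v) \<in> affine_group"
      unfolding affine_group_def using a v by blast
    ultimately show ?thesis by blast
  qed
  show ?thesis
    unfolding flag_transitive_group_def flags_def
    using affine_group_subgroup tr by (auto simp del: space_simps(2))
qed

lemma induced_perms_affine_group:
  "induced_perms space K id affine_group = {affine_map a v |a v. a \<in> C \<and> v \<in> carrier K}"
proof -
  have e: "(\<lambda>x\<in>carrier K. id (affine_map a v (inv_into (points space) id x))) = affine_map a v" for a v
  proof
    fix x
    have "inv_into (carrier K) id x = x" if "x \<in> carrier K"
      using inv_into_f_f[of id "carrier K" x] that by simp
    then show "(\<lambda>x\<in>carrier K. id (affine_map a v (inv_into (points space) id x))) x = affine_map a v x"
      by (simp add: affine_map_def)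
  qed
  have "affine_group = (\<lambda>(a, v). (affine_map a v, affine_line_map a v)) ` (C \<times> carrier K)"
    unfolding affine_group_def by auto
  then have "induced_perms space K id affine_group = (\<lambda>(a, v). affine_map a v) ` (C \<times> carrier K)"
    unfolding induced_perms_def by (simp only: image_image split_def fst_conv snd_conv e)
  then show ?thesis by auto
qed

lemma translation_perms_affine: "translation_perms K \<subseteq> induced_perms space K id affine_group"
proof
  fix f assume "f \<in> translation_perms K"
  then obtain v where v: "v \<in> carrier K" "f = (\<lambda>x\<in>carrier K. x \<oplus> v)" unfolding translation_perms_def by blast
  have "f = affine_map \<one> v" unfolding v(2) affine_map_def by (intro restrict_ext) simp
  then show "f \<in> induced_perms space K id affine_group"
    unfolding induced_perms_affine_group using v(1) C_closed(3) by blast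
qed

lemma affine_group_AGammaL1: "induced_perms space K id affine_group \<subseteq> AGammaL1 K"
proof
  fix f assume "f \<in> induced_perms space K id affine_group"
  then obtain a v where av: "a \<in> C" "v \<in> carrier K" "f = affine_map a v"
    unfolding induced_perms_affine_group by blast
  have id: "id \<in> ring_iso K K" by (rule ring_iso_set_refl)
  have "f = (\<lambda>x\<in>carrier K. a \<otimes> id x \<oplus> v)" unfolding av(3) affine_map_def by simp
  moreover have "a \<in> carrier K - {\<zero>}" using av(1) by auto
  ultimately show "f \<in> AGammaL1 K" unfolding AGammaL1_def using av(2) id by blast
qed

end

section \<open>Existence of the linear spaces\<close>

text \<open>The order \<open>n (q^2 - 1)\<close> divides \<open>q^(2 n) - 1\<close>, because \<open>n\<close> divides the repunit of length \<open>n\<close> in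
\<open>q^2\<close>; take a power of a primitive element.\<close>

lemma (in field) exists_kummer_generator:
  fixes q n :: nat
  assumes fin: "finite (carrier R)" and card: "card (carrier R) = q ^ (2 * n)"
    and q: "2 \<le> q" and n: "odd n"
    and primes: "\<And>r. Factorial_Ring.prime r \<Longrightarrow> r dvd n \<Longrightarrow> r dvd q + 1"
  shows "\<exists>b\<in>carrier R - {\<zero>}. \<forall>k::nat. b [^] k = \<one> \<longleftrightarrow> n * (q ^ 2 - 1) dvd k"
proof -
  let ?Q = "q ^ 2"
  have Q: "1 \<le> ?Q" "?Q - 1 = (q - 1) * (q + 1)"
    using q by (cases q; simp add: power2_eq_square)+
  have cong: "[?Q = 1] (mod r)" if "Factorial_Ring.prime r" "r dvd n" for r
  proof -
    have "r dvd ?Q - 1" unfolding Q(2) by (intro dvd_mult primes that)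
    moreover have "[?Q = 1] (mod r) \<longleftrightarrow> r dvd ?Q - 1" using Q(1) by (intro cong_altdef_nat) simp
    ultimately show ?thesis by blast
  qed
  have "n dvd (\<Sum>i<n. ?Q ^ i)" using dvd_repunit_iff[OF n _ cong, of n] q by simp
  then obtain m where m: "(\<Sum>i<n. ?Q ^ i) = n * m" by blast
  have N: "card (carrier R) - 1 = m * (n * (?Q - 1))"
    unfolding card power_mult repunit_geometric[symmetric] m by (simp only: ac_simps)
  have "(\<Sum>i<n. ?Q ^ i) \<noteq> 0" using n q by (auto intro!: Nat.gr0I simp: odd_pos)
  then have m0: "m \<noteq> 0" unfolding m by simp
  obtain g where g: "g \<in> carrier R" "g \<noteq> \<zero>" "\<And>k::nat. g [^] k = \<one> \<longleftrightarrow> card (carrier R) - 1 dvd k"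
    using exists_primitive_element[OF fin] by blast
  have "(g [^] m) [^] k = \<one> \<longleftrightarrow> n * (?Q - 1) dvd k" for k :: nat
    unfolding nat_pow_pow[OF g(1)] g(3) N using m0 by simp
  moreover have "g [^] m \<noteq> \<zero>" using nat_pow_eq_zeroD[OF g(1), of m] g(2) by blast
  ultimately show ?thesis using g(1) by blast
qed

theorem theorem1p1:
  fixes q d u t n :: nat
  assumes "primepow q"
    and "1 < d" and "odd d" and "d dvd q + 1"
    and "0 < u" and "u dvd d" and "u < d"
    and "0 < t"
    and "n = d ^ t * u"
  shows "\<exists>S :: (nat, nat set) incidence_structure.
    finite_linear_space S \<and> nontrivial_space S \<and> nondegenerate_space S \<and>
    card (points S) = q ^ (2 * n) \<and>
    (\<forall>l\<in>lines S. card (points_on S l) = q ^ 2) \<and>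
    flag_transitive_space S \<and>
    \<not> desarguesian q n S \<and>
    (\<exists>G. flag_transitive_group S G \<and> one_dimensional_affine S G)"
proof -
  obtain p e where pe: "Factorial_Ring.prime p" "0 < e" "q = p ^ e"
    using assms(1) unfolding primepow_def by blast
  have q2: "2 \<le> q" using primepow_gt_Suc_0[OF assms(1)] by simp
  have "odd u" using assms(3,6) by (meson dvd_trans)
  then have odd_n: "odd n" using assms(3,9) by simp
  have "1 < d ^ t" using assms(2,8) by (intro one_less_power)
  moreover have "d ^ t \<le> n" using assms(5,9) by simp
  ultimately have n1: "1 < n" by linarith
  have primes: "r dvd q + 1" if r: "Factorial_Ring.prime r" "r dvd n" for r
  proof -
    have "r dvd d ^ t \<or> r dvd u" using r assms(9) by (simp add: prime_dvd_mult_iff)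
    then have "r dvd d" using prime_dvd_power[OF r(1)] assms(6) dvd_trans by blast
    then show ?thesis using assms(4) dvd_trans by blast
  qed
  have qn: "q ^ (2 * n) = p ^ (e * (2 * n))" unfolding pe(3) by (simp add: power_mult)
  have "0 < e * (2 * n)" using pe n1 by simp
  then obtain K :: "nat ring" where K: "finite_field_of_order K (q ^ (2 * n))"
    unfolding qn using exists_finite_field_nat[OF pe(1)] by blast
  then interpret K: field K by (simp add: finite_field_of_order_def)
  have fin: "finite (carrier K)" "card (carrier K) = q ^ (2 * n)"
    using K by (simp_all add: finite_field_of_order_def)
  obtain b where b: "b \<in> carrier K" "b \<noteq> \<zero>\<^bsub>K\<^esub>"
    "\<And>k::nat. b [^]\<^bsub>K\<^esub> k = \<one>\<^bsub>K\<^esub> \<longleftrightarrow> n * (q ^ 2 - 1) dvd k"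
    using K.exists_kummer_generator[OF fin q2 odd_n primes] by blast
  interpret S: kummer_generator K p e q n b
    by unfold_locales (use fin pe odd_n n1 primes b in auto)
  have affine: "one_dimensional_affine S.space S.affine_group"
    unfolding one_dimensional_affine_def
  proof (intro conjI S.affine_group_subgroup exI)
    show "Factorial_Ring.prime p" by (rule pe(1))
    show "card (points S.space) = p ^ (e * (2 * n))" using fin(2) qn by simp
    show "finite_field_of_order K (p ^ (e * (2 * n)))" using K unfolding qn .
    show "bij_betw id (points S.space) (carrier K)" by simp
    show "translation_perms K \<subseteq> induced_perms S.space K id S.affine_group"
      by (rule S.translation_perms_affine)
    show "induced_perms S.space K id S.affine_group \<subseteq> AGammaL1 K"
      by (rule S.affine_group_AGammaL1)
  qed
  have lines: "card (points_on S.space l) = q ^ 2" if "l \<in> lines S.space" for l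
    using S.points_on_line[OF that] S.card_line[OF that] by simp
  have "flag_transitive_space S.space"
    unfolding flag_transitive_space_def using S.affine_group_flag_transitive by blast
  moreover have "\<exists>G. flag_transitive_group S.space G \<and> one_dimensional_affine S.space G"
    using S.affine_group_flag_transitive affine by blast
  moreover have "card (points S.space) = q ^ (2 * n)" using fin(2) by simp
  ultimately show ?thesis
    using S.finite_linear_space_space S.nontrivial_space_space S.nondegenerate_space_space
      lines S.not_desarguesian by blast
qed

end
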